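(* Let $p\in[2,+\infty)$. Let $J:\mathbb{R}\to\mathbb{R}$ be an even, smooth, bounded, nonnegative function with $\int_{\mathbb{R}}J(x)\,dx=1$ and $\operatorname{supp}J=[-1,1]$, and such that for some $r,R>0$ one has $J(z)\ge r$ for all $|z|<R$. Let $g:\mathbb{R}\to\mathbb{R}$ be a continuous function satisfying, for some $M>0$, $$\frac1M\le g(x)\le M\qquad\text{for all }x\in\mathbb{R}.$$ Let $u$ be a solution of $$\partial_tu(t,x)=\int_{\mathbb{R}}J\!\left(\frac{x-y}{g(y)}\right)\frac{u(t,y)}{g(y)}\,dy-u(t,x),\qquad x\in\mathbb{R},\ t\in[0,\infty),$$ with initial data $u(0,\cdot)=u_0\in L^1(\mathbb{R})\cap L^p(\mathbb{R})$. Then for some constant $C>0$ depending on $J$, $M$, $p$, $\|u_0\|_1$ and $\|u_0\|_p$, $$\|u(t,\cdot)\|_p^p\le C\,(1+t)^{-\frac{p-1}{2}}\qquad\text{for all }t\ge0.$$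
   Context: $\|\cdot\|_q$ denotes the norm of $L^q(\mathbb{R})$. A solution is understood as a function $u\in\mathcal{C}^1([0,+\infty),L^1(\mathbb{R})\cap L^p(\mathbb{R}))$ satisfying the equation with $u(0,\cdot)=u_0$. *)

theory Defs
  imports "HOL-Analysis.Analysis"
begin

text \<open>
  Elements of Lebesgue spaces are represented by Lebesgue measurable functions, so that equalities
  between them are required only almost everywhere.
\<close>

definition in_Lq :: "real \<Rightarrow> (real \<Rightarrow> real) \<Rightarrow> bool" where
  "in_Lq q f \<longleftrightarrow> f \<in> borel_measurable lebesgue \<and> integrable lebesgue (\<lambda>x. \<bar>f x\<bar> powr q)"

definition Lq_norm :: "real \<Rightarrow> (real \<Rightarrow> real) \<Rightarrow> real" where
  "Lq_norm q f = (LINT x|lebesgue. \<bar>f x\<bar> powr q) powr (1 / q)"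

definition in_L1_Lp :: "real \<Rightarrow> (real \<Rightarrow> real) \<Rightarrow> bool" where
  "in_L1_Lp p f \<longleftrightarrow> in_Lq 1 f \<and> in_Lq p f"

definition L1_Lp_norm :: "real \<Rightarrow> (real \<Rightarrow> real) \<Rightarrow> real" where
  "L1_Lp_norm p f = Lq_norm 1 f + Lq_norm p f"

text \<open>
  \<open>C1_with_deriv p u v\<close>: the curve \<open>u\<close> is continuously differentiable from \<open>[0, \<infinity>)\<close> to the Banach
  space \<open>L\<^sup>1 \<inter> L\<^sup>p\<close>, with derivative \<open>v\<close> (one-sided at 0).
\<close>

definition C1_with_deriv :: "real \<Rightarrow> (real \<Rightarrow> real \<Rightarrow> real) \<Rightarrow> (real \<Rightarrow> real \<Rightarrow> real) \<Rightarrow> bool" where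
  "C1_with_deriv p u v \<longleftrightarrow>
     (\<forall>t\<ge>0. in_L1_Lp p (u t) \<and> in_L1_Lp p (v t)) \<and>
     (\<forall>t\<ge>0. ((\<lambda>s. L1_Lp_norm p (\<lambda>x. (u s x - u t x) / (s - t) - v t x)) \<longlongrightarrow> 0)
              (at t within {0..})) \<and>
     (\<forall>t\<ge>0. ((\<lambda>s. L1_Lp_norm p (\<lambda>x. v s x - v t x)) \<longlongrightarrow> 0) (at t within {0..}))"

definition is_solution ::
  "real \<Rightarrow> (real \<Rightarrow> real) \<Rightarrow> (real \<Rightarrow> real) \<Rightarrow> (real \<Rightarrow> real) \<Rightarrow> (real \<Rightarrow> real \<Rightarrow> real) \<Rightarrow> bool" where
  "is_solution p J g u0 u \<longleftrightarrow>
     (\<exists>v. C1_with_deriv p u v \<and>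
        (\<forall>t\<ge>0. AE x in lebesgue.
           v t x = (LINT y|lebesgue. J ((x - y) / g y) * (u t y / g y)) - u t x)) \<and>
     (AE x in lebesgue. u 0 x = u0 x)"

definition smooth_fun :: "(real \<Rightarrow> real) \<Rightarrow> bool" where
  "smooth_fun f \<longleftrightarrow> (\<forall>k x. (deriv ^^ k) f field_differentiable at x)"

end

theory Submission
  imports Defs
begin

text \<open>
  Write \<open>k x y = J ((x - y) / g y) / g y\<close> and let \<open>K\<close> be the integral operator with kernel \<open>k\<close>, so
  that the equation reads \<open>u' = K u - u\<close>. As a function of \<open>x\<close>, \<open>k x y\<close> is a probability density
  that is even about \<open>y\<close>, supported in \<open>[y - M, y + M]\<close>, bounded, and bounded below near \<open>y\<close>, with
  constants that do not depend on \<open>g\<close>. Nothing else about \<open>J\<close> and \<open>g\<close> is used; the locale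
  \<open>jump_kernel\<close> records these properties.

  \<^bold>\<open>The weight.\<close> As \<open>K\<close> need not be symmetric nor contract \<open>L\<^sup>p\<close>, the \<open>L\<^sup>p\<close> norm is replaced by the
  energy \<open>\<Phi> u = \<integral> w\<^sup>1\<^sup>-\<^sup>p \<bar>u\<bar>\<^sup>p\<close> for a weight \<open>w\<close> with \<open>K w \<le> (1 + \<nu>) w\<close> that lies between two positive
  constants independent of \<open>g\<close> and of \<open>\<nu> \<in> (0, 1]\<close> (\<open>exists_weight\<close>). It is the minimal solution of
  \<open>w = (1 - \<theta>) + \<theta> K w\<close> with \<open>\<theta> = 1 / (1 + \<nu>)\<close>, the Abel mean of the functions \<open>K\<^sup>n 1\<close>. Its bounds
  come from testing this equation with \<open>\<phi> y = exp (- \<epsilon> \<bar>y - c\<bar>)\<close>, where \<open>\<epsilon>\<close> is of the order of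
  \<open>\<nu>\<^sup>1\<^sup>/\<^sup>2\<close>. As \<open>k\<close> is even, the adjoint of \<open>K\<close> multiplies \<open>\<phi>\<close> by \<open>1 + O(\<epsilon>\<^sup>2)\<close> away from the kink \<open>c\<close>,
  and lowers it by an amount of the order of \<open>\<epsilon>\<close> near \<open>c\<close>. Hence the mass of \<open>w\<close> near \<open>c\<close> is
  comparable to \<open>\<nu> / \<epsilon>\<^sup>2\<close>, that is, to a constant, and the equation turns bounds on local masses into
  pointwise bounds.

  \<^bold>\<open>Dissipation.\<close> Let \<open>q = u / w\<close> and \<open>v = \<bar>q\<bar>\<^sup>p\<^sup>/\<^sup>2\<close>. For \<open>p \<ge> 2\<close>, Jensen's inequality for \<open>\<bar>q\<bar>\<^sup>p\<close> holds
  with the variance of \<open>v\<close> as a remainder (\<open>jensen_defect\<close>). Applied to the measures \<open>k x y w y dy\<close>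
  and integrated over \<open>x\<close>, it gives \<open>\<Phi> (K u) \<le> (1 + \<nu>)\<^sup>p\<^sup>-\<^sup>1 (\<Phi> u - c D)\<close>, where \<open>D\<close> is the integral
  over \<open>0 < h < \<rho>\<close> of the squared \<open>L\<^sup>2\<close> distance between \<open>v\<close> and its translate by \<open>h\<close>
  (\<open>weighted_energy_defect\<close>). A Nash inequality bounds \<open>D\<close> below by the \<open>L\<^sup>1\<close> and \<open>L\<^sup>2\<close> norms of \<open>v\<close>
  (\<open>nash_inequality\<close>), and the \<open>L\<^sup>1\<close> norm of \<open>v\<close> is interpolated between the \<open>L\<^sup>1\<close> and \<open>L\<^sup>p\<close> norms of
  \<open>q\<close>. As \<open>K\<close> contracts \<open>L\<^sup>1\<close>, this yields \<open>D \<ge> c F / (1 + B F\<^sup>-\<^sup>1\<^sup>/\<^sup>(\<^sup>p\<^sup>-\<^sup>1\<^sup>))\<^sup>2\<close> for \<open>F = \<Phi> u\<close>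
  (\<open>energy_dissipation\<close>).

  \<^bold>\<open>Decay.\<close> From \<open>u (t + h) = (1 - h) u t + h (K (u t) + o(1))\<close> and the convexity of \<open>\<bar>z\<bar>\<^sup>p\<close>, the upper
  right derivative of \<open>F\<close> is at most \<open>\<Phi> (K u) - F\<close>. The function
  \<open>exp (\<mu> t) C (K\<^sub>0 + t) powr (- (p - 1) / 2)\<close> with \<open>\<mu> = (1 + \<nu>)\<^sup>p\<^sup>-\<^sup>1 - 1\<close> cannot be crossed from
  below (\<open>comparison_principle\<close>). To bound \<open>u\<close> at time \<open>T\<close> one takes \<open>\<nu> = 1 / (1 + T)\<close>, for which
  \<open>\<mu> T\<close> is bounded (\<open>energy_decay\<close>).
\<close>

section \<open>Elementary inequalities\<close>

text \<open>
  The convexity inequality for \<open>\<bar>z\<bar>\<^sup>p\<close> at \<open>a\<close>, with a remainder that is the squared increment of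
  \<open>\<bar>z\<bar>\<^sup>p\<^sup>/\<^sup>2\<close>. For \<open>a, b > 0\<close> and \<open>\<sigma> = b / a\<close> it reads \<open>2 \<sigma>\<^sup>p\<^sup>/\<^sup>2 \<ge> p \<sigma> - p + 2\<close>, which is Bernoulli's inequality
  with exponent \<open>p / 2 \<ge> 1\<close>. The slope \<open>s\<close> is left existential because only its independence of \<open>b\<close>
  matters.
\<close>
lemma abs_powr_jensen_defect:
  fixes p a :: real
  assumes "p \<ge> 2"
  shows "\<exists>s. \<forall>b. \<bar>a\<bar> powr p + s * (b - a) + (\<bar>b\<bar> powr (p/2) - \<bar>a\<bar> powr (p/2))\<^sup>2 \<le> \<bar>b\<bar> powr p"
proof (cases "a = 0")
  case True
  have "(\<bar>b\<bar> powr (p/2))\<^sup>2 = \<bar>b\<bar> powr p" for b :: real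
    by (simp add: power2_eq_square flip: powr_add)
  then show ?thesis using True assms by (intro exI[of _ 0]) auto
next
  case False
  define A where "A = \<bar>a\<bar>"
  have A: "A > 0" using False by (simp add: A_def)
  define s where "s = p * A powr (p - 1) * sgn a"
  have "A powr p + s * (b - a) + (\<bar>b\<bar> powr (p/2) - A powr (p/2))\<^sup>2 \<le> \<bar>b\<bar> powr p" for b :: real
  proof -
    define B where "B = \<bar>b\<bar>"
    have B: "B \<ge> 0" by (simp add: B_def)
    have Ap: "A powr p = A powr (p-1) * A" using A powr_add[of A "p-1" 1] by simp
    have "sgn a * (b - a) \<le> B - A"
      by (auto simp: B_def A_def sgn_if abs_if)
    then have s: "s * (b - a) \<le> p * A powr (p-1) * (B - A)"
      using mult_left_mono[of "sgn a * (b - a)" "B - A" "p * A powr (p-1)"] assms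
      by (simp add: s_def mult.assoc)
    have sq: "(B powr (p/2))\<^sup>2 = B powr p" "(A powr (p/2))\<^sup>2 = A powr p"
      by (simp_all add: power2_eq_square flip: powr_add)
    have young: "A powr (p/2) * A powr (p/2-1) * B \<le> (2/p) * (A powr (p/2) * B powr (p/2)) + (1-2/p) * A powr p"
    proof (cases "B = 0")
      case False
      have "(B powr (p/2)) powr (2/p) * (A powr (p/2)) powr (1 - 2/p) \<le> (2/p) * B powr (p/2) + (1-2/p) * A powr (p/2)"
        by (rule Youngs_inequality_0) (use assms A B False in auto)
      moreover have "(B powr (p/2)) powr (2/p) = B" using assms B by (simp add: powr_powr)
      moreover have "(A powr (p/2)) powr (1 - 2/p) = A powr (p/2-1)"
      proof -
        have "p/2 * (1 - 2/p) = p/2 - 1" using assms by (simp add: field_simps)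
        then show ?thesis by (simp only: powr_powr)
      qed
      ultimately have "A powr (p/2) * (B * A powr (p/2-1)) \<le> A powr (p/2) * ((2/p) * B powr (p/2) + (1-2/p) * A powr (p/2))"
        by (intro mult_left_mono) auto
      then show ?thesis using sq(2) by (simp add: algebra_simps power2_eq_square)
    qed (use assms in auto)
    have "A powr (p/2) * A powr (p/2-1) = A powr (p-1)"
      by (simp flip: powr_add)
    with young have "A powr (p-1) * B \<le> (2/p) * (A powr (p/2) * B powr (p/2)) + (1-2/p) * A powr p" by simp
    then have "p * (A powr (p-1) * B) \<le> p * ((2/p) * (A powr (p/2) * B powr (p/2)) + (1-2/p) * A powr p)"
      using assms by (intro mult_left_mono) auto
    also have "\<dots> = 2 * (A powr (p/2) * B powr (p/2)) + (p-2) * A powr p"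
      using assms by (simp add: field_simps)
    finally have "p * (A powr (p-1) * B) \<le> 2 * (A powr (p/2) * B powr (p/2)) + (p-2) * A powr p" .
    then have "A powr p + p * A powr (p-1) * (B - A) + (B powr (p/2) - A powr (p/2))\<^sup>2 \<le> B powr p"
      unfolding power2_diff sq using Ap by (simp add: algebra_simps)
    then show ?thesis using s by (simp add: B_def)
  qed
  then show ?thesis unfolding A_def by blast
qed

lemma abs_powr_convex:
  fixes q a b h :: real
  assumes "q \<ge> 1" "0 \<le> h" "h \<le> 1"
  shows "\<bar>(1 - h) * a + h * b\<bar> powr q \<le> (1 - h) * \<bar>a\<bar> powr q + h * \<bar>b\<bar> powr q"
proof -
  have "\<bar>(1 - h) * a + h * b\<bar> \<le> (1 - h) * \<bar>a\<bar> + h * \<bar>b\<bar>"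
    using assms abs_triangle_ineq[of "(1-h)*a" "h*b"] by (simp add: abs_mult)
  then have "\<bar>(1 - h) * a + h * b\<bar> powr q \<le> ((1 - h) * \<bar>a\<bar> + h * \<bar>b\<bar>) powr q"
    using assms by (intro powr_mono2) auto
  also have "\<dots> \<le> (1 - h) * \<bar>a\<bar> powr q + h * \<bar>b\<bar> powr q"
  proof -
    have le: "(c * x) powr q \<le> c * x powr q" if "0 \<le> c" "c \<le> 1" "0 \<le> x" for c x :: real
    proof -
      have "c powr q \<le> c powr 1" using that assms by (intro powr_mono') auto
      then have "c powr q * x powr q \<le> c * x powr q" using that by (intro mult_right_mono) auto
      then show ?thesis using that by (simp add: powr_mult)
    qed
    show ?thesis
    proof (cases "a = 0 \<or> b = 0")
      case True
      then show ?thesis using le[of h "\<bar>b\<bar>"] le[of "1 - h" "\<bar>a\<bar>"] assms by auto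
    next
      case False
      then show ?thesis
        using convex_onD[OF powr_convex[OF assms(1)], of h "\<bar>a\<bar>" "\<bar>b\<bar>"] assms
        by (simp add: algebra_simps)
    qed
  qed
  finally show ?thesis .
qed

lemma abs_powr_add_le:
  fixes q e :: real
  assumes "q \<ge> 1" "e > 0"
  shows "\<exists>C\<ge>0. \<forall>a b. \<bar>a + b\<bar> powr q \<le> (1 + e) * \<bar>a\<bar> powr q + C * \<bar>b\<bar> powr q"
proof -
  have "((\<lambda>h. (1 - h) powr (1 - q)) \<longlongrightarrow> (1 - 0) powr (1 - q)) (at_right (0::real))"
    by (intro tendsto_intros) auto
  then have "\<forall>\<^sub>F h in at_right 0. (1 - h) powr (1 - q) < 1 + e"
    using assms by (intro order_tendstoD) auto
  then obtain d where d: "d > 0" "\<And>h. 0 < h \<Longrightarrow> h < d \<Longrightarrow> (1 - h) powr (1 - q) < 1 + e"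
    unfolding eventually_at_right_field by auto
  define h where "h = min (d/2) (1/2)"
  have h: "0 < h" "h < 1" "(1 - h) powr (1 - q) < 1 + e" using d by (auto simp: h_def)
  have "\<bar>a + b\<bar> powr q \<le> (1 + e) * \<bar>a\<bar> powr q + h powr (1 - q) * \<bar>b\<bar> powr q" for a b :: real
  proof -
    have "\<bar>a + b\<bar> powr q = \<bar>(1 - h) * (a / (1 - h)) + h * (b / h)\<bar> powr q" using h by simp
    also have "\<dots> \<le> (1 - h) * \<bar>a / (1 - h)\<bar> powr q + h * \<bar>b / h\<bar> powr q"
      by (rule abs_powr_convex) (use assms h in auto)
    also have "\<dots> = (1 - h) powr (1 - q) * \<bar>a\<bar> powr q + h powr (1 - q) * \<bar>b\<bar> powr q"
      using h by (simp add: powr_divide powr_diff abs_divide)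
    also have "\<dots> \<le> (1 + e) * \<bar>a\<bar> powr q + h powr (1 - q) * \<bar>b\<bar> powr q"
      using h by (intro add_right_mono mult_right_mono) auto
    finally show ?thesis .
  qed
  then show ?thesis by (intro exI[of _ "h powr (1 - q)"]) auto
qed

text \<open>
  The effect on \<open>exp (- e \<bar>a\<bar>)\<close> of averaging over the two shifts \<open>\<plusminus>h\<close>: a factor
  \<open>cosh (e h) = 1 + O(e\<^sup>2)\<close>, and a loss of first order in \<open>e\<close> when the kink is closer than \<open>\<bar>h\<bar>\<close>.
\<close>
lemma exp_abs_symmetric:
  fixes e a h :: real
  assumes "e \<ge> 0"
  shows "(exp (- e * \<bar>a + h\<bar>) + exp (- e * \<bar>a - h\<bar>)) / 2
         = exp (- e * \<bar>a\<bar>) * cosh (e * h) - sinh (e * max 0 (\<bar>h\<bar> - \<bar>a\<bar>))"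
proof -
  consider "\<bar>h\<bar> \<le> \<bar>a\<bar>" "a \<ge> 0" | "\<bar>h\<bar> \<le> \<bar>a\<bar>" "a < 0" | "\<bar>h\<bar> > \<bar>a\<bar>" "h \<ge> 0" | "\<bar>h\<bar> > \<bar>a\<bar>" "h < 0" by linarith
  then show ?thesis
  proof cases
    case 1
    then have "\<bar>a+h\<bar> = a+h" "\<bar>a-h\<bar> = a-h" "max 0 (\<bar>h\<bar> - \<bar>a\<bar>) = 0" by auto
    then show ?thesis using 1 by (simp add: cosh_def field_simps flip: exp_add)
  next
    case 2
    then have "\<bar>a+h\<bar> = -a-h" "\<bar>a-h\<bar> = h-a" "max 0 (\<bar>h\<bar> - \<bar>a\<bar>) = 0" by auto
    then show ?thesis using 2 by (simp add: cosh_def field_simps flip: exp_add)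
  next
    case 3
    then have "\<bar>a+h\<bar> = a+h" "\<bar>a-h\<bar> = h-a" "max 0 (\<bar>h\<bar> - \<bar>a\<bar>) = h - \<bar>a\<bar>" by auto
    then show ?thesis using 3 by (cases "a \<ge> 0") (simp_all add: cosh_def sinh_def field_simps flip: exp_add)
  next
    case 4
    then have "\<bar>a+h\<bar> = -a-h" "\<bar>a-h\<bar> = a-h" "max 0 (\<bar>h\<bar> - \<bar>a\<bar>) = - h - \<bar>a\<bar>" by auto
    then show ?thesis using 4 by (cases "a \<ge> 0") (simp_all add: cosh_def sinh_def field_simps flip: exp_add)
  qed
qed

lemma le_sinh:
  assumes "0 \<le> x" shows "x \<le> sinh (x::real)"
proof -
  have "sinh 0 - (0::real) \<le> sinh x - x"
    by (rule DERIV_nonneg_imp_nondecreasing[OF assms])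
       (auto intro!: exI derivative_eq_intros simp: cosh_real_ge_1)
  then show ?thesis by simp
qed

lemma sinh_le_mult_cosh:
  assumes "0 \<le> x" shows "sinh x \<le> x * cosh (x::real)"
proof -
  have "0 * cosh 0 - sinh (0::real) \<le> x * cosh x - sinh x"
    by (rule DERIV_nonneg_imp_nondecreasing[OF assms])
       (auto intro!: exI derivative_eq_intros simp: cosh_real_ge_1)
  then show ?thesis by simp
qed

lemma cosh_eq_one_plus_sinh_half: "cosh x = 1 + 2 * (sinh (\<bar>x\<bar> / 2))\<^sup>2" for x :: real
proof -
  have "cosh x = cosh (2 * (\<bar>x\<bar>/2))" by simp
  also have "\<dots> = 1 + 2 * (sinh (\<bar>x\<bar>/2))\<^sup>2" unfolding cosh_double by (simp add: cosh_square_eq)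
  finally show ?thesis .
qed

lemma cosh_ge_quadratic: "1 + x\<^sup>2 / 2 \<le> cosh (x::real)"
proof -
  have "(\<bar>x\<bar> / 2)\<^sup>2 \<le> (sinh (\<bar>x\<bar> / 2))\<^sup>2"
    by (intro power_mono le_sinh) auto
  then show ?thesis using cosh_eq_one_plus_sinh_half[of x] by (simp add: power_divide)
qed

lemma cosh_le_quadratic:
  assumes "\<bar>x\<bar> \<le> (1::real)"
  shows "cosh x \<le> 1 + x\<^sup>2"
proof -
  have "exp (- 1::real) \<le> 1" by (subst exp_le_one_iff) simp
  then have "exp (1::real) + exp (- 1) \<le> 6" using exp_le by linarith
  then have c1: "cosh (1::real) \<le> 3" by (simp add: cosh_def)
  have "cosh (\<bar>x\<bar>/2) \<le> cosh (1/2::real)" using assms by (intro cosh_real_nonneg_le_iff[THEN iffD2]) auto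
  then have "(cosh (\<bar>x\<bar>/2))\<^sup>2 \<le> (cosh (1/2::real))\<^sup>2" by (intro power_mono) auto
  also have "\<dots> = (1 + cosh 1) / 2" using cosh_double[of "1/2::real"] by (simp add: sinh_square_eq)
  also have "\<dots> \<le> 2" using c1 by simp
  finally have c: "(cosh (\<bar>x\<bar>/2))\<^sup>2 \<le> 2" .
  have "(sinh (\<bar>x\<bar>/2))\<^sup>2 \<le> (\<bar>x\<bar>/2 * cosh (\<bar>x\<bar>/2))\<^sup>2"
    by (intro power_mono sinh_le_mult_cosh) auto
  also have "\<dots> = x\<^sup>2/4 * (cosh (\<bar>x\<bar>/2))\<^sup>2" by (simp add: power_mult_distrib power_divide)
  also have "\<dots> \<le> x\<^sup>2/4 * 2" using c by (intro mult_left_mono) auto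
  finally show ?thesis using cosh_eq_one_plus_sinh_half[of x] by simp
qed

lemma ennreal_le_divide_of_mult_le:
  assumes "0 < a" "ennreal a * X \<le> ennreal b" "0 \<le> b"
  shows "X \<le> ennreal (b / a)"
proof -
  have "X = ennreal (1/a) * (ennreal a * X)"
    using assms by (simp add: mult.assoc[symmetric] ennreal_mult[symmetric])
  also have "\<dots> \<le> ennreal (1/a) * ennreal b" by (intro mult_left_mono assms) auto
  also have "\<dots> = ennreal (b / a)" using assms by (simp add: ennreal_mult[symmetric])
  finally show ?thesis .
qed

lemma ennreal_divide_le_of_le_mult:
  assumes "0 < a" "ennreal b \<le> ennreal a * X" "0 \<le> b"
  shows "ennreal (b / a) \<le> X"
proof -
  have "X = ennreal (1/a) * (ennreal a * X)"
    using assms by (simp add: mult.assoc[symmetric] ennreal_mult[symmetric])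
  also have "\<dots> \<ge> ennreal (1/a) * ennreal b" by (intro mult_left_mono assms) auto
  also have "ennreal (1/a) * ennreal b = ennreal (b / a)" using assms by (simp add: ennreal_mult[symmetric])
  finally show ?thesis .
qed

section \<open>Translations of a function and a Nash inequality\<close>

lemma nn_integral_shift:
  fixes f :: "real \<Rightarrow> ennreal"
  assumes "f \<in> borel_measurable borel"
  shows "(\<integral>\<^sup>+x. f x \<partial>lborel) = (\<integral>\<^sup>+h. f (y + h) \<partial>lborel)"
  using nn_integral_real_affine[OF assms, of 1 y] by simp

lemma nn_integral_reflect:
  fixes f :: "real \<Rightarrow> ennreal"
  assumes "f \<in> borel_measurable borel"
  shows "(\<integral>\<^sup>+x. f x \<partial>lborel) = (\<integral>\<^sup>+h. f (- h) \<partial>lborel)"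
  using nn_integral_real_affine[OF assms, of "-1" 0] by simp

lemma nn_integral_translate:
  fixes f :: "real \<Rightarrow> ennreal"
  assumes "f \<in> borel_measurable borel"
  shows "(\<integral>\<^sup>+x. f (x + h) \<partial>lborel) = (\<integral>\<^sup>+x. f x \<partial>lborel)"
  using nn_integral_shift[OF assms, of h] by (simp add: add.commute)

lemma ennreal_linear_combination:
  fixes a b x y :: real
  assumes "0 \<le> a" "0 \<le> b" "0 \<le> x" "0 \<le> y"
  shows "ennreal (a * x + b * y) = ennreal a * ennreal x + ennreal b * ennreal y"
  using assms by (simp add: ennreal_mult)

text \<open>
  The squared \<open>L\<^sup>2\<close> distance between \<open>v\<close> and its translate by \<open>h\<close>; it may be infinite.
\<close>
definition shift_defect :: "(real \<Rightarrow> real) \<Rightarrow> real \<Rightarrow> ennreal" where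
  "shift_defect v h = (\<integral>\<^sup>+x. ennreal ((v (x + h) - v x)\<^sup>2) \<partial>lborel)"

lemma shift_defect_measurable [measurable]:
  assumes [measurable]: "v \<in> borel_measurable borel"
  shows "shift_defect v \<in> borel_measurable borel"
  unfolding shift_defect_def[abs_def] by measurable

lemma shift_defect_multiple:
  assumes [measurable]: "v \<in> borel_measurable borel" and "1 \<le> n"
  shows "shift_defect v (real n * h) \<le> ennreal ((real n)\<^sup>2) * shift_defect v h"
  using \<open>1 \<le> n\<close>
proof (induction n rule: nat_induct_at_least)
  case base
  then show ?case by simp
next
  case (Suc m)
  have sq: "(a + b)\<^sup>2 \<le> (real m + 1) / real m * a\<^sup>2 + (real m + 1) * b\<^sup>2" for a b :: real
  proof -
    have "0 \<le> (a - real m * b)\<^sup>2 / real m" by simp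
    also have "\<dots> = (real m + 1) / real m * a\<^sup>2 + (real m + 1) * b\<^sup>2 - (a + b)\<^sup>2"
      using \<open>1 \<le> m\<close> by (simp add: power2_eq_square field_simps)
    finally show ?thesis by simp
  qed
  have "shift_defect v (real (Suc m) * h)
      \<le> (\<integral>\<^sup>+x. ennreal ((real m + 1) / real m) * ennreal ((v (x + real m * h) - v x)\<^sup>2)
           + ennreal (real m + 1) * ennreal ((v (x + real m * h + h) - v (x + real m * h))\<^sup>2) \<partial>lborel)"
    unfolding shift_defect_def
  proof (intro nn_integral_mono)
    fix x
    have "v (x + real (Suc m) * h) - v x = (v (x + real m * h) - v x) + (v (x + real m * h + h) - v (x + real m * h))"
      by (simp add: algebra_simps)
    then have "ennreal ((v (x + real (Suc m) * h) - v x)\<^sup>2) \<le> ennreal ((real m + 1) / real m * (v (x + real m * h) - v x)\<^sup>2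
           + (real m + 1) * (v (x + real m * h + h) - v (x + real m * h))\<^sup>2)"
      using sq[of "v (x + real m * h) - v x" "v (x + real m * h + h) - v (x + real m * h)"]
      by (intro ennreal_leI) (simp only:)
    then show "ennreal ((v (x + real (Suc m) * h) - v x)\<^sup>2) \<le> ennreal ((real m + 1) / real m) * ennreal ((v (x + real m * h) - v x)\<^sup>2)
           + ennreal (real m + 1) * ennreal ((v (x + real m * h + h) - v (x + real m * h))\<^sup>2)"
      by (simp only: ennreal_linear_combination[OF _ _ zero_le_power2 zero_le_power2] of_nat_0_le_iff
          add_nonneg_nonneg divide_nonneg_nonneg zero_le_one)
  qed
  also have "\<dots> = ennreal ((real m + 1) / real m) * shift_defect v (real m * h)
      + ennreal (real m + 1) * (\<integral>\<^sup>+x. ennreal ((v (x + real m * h + h) - v (x + real m * h))\<^sup>2) \<partial>lborel)"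
    unfolding shift_defect_def by (simp add: nn_integral_add nn_integral_cmult)
  also have "(\<integral>\<^sup>+x. ennreal ((v (x + real m * h + h) - v (x + real m * h))\<^sup>2) \<partial>lborel) = shift_defect v h"
    unfolding shift_defect_def
    by (rule nn_integral_translate[where f = "\<lambda>x. ennreal ((v (x + h) - v x)\<^sup>2)"]) measurable
  also have "ennreal ((real m + 1) / real m) * shift_defect v (real m * h) + ennreal (real m + 1) * shift_defect v h
      \<le> ennreal ((real m + 1) / real m) * (ennreal ((real m)\<^sup>2) * shift_defect v h) + ennreal (real m + 1) * shift_defect v h"
    by (intro add_right_mono mult_left_mono Suc) auto
  also have "\<dots> = ennreal ((real m + 1) / real m * (real m)\<^sup>2 + (real m + 1)) * shift_defect v h"
  proof -
    have "ennreal ((real m + 1) / real m * (real m)\<^sup>2 + (real m + 1) * 1)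
        = ennreal ((real m + 1) / real m) * ennreal ((real m)\<^sup>2) + ennreal (real m + 1) * ennreal 1"
      by (rule ennreal_linear_combination) auto
    then show ?thesis by (simp only: mult_1_right ennreal_1 distrib_right mult.assoc)
  qed
  also have "(real m + 1) / real m * (real m)\<^sup>2 + (real m + 1) = (real (Suc m))\<^sup>2"
    using \<open>1 \<le> m\<close> by (simp add: power2_eq_square field_simps)
  finally show ?case .
qed

text \<open>
  The translation defects by less than \<open>\<rho>\<close>, integrated over the length of the translation.
\<close>
abbreviation total_defect :: "real \<Rightarrow> (real \<Rightarrow> real) \<Rightarrow> ennreal" where
  "total_defect \<rho> v \<equiv> (\<integral>\<^sup>+h. indicator {0..<\<rho>} h * shift_defect v h \<partial>lborel)"

text \<open>
  A Nash inequality in which only translations by less than a fixed length \<open>\<rho>\<close> enter. It follows from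
  \<open>2 \<integral> v\<^sup>2 = 2 \<integral> v x v (x + h) dx + \<integral> (v (x + h) - v x)\<^sup>2 dx\<close>, integrated over \<open>0 \<le> h < n \<rho>\<close>: the
  correlation term contributes at most \<open>2 (\<integral> v)\<^sup>2\<close>, and the defects of the long translations are
  reduced to those of translations by less than \<open>\<rho>\<close>.
\<close>
lemma nash_inequality:
  assumes [measurable]: "v \<in> borel_measurable borel" and v: "\<And>x. 0 \<le> v x"
    and n: "1 \<le> n" and r: "0 < \<rho>"
  shows "ennreal (2 * (real n * \<rho>)) * (\<integral>\<^sup>+x. ennreal ((v x)\<^sup>2) \<partial>lborel)
      \<le> 2 * (\<integral>\<^sup>+x. v x \<partial>lborel)\<^sup>2 + ennreal ((real n)^3) * total_defect \<rho> v"
proof -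
  define S where "S = (\<integral>\<^sup>+x. v x \<partial>lborel)"
  define E where "E = (\<integral>\<^sup>+x. ennreal ((v x)\<^sup>2) \<partial>lborel)"
  define L where "L = real n * \<rho>"
  have L: "0 < L" using n r by (simp add: L_def)
  have polar: "2 * E = 2 * (\<integral>\<^sup>+x. v x * v (x + h) \<partial>lborel) + shift_defect v h" for h
  proof -
    have "2 * E = (\<integral>\<^sup>+x. ennreal ((v x)\<^sup>2) \<partial>lborel) + (\<integral>\<^sup>+x. ennreal ((v (x + h))\<^sup>2) \<partial>lborel)"
      using nn_integral_translate[of "\<lambda>x. ennreal ((v x)\<^sup>2)" h] by (simp add: E_def mult_2)
    also have "\<dots> = (\<integral>\<^sup>+x. ennreal ((v x)\<^sup>2) + ennreal ((v (x + h))\<^sup>2) \<partial>lborel)"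
      by (rule nn_integral_add[symmetric]) measurable
    also have "\<dots> = (\<integral>\<^sup>+x. 2 * ennreal (v x * v (x + h)) + ennreal ((v (x + h) - v x)\<^sup>2) \<partial>lborel)"
    proof (intro nn_integral_cong)
      fix x
      have "ennreal ((v x)\<^sup>2) + ennreal ((v (x + h))\<^sup>2) = ennreal (2 * (v x * v (x + h)) + (v (x + h) - v x)\<^sup>2)"
        by (subst ennreal_plus[symmetric]) (auto simp: power2_eq_square algebra_simps)
      also have "\<dots> = ennreal (2 * (v x * v (x + h))) + ennreal ((v (x + h) - v x)\<^sup>2)"
        using v by (intro ennreal_plus) auto
      finally show "ennreal ((v x)\<^sup>2) + ennreal ((v (x + h))\<^sup>2) = 2 * ennreal (v x * v (x + h)) + ennreal ((v (x + h) - v x)\<^sup>2)"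
        by (simp add: ennreal_mult')
    qed
    also have "\<dots> = 2 * (\<integral>\<^sup>+x. v x * v (x + h) \<partial>lborel) + shift_defect v h"
      unfolding shift_defect_def by (simp add: nn_integral_add nn_integral_cmult)
    finally show ?thesis .
  qed
  have corr: "(\<integral>\<^sup>+h. (\<integral>\<^sup>+x. v x * v (x + h) \<partial>lborel) \<partial>lborel) = S\<^sup>2"
  proof -
    have "(\<integral>\<^sup>+h. (\<integral>\<^sup>+x. v x * v (x + h) \<partial>lborel) \<partial>lborel) = (\<integral>\<^sup>+x. (\<integral>\<^sup>+h. v x * v (x + h) \<partial>lborel) \<partial>lborel)"
      by (rule lborel_pair.Fubini') measurable
    also have "\<dots> = (\<integral>\<^sup>+x. v x * (\<integral>\<^sup>+h. v (x + h) \<partial>lborel) \<partial>lborel)"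
      using v by (intro nn_integral_cong) (simp add: ennreal_mult nn_integral_cmult)
    also have "\<dots> = (\<integral>\<^sup>+x. v x * S \<partial>lborel)"
    proof (intro nn_integral_cong)
      fix x
      show "ennreal (v x) * (\<integral>\<^sup>+h. v (x + h) \<partial>lborel) = ennreal (v x) * S"
        using nn_integral_translate[of "\<lambda>x. ennreal (v x)" x] by (simp add: S_def add.commute)
    qed
    also have "\<dots> = S\<^sup>2" by (simp add: nn_integral_multc S_def power2_eq_square)
    finally show ?thesis .
  qed
  have "ennreal (2 * L) * E = (2 * E) * emeasure lborel {0..<L}"
    using L by (simp add: ennreal_mult' mult_ac)
  also have "\<dots> = (\<integral>\<^sup>+h. 2 * E * indicator {0..<L} h \<partial>lborel)"
    by (simp add: nn_integral_cmult_indicator)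
  also have "\<dots> = (\<integral>\<^sup>+h. 2 * (\<integral>\<^sup>+x. v x * v (x + h) \<partial>lborel) * indicator {0..<L} h + indicator {0..<L} h * shift_defect v h \<partial>lborel)"
  proof (intro nn_integral_cong)
    fix h
    show "2 * E * indicator {0..<L} h = 2 * (\<integral>\<^sup>+x. v x * v (x + h) \<partial>lborel) * indicator {0..<L} h + indicator {0..<L} h * shift_defect v h"
      unfolding polar[of h] by (simp add: indicator_def)
  qed
  also have "\<dots> = (\<integral>\<^sup>+h. 2 * (\<integral>\<^sup>+x. v x * v (x + h) \<partial>lborel) * indicator {0..<L} h \<partial>lborel) + (\<integral>\<^sup>+h. indicator {0..<L} h * shift_defect v h \<partial>lborel)"
    by (intro nn_integral_add) measurable
  also have "(\<integral>\<^sup>+h. 2 * (\<integral>\<^sup>+x. v x * v (x + h) \<partial>lborel) * indicator {0..<L} h \<partial>lborel)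
      \<le> (\<integral>\<^sup>+h. 2 * (\<integral>\<^sup>+x. v x * v (x + h) \<partial>lborel) \<partial>lborel)"
    by (intro nn_integral_mono) (auto simp: indicator_def)
  also have "\<dots> = 2 * S\<^sup>2" unfolding corr[symmetric] by (intro nn_integral_cmult) measurable
  also have "(\<integral>\<^sup>+h. indicator {0..<L} h * shift_defect v h \<partial>lborel)
      = ennreal (real n) * (\<integral>\<^sup>+h. indicator {0..<L} (real n * h) * shift_defect v (real n * h) \<partial>lborel)"
    using nn_integral_real_affine[of "\<lambda>h. indicator {0..<L} h * shift_defect v h" "real n" 0] n by simp
  also have "\<dots> \<le> ennreal (real n) * (\<integral>\<^sup>+h. indicator {0..<\<rho>} h * (ennreal ((real n)\<^sup>2) * shift_defect v h) \<partial>lborel)"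
  proof (intro mult_left_mono nn_integral_mono)
    fix h
    have "real n * h \<in> {0..<L} \<longleftrightarrow> h \<in> {0..<\<rho>}" using n by (auto simp: L_def zero_le_mult_iff)
    then show "indicator {0..<L} (real n * h) * shift_defect v (real n * h) \<le> indicator {0..<\<rho>} h * (ennreal ((real n)\<^sup>2) * shift_defect v h)"
      using shift_defect_multiple[OF assms(1) n, of h] by (auto simp: indicator_def)
  qed auto
  also have "\<dots> = ennreal (real n) * (ennreal ((real n)\<^sup>2) * total_defect \<rho> v)"
  proof -
    have "(\<integral>\<^sup>+h. indicator {0..<\<rho>} h * (ennreal ((real n)\<^sup>2) * shift_defect v h) \<partial>lborel)
        = (\<integral>\<^sup>+h. ennreal ((real n)\<^sup>2) * (indicator {0..<\<rho>} h * shift_defect v h) \<partial>lborel)"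
      by (simp only: mult.left_commute)
    then show ?thesis by (simp add: nn_integral_cmult)
  qed
  also have "\<dots> = ennreal ((real n)^3) * total_defect \<rho> v"
    unfolding mult.assoc[symmetric] by (subst ennreal_mult[symmetric]) (auto simp: power2_eq_square power3_eq_cube mult.assoc)
  finally show ?thesis unfolding L_def E_def S_def by (auto intro: add_mono)
qed

text \<open>
  Interpolation of the \<open>L\<^sup>p\<^sup>/\<^sup>2\<close> norm between \<open>L\<^sup>1\<close> and \<open>L\<^sup>p\<close>, by splitting at the level \<open>\<tau>\<close>; optimising
  \<open>\<tau>\<close> gives, up to a constant, the bound of Hoelder's inequality.
\<close>
lemma nn_integral_powr_half_le:
  fixes q :: "real \<Rightarrow> real" and p \<tau> :: real
  assumes p: "2 \<le> p" and t: "0 < \<tau>" and [measurable]: "q \<in> borel_measurable borel"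
    and i: "integrable lborel (\<lambda>x. \<bar>q x\<bar>)" "integrable lborel (\<lambda>x. \<bar>q x\<bar> powr p)"
  shows "(\<integral>\<^sup>+x. \<bar>q x\<bar> powr (p/2) \<partial>lborel)
     \<le> ennreal (\<tau> powr (p/2 - 1) * (LINT x|lborel. \<bar>q x\<bar>) + \<tau> powr (- (p/2)) * (LINT x|lborel. \<bar>q x\<bar> powr p))"
proof -
  have pw: "c powr (p/2) \<le> \<tau> powr (p/2 - 1) * c + \<tau> powr (- (p/2)) * c powr p" if "0 \<le> c" for c :: real
  proof (cases "c = 0")
    case False
    then have c: "0 < c" using that by simp
    show ?thesis
    proof (cases "c \<le> \<tau>")
      case True
      have "c powr (p/2) = c powr (p/2 - 1) * c" using c powr_add[of c "p/2 - 1" 1] by simp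
      also have "\<dots> \<le> \<tau> powr (p/2 - 1) * c" using c True p by (intro mult_right_mono powr_mono2) auto
      finally show ?thesis by (simp add: add_increasing2)
    next
      case False
      have "c powr (p/2) = c powr (- (p/2)) * c powr p" by (simp flip: powr_add)
      also have "\<dots> \<le> \<tau> powr (- (p/2)) * c powr p"
        using t False p by (intro mult_right_mono powr_mono2') auto
      finally show ?thesis using c by (simp add: add_increasing)
    qed
  qed simp
  have "(\<integral>\<^sup>+x. \<bar>q x\<bar> powr (p/2) \<partial>lborel) \<le> (\<integral>\<^sup>+x. \<tau> powr (p/2 - 1) * \<bar>q x\<bar> + \<tau> powr (- (p/2)) * \<bar>q x\<bar> powr p \<partial>lborel)"
    by (intro nn_integral_mono ennreal_leI pw) auto
  also have "\<dots> = ennreal (LINT x|lborel. \<tau> powr (p/2 - 1) * \<bar>q x\<bar> + \<tau> powr (- (p/2)) * \<bar>q x\<bar> powr p)"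
    using i by (intro nn_integral_eq_integral) auto
  finally show ?thesis using i by simp
qed

section \<open>Jensen's inequality with a remainder\<close>

text \<open>
  The variance of \<open>v\<close> under the measure \<open>\<theta> y dy\<close>, up to the factor \<open>2 \<integral> \<theta>\<close>.
\<close>
abbreviation pair_defect :: "(real \<Rightarrow> real) \<Rightarrow> (real \<Rightarrow> real) \<Rightarrow> ennreal" where
  "pair_defect \<theta> v \<equiv> (\<integral>\<^sup>+y. (\<integral>\<^sup>+z. \<theta> y * \<theta> z * (v z - v y)\<^sup>2 \<partial>lborel) \<partial>lborel)"

text \<open>
  Jensen's inequality for the finite measure \<open>\<theta> y dy\<close> of mass \<open>m\<close>, with a remainder comparable to the
  variance of \<open>\<bar>q\<bar>\<^sup>p\<^sup>/\<^sup>2\<close>, written as a double integral.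
\<close>
lemma jensen_defect:
  fixes \<theta> q :: "real \<Rightarrow> real"
  assumes p: "2 \<le> p" and \<theta>: "\<And>y. 0 \<le> \<theta> y"
    and [measurable]: "\<theta> \<in> borel_measurable borel" "q \<in> borel_measurable borel"
    and i: "integrable lborel \<theta>" "integrable lborel (\<lambda>y. \<theta> y * q y)" "integrable lborel (\<lambda>y. \<theta> y * \<bar>q y\<bar> powr p)"
    and m: "m = (LINT y|lborel. \<theta> y)" "0 < m"
  defines "v \<equiv> \<lambda>y. \<bar>q y\<bar> powr (p/2)"
  shows "ennreal (m powr (1 - p) * \<bar>LINT y|lborel. \<theta> y * q y\<bar> powr p)
      + ennreal (1 / (4 * m)) * pair_defect \<theta> v
      \<le> (\<integral>\<^sup>+y. \<theta> y * \<bar>q y\<bar> powr p \<partial>lborel)"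
proof -
  define a where "a = (LINT y|lborel. \<theta> y * q y) / m"
  define va where "va = \<bar>a\<bar> powr (p/2)"
  have [measurable]: "v \<in> borel_measurable borel" unfolding v_def by measurable
  obtain s where s: "\<And>b. \<bar>a\<bar> powr p + s * (b - a) + (\<bar>b\<bar> powr (p/2) - va)\<^sup>2 \<le> \<bar>b\<bar> powr p"
    using abs_powr_jensen_defect[OF p, of a] unfolding va_def by blast
  have v2: "(v y)\<^sup>2 = \<bar>q y\<bar> powr p" for y
    by (simp add: v_def power2_eq_square flip: powr_add)
  have id: "integrable lborel (\<lambda>y. \<theta> y * (v y - va)\<^sup>2)"
  proof (rule Bochner_Integration.integrable_bound)
    show "integrable lborel (\<lambda>y. 2 * (\<theta> y * \<bar>q y\<bar> powr p) + 2 * va\<^sup>2 * \<theta> y)"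
      using i by auto
    have "\<theta> y * (v y - va)\<^sup>2 \<le> 2 * (\<theta> y * \<bar>q y\<bar> powr p) + 2 * va\<^sup>2 * \<theta> y" for y
    proof -
      have "(v y - va)\<^sup>2 \<le> 2 * (v y)\<^sup>2 + 2 * va\<^sup>2"
        using sum_squares_ge_zero[of "v y + va" 0] by (simp add: power2_eq_square algebra_simps)
      from mult_left_mono[OF this \<theta>[of y]] show ?thesis unfolding v2 by (simp add: algebra_simps)
    qed
    then show "AE y in lborel. norm (\<theta> y * (v y - va)\<^sup>2) \<le> norm (2 * (\<theta> y * \<bar>q y\<bar> powr p) + 2 * va\<^sup>2 * \<theta> y)"
      using \<theta> by (intro AE_I2) auto
  qed measurable
  define V where "V = (LINT y|lborel. \<theta> y * (v y - va)\<^sup>2)"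
  have V: "0 \<le> V" unfolding V_def using \<theta> by (intro integral_nonneg_AE) auto
  have "\<bar>a\<bar> powr p * m + s * ((LINT y|lborel. \<theta> y * q y) - a * m) + V
      = (LINT y|lborel. \<bar>a\<bar> powr p * \<theta> y + s * (\<theta> y * q y - a * \<theta> y) + \<theta> y * (v y - va)\<^sup>2)"
    using i id by (simp add: V_def m(1))
  also have "\<dots> \<le> (LINT y|lborel. \<theta> y * \<bar>q y\<bar> powr p)"
  proof (intro integral_mono)
    fix y
    from mult_left_mono[OF s[of "q y"] \<theta>[of y]]
    show "\<bar>a\<bar> powr p * \<theta> y + s * (\<theta> y * q y - a * \<theta> y) + \<theta> y * (v y - va)\<^sup>2 \<le> \<theta> y * \<bar>q y\<bar> powr p"
      by (simp add: algebra_simps v_def)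
  qed (use i id in auto)
  also have "(LINT y|lborel. \<theta> y * q y) - a * m = 0" using m by (simp add: a_def)
  finally have main: "\<bar>a\<bar> powr p * m + V \<le> (LINT y|lborel. \<theta> y * \<bar>q y\<bar> powr p)" by simp
  have am: "\<bar>a\<bar> powr p * m = m powr (1 - p) * \<bar>LINT y|lborel. \<theta> y * q y\<bar> powr p"
    using m(2) by (simp add: a_def abs_divide powr_divide powr_diff)
  have V_nn: "ennreal V = (\<integral>\<^sup>+y. \<theta> y * (v y - va)\<^sup>2 \<partial>lborel)"
    unfolding V_def using id \<theta> by (intro nn_integral_eq_integral[symmetric]) auto
  have m_nn: "ennreal m = (\<integral>\<^sup>+y. \<theta> y \<partial>lborel)"
    unfolding m(1) using i \<theta> by (intro nn_integral_eq_integral[symmetric]) auto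
  have "pair_defect \<theta> v
     \<le> (\<integral>\<^sup>+y. (\<integral>\<^sup>+z. 2 * ennreal (\<theta> y) * ennreal (\<theta> z * (v z - va)\<^sup>2) + 2 * ennreal (\<theta> y * (v y - va)\<^sup>2) * ennreal (\<theta> z) \<partial>lborel) \<partial>lborel)"
  proof (intro nn_integral_mono)
    fix y z
    have "(v z - v y)\<^sup>2 \<le> 2 * (v z - va)\<^sup>2 + 2 * (v y - va)\<^sup>2"
      using sum_squares_ge_zero[of "(v z - va) + (v y - va)" 0] by (simp add: power2_eq_square algebra_simps)
    from mult_left_mono[OF this, of "\<theta> y * \<theta> z"]
    have "ennreal (\<theta> y * \<theta> z * (v z - v y)\<^sup>2) \<le> ennreal (2 * \<theta> y * (\<theta> z * (v z - va)\<^sup>2) + 2 * (\<theta> y * (v y - va)\<^sup>2) * \<theta> z)"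
      using \<theta> by (intro ennreal_leI) (simp add: algebra_simps)
    also have "\<dots> = ennreal (2 * \<theta> y * (\<theta> z * (v z - va)\<^sup>2)) + ennreal (2 * (\<theta> y * (v y - va)\<^sup>2) * \<theta> z)"
      using \<theta> by (intro ennreal_plus) auto
    finally show "ennreal (\<theta> y * \<theta> z * (v z - v y)\<^sup>2) \<le> 2 * ennreal (\<theta> y) * ennreal (\<theta> z * (v z - va)\<^sup>2) + 2 * ennreal (\<theta> y * (v y - va)\<^sup>2) * ennreal (\<theta> z)"
      using \<theta> by (simp add: ennreal_mult ennreal_mult')
  qed
  also have "\<dots> = (\<integral>\<^sup>+y. 2 * ennreal (\<theta> y) * ennreal V + 2 * ennreal (\<theta> y * (v y - va)\<^sup>2) * ennreal m \<partial>lborel)"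
    unfolding V_nn m_nn by (intro nn_integral_cong) (simp add: nn_integral_add nn_integral_cmult)
  also have "\<dots> = 2 * ennreal m * ennreal V + 2 * ennreal V * ennreal m"
    unfolding V_nn m_nn by (simp add: nn_integral_add nn_integral_cmult nn_integral_multc)
  also have "\<dots> = ennreal (4 * m * V)"
  proof -
    have "2 * ennreal m * ennreal V + 2 * ennreal V * ennreal m = ennreal (2 * m * V) + ennreal (2 * V * m)"
      using V m(2) by (simp add: ennreal_mult')
    also have "\<dots> = ennreal (4 * m * V)" using V m(2) by (subst ennreal_plus[symmetric]) auto
    finally show ?thesis .
  qed
  finally have "ennreal (1 / (4 * m)) * pair_defect \<theta> v \<le> ennreal (1 / (4 * m)) * ennreal (4 * m * V)"
    by (intro mult_left_mono) auto
  also have "\<dots> = ennreal V" using m(2) V by (subst ennreal_mult[symmetric]) auto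
  finally have "ennreal (m powr (1 - p) * \<bar>LINT y|lborel. \<theta> y * q y\<bar> powr p)
      + ennreal (1 / (4 * m)) * pair_defect \<theta> v
      \<le> ennreal (\<bar>a\<bar> powr p * m) + ennreal V"
    unfolding am by (intro add_left_mono)
  also have "\<dots> = ennreal (\<bar>a\<bar> powr p * m + V)" using V m(2) by (intro ennreal_plus[symmetric]) auto
  also have "\<dots> \<le> ennreal (LINT y|lborel. \<theta> y * \<bar>q y\<bar> powr p)" by (intro ennreal_leI main)
  also have "\<dots> = (\<integral>\<^sup>+y. \<theta> y * \<bar>q y\<bar> powr p \<partial>lborel)"
    using i(3) \<theta> by (intro nn_integral_eq_integral[symmetric]) auto
  finally show ?thesis .
qed

section \<open>Even jump kernels and exponential test functions\<close>

text \<open>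
  \<open>k x y\<close> is the density of the jumps from \<open>y\<close> to \<open>x\<close>. The jumps from \<open>y\<close> are symmetric about \<open>y\<close>, but \<open>k\<close>
  need not be symmetric in its two arguments.
\<close>
locale jump_kernel =
  fixes k :: "real \<Rightarrow> real \<Rightarrow> real" and k0 k1 M \<rho> :: real
  assumes k_borel: "case_prod k \<in> borel_measurable (borel \<Otimes>\<^sub>M borel)"
    and k_nonneg: "\<And>x y. 0 \<le> k x y"
    and k_le: "\<And>x y. k x y \<le> k1"
    and k_ge: "\<And>x y. \<bar>x - y\<bar> < \<rho> \<Longrightarrow> k0 \<le> k x y"
    and k_far: "\<And>x y. M < \<bar>x - y\<bar> \<Longrightarrow> k x y = 0"
    and k_even: "\<And>y h. k (y + h) y = k (y - h) y"
    and k_mass: "\<And>y. (\<integral>\<^sup>+x. k x y \<partial>lborel) = 1"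
    and kappa0_pos: "0 < k0" and rho_pos: "0 < \<rho>" and M_pos: "0 < M"
begin

lemma k_measurable [measurable (raw)]:
  assumes [measurable]: "f \<in> borel_measurable N" "g \<in> borel_measurable N"
  shows "(\<lambda>z. k (f z) (g z)) \<in> borel_measurable N"
proof -
  have "(\<lambda>z. (f z, g z)) \<in> N \<rightarrow>\<^sub>M borel \<Otimes>\<^sub>M borel" by measurable
  from measurable_compose[OF this k_borel] show ?thesis by simp
qed

lemma k_mass_shifted: "(\<integral>\<^sup>+h. k (y + h) y \<partial>lborel) = 1"
  using nn_integral_shift[of "\<lambda>x. k x y" y] k_mass[of y] by simp

lemma nn_integral_k_symmetrised:
  assumes [measurable]: "f \<in> borel_measurable borel" and f: "\<And>x. (0::real) \<le> f x"
  shows "(\<integral>\<^sup>+x. k x y * f x \<partial>lborel) = (\<integral>\<^sup>+h. k (y + h) y * ((f (y + h) + f (y - h)) / 2) \<partial>lborel)"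
proof -
  have a: "(\<integral>\<^sup>+x. k x y * f x \<partial>lborel) = (\<integral>\<^sup>+h. k (y + h) y * f (y + h) \<partial>lborel)"
    by (rule nn_integral_shift) measurable
  also have "\<dots> = (\<integral>\<^sup>+h. k (y + - h) y * f (y + - h) \<partial>lborel)"
    by (rule nn_integral_reflect) measurable
  finally have b: "(\<integral>\<^sup>+x. k x y * f x \<partial>lborel) = (\<integral>\<^sup>+h. k (y + h) y * f (y - h) \<partial>lborel)"
    using k_even by simp
  have "ennreal (1/2) + ennreal (1/2) = 1"
    by (subst ennreal_plus[symmetric]) auto
  then have half: "ennreal (1/2) * z + ennreal (1/2) * z = z" for z
    by (metis distrib_right mult_1)
  have "(\<integral>\<^sup>+h. k (y + h) y * ((f (y + h) + f (y - h)) / 2) \<partial>lborel)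
      = (\<integral>\<^sup>+h. ennreal (1/2) * ennreal (k (y + h) y * f (y + h)) + ennreal (1/2) * ennreal (k (y + h) y * f (y - h)) \<partial>lborel)"
  proof (intro nn_integral_cong)
    fix h
    have "ennreal (r * ((a + b) / 2)) = ennreal t * ennreal (r * a) + ennreal t * ennreal (r * b)"
      if "t = 1/2" "0 \<le> r" "0 \<le> a" "0 \<le> b" for r a b t :: real
    proof -
      have "ennreal t * ennreal (r * a) + ennreal t * ennreal (r * b) = ennreal (t * (r * a) + t * (r * b))"
        using that by (subst ennreal_plus) (auto simp: ennreal_mult)
      moreover have "t * (r * a) + t * (r * b) = r * ((a + b) / 2)"
        using that(1) by (simp add: field_simps)
      ultimately show ?thesis by simp
    qed
    then show "ennreal (k (y + h) y * ((f (y + h) + f (y - h)) / 2))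
       = ennreal (1/2) * ennreal (k (y + h) y * f (y + h)) + ennreal (1/2) * ennreal (k (y + h) y * f (y - h))"
      using k_nonneg f by blast
  qed
  also have "\<dots> = ennreal (1/2) * (\<integral>\<^sup>+h. k (y + h) y * f (y + h) \<partial>lborel) + ennreal (1/2) * (\<integral>\<^sup>+h. k (y + h) y * f (y - h) \<partial>lborel)"
    by (simp add: nn_integral_add nn_integral_cmult)
  also have "\<dots> = (\<integral>\<^sup>+x. k x y * f x \<partial>lborel)"
    unfolding a[symmetric] b[symmetric] by (rule half)
  finally show ?thesis by simp
qed

text \<open>
  The adjoint of the integral operator, applied to \<open>exp (- \<epsilon> \<bar>x - c\<bar>)\<close>, stays below
  \<open>cosh (\<epsilon> M)\<close> times this function, with a gap of the order of \<open>\<epsilon>\<close> near the kink.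
\<close>
lemma exp_test_upper:
  assumes e: "0 < \<epsilon>"
  shows "(\<integral>\<^sup>+x. k x y * exp (- \<epsilon> * \<bar>x - c\<bar>) \<partial>lborel)
            + ennreal (\<epsilon> * k0 * \<rho>\<^sup>2 / 16 * indicator {c - \<rho>/2..c + \<rho>/2} y)
         \<le> ennreal (cosh (\<epsilon> * M) * exp (- \<epsilon> * \<bar>y - c\<bar>))"
proof -
  define a where "a = y - c"
  define \<psi> where "\<psi> h = (exp (- \<epsilon> * \<bar>y + h - c\<bar>) + exp (- \<epsilon> * \<bar>y - h - c\<bar>)) / 2" for h
  have psi: "(\<integral>\<^sup>+x. k x y * exp (- \<epsilon> * \<bar>x - c\<bar>) \<partial>lborel) = (\<integral>\<^sup>+h. k (y + h) y * \<psi> h \<partial>lborel)"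
    unfolding \<psi>_def by (subst nn_integral_k_symmetrised) auto
  have [measurable]: "\<psi> \<in> borel_measurable borel" unfolding \<psi>_def[abs_def] by measurable
  have psi0: "0 \<le> \<psi> h" for h by (simp add: \<psi>_def)
  define i where "i = (indicator {c - \<rho>/2..c + \<rho>/2} y :: real)"
  have i: "i = (if \<bar>a\<bar> \<le> \<rho>/2 then 1 else 0)"
  proof -
    have "y \<in> {c - \<rho>/2..c + \<rho>/2} \<longleftrightarrow> \<bar>a\<bar> \<le> \<rho>/2" unfolding a_def atLeastAtMost_iff by linarith
    then show ?thesis by (simp add: i_def indicator_def)
  qed
  have pw: "k (y + h) y * \<psi> h
          + k (y + h) y * (\<epsilon> * i * max 0 (\<bar>h\<bar> - \<rho>/2)) \<le> k (y + h) y * (cosh (\<epsilon> * M) * exp (- \<epsilon> * \<bar>a\<bar>))" for h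
  proof (cases "M < \<bar>h\<bar>")
    case True
    then show ?thesis using k_far[of "y + h" y] by simp
  next
    case False
    have "y + h - c = a + h" "y - h - c = a - h" by (auto simp: a_def)
    then have eq: "\<psi> h
        = exp (- \<epsilon> * \<bar>a\<bar>) * cosh (\<epsilon> * h) - sinh (\<epsilon> * max 0 (\<bar>h\<bar> - \<bar>a\<bar>))"
      using exp_abs_symmetric[of \<epsilon> a h] e by (simp only: \<psi>_def less_imp_le)
    have "cosh (\<epsilon> * h) = cosh (\<epsilon> * \<bar>h\<bar>)" by (cases "h \<ge> 0") (auto simp: abs_if)
    also have "\<dots> \<le> cosh (\<epsilon> * M)"
      using e False M_pos by (subst cosh_real_nonneg_le_iff) (auto intro!: mult_left_mono)
    finally have 1: "exp (- \<epsilon> * \<bar>a\<bar>) * cosh (\<epsilon> * h) \<le> cosh (\<epsilon> * M) * exp (- \<epsilon> * \<bar>a\<bar>)" by simp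
    have "\<epsilon> * i * max 0 (\<bar>h\<bar> - \<rho>/2) \<le> \<epsilon> * max 0 (\<bar>h\<bar> - \<bar>a\<bar>)"
      using e by (auto simp: i)
    also have "\<dots> \<le> sinh (\<epsilon> * max 0 (\<bar>h\<bar> - \<bar>a\<bar>))"
      using e by (intro le_sinh) auto
    finally have "\<psi> h + \<epsilon> * i * max 0 (\<bar>h\<bar> - \<rho>/2)
        \<le> cosh (\<epsilon> * M) * exp (- \<epsilon> * \<bar>a\<bar>)" using 1 unfolding eq by linarith
    from mult_left_mono[OF this k_nonneg[of "y+h" y]] show ?thesis by (simp only: distrib_left)
  qed
  have i0: "0 \<le> i" by (simp add: i)
  have low: "ennreal (k0 * \<rho>\<^sup>2 / 16) \<le> (\<integral>\<^sup>+h. k (y + h) y * max 0 (\<bar>h\<bar> - \<rho>/2) \<partial>lborel)"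
  proof -
    have "ennreal (k0 * \<rho>\<^sup>2 / 16) = ennreal (k0 * (\<rho> / 4)) * ennreal (\<rho> - 3*\<rho>/4)"
      using kappa0_pos rho_pos by (subst ennreal_mult[symmetric]) (auto simp: power2_eq_square field_simps)
    also have "ennreal (\<rho> - 3*\<rho>/4) = emeasure lborel {3*\<rho>/4<..<\<rho>}" using rho_pos by simp
    also have "ennreal (k0 * (\<rho> / 4)) * \<dots> = (\<integral>\<^sup>+h. ennreal (k0 * (\<rho> / 4)) * indicator {3*\<rho>/4<..<\<rho>} h \<partial>lborel)"
      by (simp add: nn_integral_cmult_indicator)
    also have "\<dots> \<le> (\<integral>\<^sup>+h. k (y + h) y * max 0 (\<bar>h\<bar> - \<rho>/2) \<partial>lborel)"
    proof (intro nn_integral_mono)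
      fix h :: real
      show "ennreal (k0 * (\<rho> / 4)) * indicator {3*\<rho>/4<..<\<rho>} h \<le> k (y + h) y * max 0 (\<bar>h\<bar> - \<rho>/2)"
      proof (cases "h \<in> {3*\<rho>/4<..<\<rho>}")
        case True
        then have "k0 * (\<rho> / 4) \<le> k (y + h) y * max 0 (\<bar>h\<bar> - \<rho>/2)"
          using kappa0_pos rho_pos k_nonneg k_ge[of "y+h" y] by (intro mult_mono) auto
        then show ?thesis using True by (simp add: ennreal_leI)
      qed auto
    qed
    finally show ?thesis .
  qed
  have "(\<integral>\<^sup>+x. k x y * exp (- \<epsilon> * \<bar>x - c\<bar>) \<partial>lborel) + ennreal (\<epsilon> * k0 * \<rho>\<^sup>2 / 16 * i)
      = (\<integral>\<^sup>+h. k (y + h) y * \<psi> h \<partial>lborel)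
        + ennreal (\<epsilon> * i) * ennreal (k0 * \<rho>\<^sup>2 / 16)"
    using e i0 kappa0_pos unfolding psi by (auto simp: ennreal_mult[symmetric] mult_ac)
  also have "\<dots> \<le> (\<integral>\<^sup>+h. k (y + h) y * \<psi> h \<partial>lborel)
        + ennreal (\<epsilon> * i) * (\<integral>\<^sup>+h. k (y + h) y * max 0 (\<bar>h\<bar> - \<rho>/2) \<partial>lborel)"
    by (intro add_left_mono mult_left_mono low) auto
  also have "\<dots> = (\<integral>\<^sup>+h. ennreal (k (y + h) y * \<psi> h)
        + ennreal (\<epsilon> * i) * ennreal (k (y + h) y * max 0 (\<bar>h\<bar> - \<rho>/2)) \<partial>lborel)"
    by (simp add: nn_integral_add nn_integral_cmult)
  also have "\<dots> \<le> (\<integral>\<^sup>+h. ennreal (cosh (\<epsilon> * M) * exp (- \<epsilon> * \<bar>a\<bar>)) * k (y + h) y \<partial>lborel)"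
  proof (intro nn_integral_mono)
    fix h :: real
    have "ennreal (k (y + h) y * \<psi> h)
        + ennreal (\<epsilon> * i) * ennreal (k (y + h) y * max 0 (\<bar>h\<bar> - \<rho>/2))
      = ennreal (k (y + h) y * \<psi> h
          + k (y + h) y * (\<epsilon> * i * max 0 (\<bar>h\<bar> - \<rho>/2)))"
      using e i0 k_nonneg psi0 by (simp add: ennreal_mult[symmetric] ennreal_plus[symmetric] mult_ac del: ennreal_plus)
    also have "\<dots> \<le> ennreal (k (y + h) y * (cosh (\<epsilon> * M) * exp (- \<epsilon> * \<bar>a\<bar>)))"
      by (intro ennreal_leI pw)
    also have "\<dots> = ennreal (cosh (\<epsilon> * M) * exp (- \<epsilon> * \<bar>a\<bar>)) * k (y + h) y"
      using k_nonneg by (simp add: ennreal_mult[symmetric] mult_ac)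
    finally show "ennreal (k (y + h) y * \<psi> h)
        + ennreal (\<epsilon> * i) * ennreal (k (y + h) y * max 0 (\<bar>h\<bar> - \<rho>/2)) \<le> ennreal (cosh (\<epsilon> * M) * exp (- \<epsilon> * \<bar>a\<bar>)) * k (y + h) y" .
  qed
  also have "\<dots> = ennreal (cosh (\<epsilon> * M) * exp (- \<epsilon> * \<bar>a\<bar>))"
    by (subst nn_integral_cmult) (auto simp: k_mass_shifted)
  finally show ?thesis by (simp add: a_def i_def)
qed

text \<open>
  The converse estimate: the second moment of the jumps produces the factor \<open>1 + O(\<epsilon>\<^sup>2)\<close>, and the loss
  at the kink is confined to \<open>[c - M, c + M]\<close>.
\<close>
lemma exp_test_lower:
  assumes e: "0 < \<epsilon>"
  shows "ennreal ((1 + \<epsilon>\<^sup>2 * k0 * \<rho>^3 / 16) * exp (- \<epsilon> * \<bar>y - c\<bar>))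
       \<le> (\<integral>\<^sup>+x. k x y * exp (- \<epsilon> * \<bar>x - c\<bar>) \<partial>lborel)
            + ennreal (sinh (\<epsilon> * M) * indicator {c - M..c + M} y)"
proof -
  define a where "a = y - c"
  define \<psi> where "\<psi> h = (exp (- \<epsilon> * \<bar>y + h - c\<bar>) + exp (- \<epsilon> * \<bar>y - h - c\<bar>)) / 2" for h
  have psi: "(\<integral>\<^sup>+x. k x y * exp (- \<epsilon> * \<bar>x - c\<bar>) \<partial>lborel) = (\<integral>\<^sup>+h. k (y + h) y * \<psi> h \<partial>lborel)"
    unfolding \<psi>_def by (subst nn_integral_k_symmetrised) auto
  have [measurable]: "\<psi> \<in> borel_measurable borel" unfolding \<psi>_def[abs_def] by measurable
  have psi0: "0 \<le> \<psi> h" for h by (simp add: \<psi>_def)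
  define i where "i = (indicator {c - M..c + M} y :: real)"
  have i: "i = (if \<bar>a\<bar> \<le> M then 1 else 0)" by (auto simp: i_def a_def indicator_def)
  have i0: "0 \<le> i" by (simp add: i)
  have s0: "0 \<le> sinh (\<epsilon> * M)" using e M_pos by simp
  have pw: "k (y + h) y * ((1 + \<epsilon>\<^sup>2 * h\<^sup>2 / 2) * exp (- \<epsilon> * \<bar>a\<bar>)) \<le>
      k (y + h) y * \<psi> h
          + k (y + h) y * (sinh (\<epsilon> * M) * i)" for h
  proof (cases "M < \<bar>h\<bar>")
    case True
    then show ?thesis using k_far[of "y + h" y] by simp
  next
    case False
    have "y + h - c = a + h" "y - h - c = a - h" by (auto simp: a_def)
    then have eq: "\<psi> h
        = exp (- \<epsilon> * \<bar>a\<bar>) * cosh (\<epsilon> * h) - sinh (\<epsilon> * max 0 (\<bar>h\<bar> - \<bar>a\<bar>))"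
      using exp_abs_symmetric[of \<epsilon> a h] e by (simp only: \<psi>_def less_imp_le)
    have 1: "(1 + \<epsilon>\<^sup>2 * h\<^sup>2 / 2) * exp (- \<epsilon> * \<bar>a\<bar>) \<le> cosh (\<epsilon> * h) * exp (- \<epsilon> * \<bar>a\<bar>)"
      using cosh_ge_quadratic[of "\<epsilon> * h"] by (intro mult_right_mono) (auto simp: power_mult_distrib)
    have "sinh (\<epsilon> * max 0 (\<bar>h\<bar> - \<bar>a\<bar>)) \<le> sinh (\<epsilon> * M) * i"
    proof (cases "\<bar>a\<bar> \<le> M")
      case True
      then show ?thesis using e False M_pos by (auto simp: i intro!: mult_left_mono)
    next
      case a: False
      then have "max 0 (\<bar>h\<bar> - \<bar>a\<bar>) = 0" using False by auto
      then show ?thesis using a by (simp add: i)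
    qed
    then have "(1 + \<epsilon>\<^sup>2 * h\<^sup>2 / 2) * exp (- \<epsilon> * \<bar>a\<bar>) \<le> \<psi> h + sinh (\<epsilon> * M) * i"
      using 1 unfolding eq mult.commute[of "exp (- \<epsilon> * \<bar>a\<bar>)"] by linarith
    from mult_left_mono[OF this k_nonneg[of "y+h" y]] show ?thesis by (simp only: distrib_left)
  qed
  have low: "ennreal (k0 * \<rho>^3 / 8) \<le> (\<integral>\<^sup>+h. k (y + h) y * h\<^sup>2 \<partial>lborel)"
  proof -
    have "ennreal (k0 * \<rho>^3 / 8) = ennreal (k0 * (\<rho> / 2)\<^sup>2) * ennreal (\<rho> - \<rho>/2)"
      using kappa0_pos rho_pos by (subst ennreal_mult[symmetric]) (auto simp: power2_eq_square power3_eq_cube field_simps)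
    also have "ennreal (\<rho> - \<rho>/2) = emeasure lborel {\<rho>/2<..<\<rho>}" using rho_pos by simp
    also have "ennreal (k0 * (\<rho> / 2)\<^sup>2) * \<dots> = (\<integral>\<^sup>+h. ennreal (k0 * (\<rho> / 2)\<^sup>2) * indicator {\<rho>/2<..<\<rho>} h \<partial>lborel)"
      by (simp add: nn_integral_cmult_indicator)
    also have "\<dots> \<le> (\<integral>\<^sup>+h. k (y + h) y * h\<^sup>2 \<partial>lborel)"
    proof (intro nn_integral_mono)
      fix h :: real
      show "ennreal (k0 * (\<rho> / 2)\<^sup>2) * indicator {\<rho>/2<..<\<rho>} h \<le> k (y + h) y * h\<^sup>2"
      proof (cases "h \<in> {\<rho>/2<..<\<rho>}")
        case True
        then have "k0 * (\<rho> / 2)\<^sup>2 \<le> k (y + h) y * h\<^sup>2"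
          using kappa0_pos rho_pos k_nonneg k_ge[of "y+h" y] by (intro mult_mono power_mono) auto
        then show ?thesis using True by (simp add: ennreal_leI)
      qed auto
    qed
    finally show ?thesis .
  qed
  have "ennreal ((1 + \<epsilon>\<^sup>2 * k0 * \<rho>^3 / 16) * exp (- \<epsilon> * \<bar>a\<bar>))
      = ennreal (exp (- \<epsilon> * \<bar>a\<bar>)) * 1 + ennreal (\<epsilon>\<^sup>2 / 2 * exp (- \<epsilon> * \<bar>a\<bar>)) * ennreal (k0 * \<rho>^3 / 8)"
    using kappa0_pos rho_pos by (simp add: ennreal_mult[symmetric] ennreal_plus[symmetric] field_simps del: ennreal_plus)
  also have "\<dots> \<le> ennreal (exp (- \<epsilon> * \<bar>a\<bar>)) * (\<integral>\<^sup>+h. k (y + h) y \<partial>lborel)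
      + ennreal (\<epsilon>\<^sup>2 / 2 * exp (- \<epsilon> * \<bar>a\<bar>)) * (\<integral>\<^sup>+h. k (y + h) y * h\<^sup>2 \<partial>lborel)"
    unfolding k_mass_shifted by (intro add_left_mono mult_left_mono low) auto
  also have "\<dots> = (\<integral>\<^sup>+h. ennreal (exp (- \<epsilon> * \<bar>a\<bar>)) * k (y + h) y
      + ennreal (\<epsilon>\<^sup>2 / 2 * exp (- \<epsilon> * \<bar>a\<bar>)) * ennreal (k (y + h) y * h\<^sup>2) \<partial>lborel)"
    by (simp add: nn_integral_add nn_integral_cmult)
  also have "\<dots> \<le> (\<integral>\<^sup>+h. ennreal (k (y + h) y * \<psi> h)
      + ennreal (sinh (\<epsilon> * M) * i) * k (y + h) y \<partial>lborel)"
  proof (intro nn_integral_mono)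
    fix h :: real
    have "ennreal (exp (- \<epsilon> * \<bar>a\<bar>)) * k (y + h) y
        + ennreal (\<epsilon>\<^sup>2 / 2 * exp (- \<epsilon> * \<bar>a\<bar>)) * ennreal (k (y + h) y * h\<^sup>2)
      = ennreal (k (y + h) y * ((1 + \<epsilon>\<^sup>2 * h\<^sup>2 / 2) * exp (- \<epsilon> * \<bar>a\<bar>)))"
      using k_nonneg by (simp add: ennreal_mult[symmetric] ennreal_plus[symmetric] algebra_simps del: ennreal_plus)
    also have "\<dots> \<le> ennreal (k (y + h) y * \<psi> h
          + k (y + h) y * (sinh (\<epsilon> * M) * i))"
      by (intro ennreal_leI pw)
    also have "\<dots> = ennreal (k (y + h) y * \<psi> h)
      + ennreal (sinh (\<epsilon> * M) * i) * k (y + h) y"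
      using k_nonneg i0 s0 psi0 by (subst ennreal_plus) (auto simp: ennreal_mult[symmetric] mult_ac)
    finally show "ennreal (exp (- \<epsilon> * \<bar>a\<bar>)) * k (y + h) y
        + ennreal (\<epsilon>\<^sup>2 / 2 * exp (- \<epsilon> * \<bar>a\<bar>)) * ennreal (k (y + h) y * h\<^sup>2) \<le> \<dots>" .
  qed
  also have "\<dots> = (\<integral>\<^sup>+h. k (y + h) y * \<psi> h \<partial>lborel)
      + ennreal (sinh (\<epsilon> * M) * i)"
    by (simp add: nn_integral_add nn_integral_cmult k_mass_shifted)
  also have "\<dots> = (\<integral>\<^sup>+x. k x y * exp (- \<epsilon> * \<bar>x - c\<bar>) \<partial>lborel) + ennreal (sinh (\<epsilon> * M) * i)"
    unfolding psi ..
  finally show ?thesis by (simp add: a_def i_def)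
qed

lemma nn_integral_exp_abs:
  assumes e: "0 < \<epsilon>"
  shows "(\<integral>\<^sup>+x. exp (- \<epsilon> * \<bar>x - c\<bar>) \<partial>lborel) = ennreal (2 / \<epsilon>)"
proof -
  have half: "(\<integral>\<^sup>+x. ennreal (exp (- \<epsilon> * x)) * indicator {0..} x \<partial>lborel) = ennreal (0 - (- exp (- \<epsilon> * 0) / \<epsilon>))"
  proof (rule nn_integral_FTC_atLeast)
    show "((\<lambda>x. - exp (- \<epsilon> * x) / \<epsilon>) \<longlongrightarrow> 0) at_top" using e by real_asymp
  qed (use e in \<open>auto intro!: derivative_eq_intros\<close>)
  have "(\<integral>\<^sup>+x. exp (- \<epsilon> * \<bar>x - c\<bar>) \<partial>lborel) = (\<integral>\<^sup>+h. exp (- \<epsilon> * \<bar>h\<bar>) \<partial>lborel)"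
    by (subst nn_integral_shift[of _ c]) auto
  also have "\<dots> = (\<integral>\<^sup>+x. ennreal (exp (- \<epsilon> * x)) * indicator {0..} x + ennreal (exp (\<epsilon> * x)) * indicator {..0} x \<partial>lborel)"
    by (intro nn_integral_cong_AE AE_I[where N="{0}"]) (auto simp: indicator_def abs_if)
  also have "\<dots> = (\<integral>\<^sup>+x. ennreal (exp (- \<epsilon> * x)) * indicator {0..} x \<partial>lborel) + (\<integral>\<^sup>+x. ennreal (exp (\<epsilon> * x)) * indicator {..0} x \<partial>lborel)"
    by (intro nn_integral_add) auto
  also have "(\<integral>\<^sup>+x. ennreal (exp (\<epsilon> * x)) * indicator {..0} x \<partial>lborel) = (\<integral>\<^sup>+x. ennreal (exp (- \<epsilon> * x)) * indicator {0..} x \<partial>lborel)"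
    by (subst nn_integral_reflect) (auto simp: indicator_def intro!: nn_integral_cong)
  finally show ?thesis using e unfolding half by (simp flip: ennreal_plus)
qed

end

section \<open>An almost stationary weight\<close>

text \<open>
  The two bounds of the weight. The upper one adds up \<open>\<lceil>2 M / \<rho>\<rceil>\<close> local masses, which cover
  \<open>[x - M, x + M]\<close> by intervals of length \<open>\<rho>\<close>. In the lower one, \<open>\<lceil>4 M / \<rho>\<rceil>\<close> is the number of steps of
  length \<open>\<rho> / 4\<close> in which the mass of an interval of radius \<open>M\<close> is spread to its centre.
\<close>
definition weight_upper :: "real \<Rightarrow> real \<Rightarrow> real \<Rightarrow> real \<Rightarrow> real" where
  "weight_upper k0 k1 M \<rho> = 1 + k1 * (real (nat \<lceil>2 * M / \<rho>\<rceil>) * (32 * M\<^sup>2 / (k0 * \<rho>\<^sup>2)))"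

definition weight_lower :: "real \<Rightarrow> real \<Rightarrow> real \<Rightarrow> real" where
  "weight_lower k0 M \<rho> =
     k0 / 2 * (k0 * \<rho> / 16) ^ nat \<lceil>4 * M / \<rho>\<rceil> * (k0 * \<rho>^3 / (8 * M * cosh (sqrt (16 / (k0 * \<rho>^3)) * M)))"

lemma weight_upper_pos:
  assumes "0 < k0" "0 \<le> k1"
  shows "0 < weight_upper k0 k1 M \<rho>"
  unfolding weight_upper_def
  by (intro add_pos_nonneg mult_nonneg_nonneg divide_nonneg_nonneg) (use assms in auto)

lemma weight_lower_pos:
  assumes "0 < k0" "0 < M" "0 < \<rho>"
  shows "0 < weight_lower k0 M \<rho>"
  using assms by (simp add: weight_lower_def)

text \<open>
  The action of the kernel on nonnegative functions, and its adjoint.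
\<close>
abbreviation (in jump_kernel) Knn :: "(real \<Rightarrow> ennreal) \<Rightarrow> real \<Rightarrow> ennreal" where
  "Knn f x \<equiv> (\<integral>\<^sup>+y. ennreal (k x y) * f y \<partial>lborel)"

abbreviation (in jump_kernel) Kadj :: "(real \<Rightarrow> ennreal) \<Rightarrow> real \<Rightarrow> ennreal" where
  "Kadj \<phi> y \<equiv> (\<integral>\<^sup>+x. ennreal (k x y) * \<phi> x \<partial>lborel)"

context jump_kernel
begin

lemma kappa1_pos: "0 < k1"
  using k_ge[of 0 0] k_le[of 0 0] kappa0_pos rho_pos by simp

text \<open>
  The increasing iterates of \<open>w \<mapsto> (1 - \<theta>) + \<theta> K w\<close> from \<open>0\<close>. They take values in \<open>ennreal\<close>, which makes
  monotone limits and Tonelli's theorem available without integrability conditions.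
\<close>
primrec weight_iter :: "real \<Rightarrow> nat \<Rightarrow> real \<Rightarrow> ennreal" where
  "weight_iter \<theta> 0 x = 0"
| "weight_iter \<theta> (Suc n) x = ennreal (1 - \<theta>) + ennreal \<theta> * Knn (weight_iter \<theta> n) x"

declare weight_iter.simps(2) [simp del]

lemma weight_iter_measurable [measurable]: "weight_iter \<theta> n \<in> borel_measurable borel"
proof (induction n)
  case 0
  then show ?case by simp
next
  case (Suc n)
  note [measurable] = Suc
  have "(\<lambda>x. ennreal (1 - \<theta>) + ennreal \<theta> * Knn (weight_iter \<theta> n) x) \<in> borel_measurable borel"
    by measurable
  then show ?case by (simp add: weight_iter.simps(2)[abs_def])
qed

lemma weight_iter_mono: "weight_iter \<theta> n x \<le> weight_iter \<theta> (Suc n) x"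
proof (induction n arbitrary: x)
  case (Suc n)
  have "ennreal (1 - \<theta>) + ennreal \<theta> * Knn (weight_iter \<theta> n) x
     \<le> ennreal (1 - \<theta>) + ennreal \<theta> * Knn (weight_iter \<theta> (Suc n)) x"
    by (intro add_left_mono mult_left_mono nn_integral_mono Suc) auto
  then show ?case by (simp only: weight_iter.simps(2))
qed simp

lemma nn_integral_k_mult_le:
  fixes f :: "real \<Rightarrow> ennreal"
  assumes [measurable]: "f \<in> borel_measurable borel"
  shows "Knn f x \<le> ennreal k1 * (\<integral>\<^sup>+y. indicator {x - M..x + M} y * f y \<partial>lborel)"
proof -
  have "Knn f x \<le> (\<integral>\<^sup>+y. ennreal k1 * (indicator {x - M..x + M} y * f y) \<partial>lborel)"
  proof (intro nn_integral_mono)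
    fix y
    show "k x y * f y \<le> ennreal k1 * (indicator {x - M..x + M} y * f y)"
    proof (cases "y \<in> {x - M..x + M}")
      case True
      then show ?thesis using k_le by (auto intro!: mult_right_mono ennreal_leI)
    next
      case False
      then have "M < \<bar>x - y\<bar>" by auto
      then show ?thesis using k_far by simp
    qed
  qed
  then show ?thesis by (simp add: nn_integral_cmult)
qed

lemma weight_iter_bounded:
  assumes "0 \<le> \<theta>" "\<theta> \<le> 1"
  shows "\<exists>b\<ge>0. \<forall>x. weight_iter \<theta> n x \<le> ennreal b"
proof (induction n)
  case 0
  then show ?case by (intro exI[of _ 0]) auto
next
  case (Suc n)
  then obtain b where b: "b \<ge> 0" "\<And>x. weight_iter \<theta> n x \<le> ennreal b" by auto
  have "weight_iter \<theta> (Suc n) x \<le> ennreal (1 + k1 * (b * (2 * M)))" for x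
  proof -
    have "Knn (weight_iter \<theta> n) x \<le> ennreal k1 * (\<integral>\<^sup>+y. indicator {x - M..x + M} y * weight_iter \<theta> n y \<partial>lborel)"
      by (rule nn_integral_k_mult_le) measurable
    also have "\<dots> \<le> ennreal k1 * (\<integral>\<^sup>+y. ennreal b * indicator {x - M..x + M} y \<partial>lborel)"
      using b by (intro mult_left_mono nn_integral_mono) (auto simp: indicator_def)
    also have "\<dots> = ennreal (k1 * (b * (2 * M)))"
      using b kappa1_pos M_pos by (simp add: nn_integral_cmult_indicator ennreal_mult)
    finally have 1: "Knn (weight_iter \<theta> n) x \<le> ennreal (k1 * (b * (2 * M)))" .
    have "weight_iter \<theta> (Suc n) x \<le> ennreal 1 + ennreal 1 * ennreal (k1 * (b * (2 * M)))"
      unfolding weight_iter.simps(2) using assms by (intro add_mono mult_mono 1 ennreal_leI) auto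
    also have "\<dots> = ennreal (1 + k1 * (b * (2 * M)))"
      using b kappa1_pos M_pos by (subst ennreal_plus) auto
    finally show ?thesis .
  qed
  then show ?case using b kappa1_pos M_pos by (intro exI[of _ "1 + k1 * (b * (2 * M))"]) auto
qed

lemma nn_integral_k_swap:
  fixes f \<phi> :: "real \<Rightarrow> ennreal"
  assumes [measurable]: "f \<in> borel_measurable borel" "\<phi> \<in> borel_measurable borel"
  shows "(\<integral>\<^sup>+x. \<phi> x * Knn f x \<partial>lborel) = (\<integral>\<^sup>+y. Kadj \<phi> y * f y \<partial>lborel)"
proof -
  have "(\<integral>\<^sup>+x. \<phi> x * Knn f x \<partial>lborel) = (\<integral>\<^sup>+x. (\<integral>\<^sup>+y. \<phi> x * (k x y * f y) \<partial>lborel) \<partial>lborel)"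
    by (simp add: nn_integral_cmult)
  also have "\<dots> = (\<integral>\<^sup>+y. (\<integral>\<^sup>+x. \<phi> x * (k x y * f y) \<partial>lborel) \<partial>lborel)"
    by (rule lborel_pair.Fubini') measurable
  also have "\<dots> = (\<integral>\<^sup>+y. Kadj \<phi> y * f y \<partial>lborel)"
  proof (intro nn_integral_cong)
    fix y
    have "(\<integral>\<^sup>+x. \<phi> x * (k x y * f y) \<partial>lborel) = (\<integral>\<^sup>+x. k x y * \<phi> x * f y \<partial>lborel)"
      by (simp add: mult_ac)
    then show "(\<integral>\<^sup>+x. \<phi> x * (k x y * f y) \<partial>lborel) = Kadj \<phi> y * f y"
      by (simp add: nn_integral_multc)
  qed
  finally show ?thesis .
qed

text \<open>
  Testing the recursion with \<open>exp (- \<epsilon> \<bar>y - c\<bar>)\<close> bounds the local mass of each iterate uniformly in \<open>n\<close>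
  and \<open>\<nu>\<close>. Working with the iterates rather than with their limit makes the integral to be cancelled
  finite.
\<close>
lemma weight_iter_local_mass:
  assumes l: "0 < \<nu>" "\<nu> \<le> 1" and \<theta>: "\<theta> = 1 / (1 + \<nu>)"
  shows "(\<integral>\<^sup>+y. indicator {c - \<rho>/2..c + \<rho>/2} y * weight_iter \<theta> n y \<partial>lborel) \<le> ennreal (32 * M\<^sup>2 / (k0 * \<rho>\<^sup>2))"
proof -
  \<comment> \<open>this gives \<open>\<theta> cosh (\<epsilon> M) \<le> 1\<close>, since \<open>cosh s \<le> 1 + s\<^sup>2\<close> for \<open>\<bar>s\<bar> \<le> 1\<close>\<close>
  define \<epsilon> where "\<epsilon> = sqrt \<nu> / M"
  have e: "0 < \<epsilon>" using l M_pos by (simp add: \<epsilon>_def)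
  have th: "0 < \<theta>" "\<theta> \<le> 1" "1 - \<theta> = \<theta> * \<nu>" using l by (auto simp: \<theta> field_simps)
  define C where "C = \<epsilon> * k0 * \<rho>\<^sup>2 / 16"
  have C: "0 < C" using e kappa0_pos rho_pos by (simp add: C_def)
  define \<phi> where "\<phi> = (\<lambda>y. ennreal (exp (- \<epsilon> * \<bar>y - c\<bar>)))"
  have [measurable]: "\<phi> \<in> borel_measurable borel" by (simp add: \<phi>_def)
  define B where "B = (indicator {c - \<rho>/2..c + \<rho>/2} :: real \<Rightarrow> ennreal)"
  have [measurable]: "B \<in> borel_measurable borel" by (simp add: B_def)
  have int\<phi>: "(\<integral>\<^sup>+y. \<phi> y \<partial>lborel) = ennreal (2 / \<epsilon>)"
    using nn_integral_exp_abs[OF e, of c] by (simp add: \<phi>_def)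
  have "\<epsilon> * M = sqrt \<nu>" using M_pos by (simp add: \<epsilon>_def)
  then have "cosh (\<epsilon> * M) \<le> 1 + \<nu>" using cosh_le_quadratic[of "sqrt \<nu>"] l by simp
  then have ch: "\<theta> * cosh (\<epsilon> * M) \<le> 1" using l by (simp add: \<theta> field_simps)
  have test: "ennreal \<theta> * Kadj \<phi> y + ennreal (\<theta> * C) * B y \<le> \<phi> y" for y
  proof -
    have CB: "ennreal (C * indicator {c - \<rho>/2..c + \<rho>/2} y) = ennreal C * B y"
      by (simp add: B_def indicator_def)
    have "Kadj \<phi> y + ennreal C * B y \<le> ennreal (cosh (\<epsilon> * M) * exp (- \<epsilon> * \<bar>y - c\<bar>))"
      using exp_test_upper[OF e, of y c] k_nonneg unfolding C_def[symmetric] CB by (simp add: \<phi>_def ennreal_mult)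
    then have "ennreal \<theta> * (Kadj \<phi> y + ennreal C * B y) \<le> ennreal \<theta> * ennreal (cosh (\<epsilon> * M) * exp (- \<epsilon> * \<bar>y - c\<bar>))"
      by (intro mult_left_mono) auto
    also have "\<dots> = ennreal ((\<theta> * cosh (\<epsilon> * M)) * exp (- \<epsilon> * \<bar>y - c\<bar>))"
      using th by (simp add: ennreal_mult[symmetric] mult_ac)
    also have "\<dots> \<le> \<phi> y"
      unfolding \<phi>_def using ch by (intro ennreal_leI) (simp add: mult_left_le_one_le th)
    finally show ?thesis using th C by (simp add: distrib_left ennreal_mult mult.assoc)
  qed
  define I where "I = (\<lambda>n. (\<integral>\<^sup>+y. \<phi> y * weight_iter \<theta> n y \<partial>lborel))"
  have fin: "I m < \<infinity>" for m
  proof -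
    obtain b where b: "b \<ge> 0" "\<And>x. weight_iter \<theta> m x \<le> ennreal b" using weight_iter_bounded[of \<theta> m] th by auto
    have "I m \<le> (\<integral>\<^sup>+y. \<phi> y * ennreal b \<partial>lborel)" unfolding I_def by (intro nn_integral_mono mult_left_mono b) auto
    also have "\<dots> < \<infinity>" by (simp add: nn_integral_multc int\<phi> ennreal_mult_less_top)
    finally show ?thesis .
  qed
  have Suc: "I (Suc n) = ennreal (1 - \<theta>) * ennreal (2 / \<epsilon>) + ennreal \<theta> * (\<integral>\<^sup>+y. Kadj \<phi> y * weight_iter \<theta> n y \<partial>lborel)"
  proof -
    have "I (Suc n) = (\<integral>\<^sup>+x. ennreal (1 - \<theta>) * \<phi> x + ennreal \<theta> * (\<phi> x * Knn (weight_iter \<theta> n) x) \<partial>lborel)"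
      unfolding I_def weight_iter.simps(2) by (intro nn_integral_cong) (simp add: distrib_left mult_ac)
    also have "\<dots> = ennreal (1 - \<theta>) * ennreal (2 / \<epsilon>) + ennreal \<theta> * (\<integral>\<^sup>+x. \<phi> x * Knn (weight_iter \<theta> n) x \<partial>lborel)"
      by (simp add: nn_integral_add nn_integral_cmult int\<phi>)
    finally show ?thesis by (simp add: nn_integral_k_swap)
  qed
  define X where "X = (\<integral>\<^sup>+y. B y * weight_iter \<theta> n y \<partial>lborel)"
  have "I (Suc n) + ennreal (\<theta> * C) * X
      = ennreal (1 - \<theta>) * ennreal (2 / \<epsilon>) + (\<integral>\<^sup>+y. (ennreal \<theta> * Kadj \<phi> y + ennreal (\<theta> * C) * B y) * weight_iter \<theta> n y \<partial>lborel)"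
    unfolding Suc X_def by (simp add: distrib_right nn_integral_add nn_integral_cmult mult.assoc add.assoc)
  also have "\<dots> \<le> ennreal (1 - \<theta>) * ennreal (2 / \<epsilon>) + I n"
    unfolding I_def by (intro add_left_mono nn_integral_mono mult_right_mono test) auto
  also have "\<dots> \<le> ennreal (1 - \<theta>) * ennreal (2 / \<epsilon>) + I (Suc n)"
    unfolding I_def by (intro add_left_mono nn_integral_mono mult_left_mono weight_iter_mono) auto
  finally have "I (Suc n) + ennreal (\<theta> * C) * X \<le> I (Suc n) + ennreal ((1 - \<theta>) * (2 / \<epsilon>))"
    using th(2) e by (subst ennreal_mult) (auto simp: add.commute)
  then have "ennreal (\<theta> * C) * X \<le> ennreal ((1 - \<theta>) * (2 / \<epsilon>))"
    using fin[of "Suc n"] by (auto simp: ennreal_add_left_cancel_le)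
  then have "X \<le> ennreal ((1 - \<theta>) * (2 / \<epsilon>) / (\<theta> * C))"
    using th C e by (intro ennreal_le_divide_of_mult_le) auto
  also have "(1 - \<theta>) * (2 / \<epsilon>) / (\<theta> * C) = 32 * \<nu> / (\<epsilon>\<^sup>2 * (k0 * \<rho>\<^sup>2))"
    unfolding th(3) C_def using th e by (simp add: power2_eq_square)
  also have "\<dots> = 32 * M\<^sup>2 / (k0 * \<rho>\<^sup>2)"
    unfolding \<epsilon>_def using l M_pos by (simp add: power_divide)
  finally show ?thesis unfolding X_def B_def .
qed

lemma weight_iter_upper:
  assumes l: "0 < \<nu>" "\<nu> \<le> 1" and \<theta>: "\<theta> = 1 / (1 + \<nu>)"
  shows "weight_iter \<theta> n x \<le> ennreal (weight_upper k0 k1 M \<rho>)"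
proof (cases n)
  case 0
  then show ?thesis by simp
next
  case (Suc m)
  define m2 where "m2 = 32 * M\<^sup>2 / (k0 * \<rho>\<^sup>2)"
  have m2: "0 \<le> m2" using kappa0_pos by (simp add: m2_def)
  have th: "0 < \<theta>" "\<theta> \<le> 1" using l by (auto simp: \<theta> field_simps)
  have cover: "(\<integral>\<^sup>+y. indicator {a..a + real j * \<rho>} y * weight_iter \<theta> m y \<partial>lborel) \<le> ennreal (real j * m2)" for a j
  proof (induction j)
    case 0
    have "(\<integral>\<^sup>+y. indicator {a..a + real 0 * \<rho>} y * weight_iter \<theta> m y \<partial>lborel) = (\<integral>\<^sup>+y. 0 \<partial>(lborel::real measure))"
      by (intro nn_integral_cong_AE AE_I[where N="{a}"]) (auto simp: indicator_def)
    then show ?case by simp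
  next
    case (Suc j)
    let ?c = "a + real j * \<rho> + \<rho>/2"
    have "(\<integral>\<^sup>+y. indicator {a..a + real (Suc j) * \<rho>} y * weight_iter \<theta> m y \<partial>lborel)
       \<le> (\<integral>\<^sup>+y. indicator {a..a + real j * \<rho>} y * weight_iter \<theta> m y + indicator {?c - \<rho>/2..?c + \<rho>/2} y * weight_iter \<theta> m y \<partial>lborel)"
      by (intro nn_integral_mono) (auto simp: indicator_def algebra_simps)
    also have "\<dots> = (\<integral>\<^sup>+y. indicator {a..a + real j * \<rho>} y * weight_iter \<theta> m y \<partial>lborel) + (\<integral>\<^sup>+y. indicator {?c - \<rho>/2..?c + \<rho>/2} y * weight_iter \<theta> m y \<partial>lborel)"
      by (intro nn_integral_add) auto
    also have "\<dots> \<le> ennreal (real j * m2) + ennreal m2"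
      unfolding m2_def by (intro add_mono weight_iter_local_mass[OF l \<theta>] Suc[unfolded m2_def])
    also have "\<dots> = ennreal (real (Suc j) * m2)"
      using m2 by (subst ennreal_plus[symmetric]) (auto simp: algebra_simps)
    finally show ?case .
  qed
  define N where "N = nat \<lceil>2 * M / \<rho>\<rceil>"
  have "2 * M / \<rho> \<le> real N" unfolding N_def by (rule real_nat_ceiling_ge)
  then have N: "2 * M \<le> real N * \<rho>" using rho_pos by (simp add: field_simps)
  have "Knn (weight_iter \<theta> m) x \<le> ennreal k1 * (\<integral>\<^sup>+y. indicator {x - M..x + M} y * weight_iter \<theta> m y \<partial>lborel)"
    by (rule nn_integral_k_mult_le) measurable
  also have "\<dots> \<le> ennreal k1 * (\<integral>\<^sup>+y. indicator {x - M..(x - M) + real N * \<rho>} y * weight_iter \<theta> m y \<partial>lborel)"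
    using N by (intro mult_left_mono nn_integral_mono) (auto simp: indicator_def)
  also have "\<dots> \<le> ennreal k1 * ennreal (real N * m2)" by (intro mult_left_mono cover) auto
  also have "\<dots> = ennreal (k1 * (real N * m2))" using kappa1_pos m2 by (simp add: ennreal_mult)
  finally have 1: "Knn (weight_iter \<theta> m) x \<le> ennreal (k1 * (real N * m2))" .
  have "weight_iter \<theta> (Suc m) x \<le> ennreal 1 + ennreal 1 * ennreal (k1 * (real N * m2))"
    unfolding weight_iter.simps(2) using th by (intro add_mono mult_mono 1 ennreal_leI) auto
  also have "\<dots> = ennreal (1 + k1 * (real N * m2))"
    using m2 kappa1_pos by (subst ennreal_plus) auto
  finally show ?thesis unfolding Suc weight_upper_def N_def m2_def .
qed

text \<open>
  The minimal solution of \<open>w = (1 - \<theta>) + \<theta> K w\<close>. Of this equation only the inequality \<open>\<ge>\<close> is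
  needed.
\<close>
definition weight_sup :: "real \<Rightarrow> real \<Rightarrow> ennreal" where
  "weight_sup \<theta> x = (SUP n. weight_iter \<theta> n x)"

lemma weight_sup_measurable [measurable]: "weight_sup \<theta> \<in> borel_measurable borel"
  unfolding weight_sup_def[abs_def] by measurable

lemma weight_sup_supersolution:
  "ennreal (1 - \<theta>) + ennreal \<theta> * Knn (weight_sup \<theta>) x \<le> weight_sup \<theta> x"
proof -
  have inc: "incseq (\<lambda>n. weight_iter \<theta> n y)" for y
    by (intro incseq_SucI weight_iter_mono)
  have "Knn (weight_sup \<theta>) x = (\<integral>\<^sup>+y. (SUP n. k x y * weight_iter \<theta> n y) \<partial>lborel)"
    unfolding weight_sup_def by (simp add: SUP_mult_left_ennreal)
  also have "\<dots> = (SUP n. Knn (weight_iter \<theta> n) x)"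
    using inc by (intro nn_integral_monotone_convergence_SUP)
      (auto simp: incseq_def le_fun_def intro!: mult_left_mono)
  finally have "ennreal (1 - \<theta>) + ennreal \<theta> * Knn (weight_sup \<theta>) x
       = (SUP n. ennreal (1 - \<theta>) + ennreal \<theta> * Knn (weight_iter \<theta> n) x)"
    by (simp add: SUP_mult_left_ennreal ennreal_SUP_add_right)
  also have "\<dots> = (SUP n. weight_iter \<theta> (Suc n) x)" by (simp add: weight_iter.simps(2))
  also have "\<dots> \<le> weight_sup \<theta> x" unfolding weight_sup_def by (intro SUP_least SUP_upper) auto
  finally show ?thesis .
qed

lemma weight_sup_upper:
  assumes l: "0 < \<nu>" "\<nu> \<le> 1" and \<theta>: "\<theta> = 1 / (1 + \<nu>)"
  shows "weight_sup \<theta> x \<le> ennreal (weight_upper k0 k1 M \<rho>)"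
  unfolding weight_sup_def by (intro SUP_least weight_iter_upper[OF assms])

text \<open>
  The lower bound for the mass of \<open>w\<close> in an interval of radius \<open>M\<close>, again uniform in \<open>\<nu>\<close>.
\<close>
lemma weight_sup_local_mass:
  assumes l: "0 < \<nu>" "\<nu> \<le> 1" and \<theta>: "\<theta> = 1 / (1 + \<nu>)"
  shows "ennreal (k0 * \<rho>^3 / (8 * M * cosh (sqrt (16 / (k0 * \<rho>^3)) * M)))
       \<le> (\<integral>\<^sup>+y. indicator {c - M..c + M} y * weight_sup \<theta> y \<partial>lborel)"
proof -
  define \<epsilon>\<^sub>1 where "\<epsilon>\<^sub>1 = sqrt (16 / (k0 * \<rho>^3))"
  \<comment> \<open>now the growth factor of \<open>exp_test_lower\<close> is exactly \<open>1 + \<nu> = 1 / \<theta>\<close>\<close>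
  define \<epsilon> where "\<epsilon> = sqrt \<nu> * \<epsilon>\<^sub>1"
  have e1: "0 < \<epsilon>\<^sub>1" using kappa0_pos rho_pos by (simp add: \<epsilon>\<^sub>1_def)
  have e: "0 < \<epsilon>" "\<epsilon> \<le> \<epsilon>\<^sub>1" using e1 l by (auto simp: \<epsilon>_def mult_left_le_one_le)
  have th: "0 < \<theta>" "\<theta> \<le> 1" "1 - \<theta> = \<theta> * \<nu>" "\<theta> * (1 + \<nu>) = 1" using l by (auto simp: \<theta> field_simps)
  have "\<epsilon>\<^sub>1\<^sup>2 * k0 * \<rho>^3 / 16 = 1"
    using kappa0_pos rho_pos by (simp add: \<epsilon>\<^sub>1_def)
  then have el: "\<epsilon>\<^sup>2 * k0 * \<rho>^3 / 16 = \<nu>" using l by (simp add: \<epsilon>_def power_mult_distrib)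
  define s where "s = sinh (\<epsilon> * M)"
  have s: "0 < s" using e M_pos by (simp add: s_def)
  define \<phi> where "\<phi> = (\<lambda>y. ennreal (exp (- \<epsilon> * \<bar>y - c\<bar>)))"
  have [measurable]: "\<phi> \<in> borel_measurable borel" by (simp add: \<phi>_def)
  define B where "B = (indicator {c - M..c + M} :: real \<Rightarrow> ennreal)"
  have [measurable]: "B \<in> borel_measurable borel" by (simp add: B_def)
  have int\<phi>: "(\<integral>\<^sup>+y. \<phi> y \<partial>lborel) = ennreal (2 / \<epsilon>)"
    using nn_integral_exp_abs[OF e(1), of c] by (simp add: \<phi>_def)
  have test: "\<phi> y \<le> ennreal \<theta> * Kadj \<phi> y + ennreal (\<theta> * s) * B y" for y
  proof -
    have CB: "ennreal (s * indicator {c - M..c + M} y) = ennreal s * B y"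
      by (simp add: B_def indicator_def)
    have "ennreal ((1 + \<nu>) * exp (- \<epsilon> * \<bar>y - c\<bar>)) \<le> Kadj \<phi> y + ennreal s * B y"
      using exp_test_lower[OF e(1), of y c] k_nonneg unfolding el s_def[symmetric] CB by (simp add: \<phi>_def ennreal_mult)
    then have "ennreal \<theta> * ennreal ((1 + \<nu>) * exp (- \<epsilon> * \<bar>y - c\<bar>)) \<le> ennreal \<theta> * (Kadj \<phi> y + ennreal s * B y)"
      by (intro mult_left_mono) auto
    moreover have "ennreal \<theta> * ennreal ((1 + \<nu>) * exp (- \<epsilon> * \<bar>y - c\<bar>)) = ennreal ((\<theta> * (1 + \<nu>)) * exp (- \<epsilon> * \<bar>y - c\<bar>))"
      using th l by (simp add: ennreal_mult[symmetric] mult_ac)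
    ultimately show ?thesis unfolding th(4) using th s by (simp add: distrib_left ennreal_mult mult.assoc \<phi>_def)
  qed
  define Q where "Q = ennreal \<theta> * (\<integral>\<^sup>+y. Kadj \<phi> y * weight_sup \<theta> y \<partial>lborel)"
  define X where "X = (\<integral>\<^sup>+y. B y * weight_sup \<theta> y \<partial>lborel)"
  have "ennreal (1 - \<theta>) * ennreal (2 / \<epsilon>) + Q
      = (\<integral>\<^sup>+x. \<phi> x * (ennreal (1 - \<theta>) + ennreal \<theta> * Knn (weight_sup \<theta>) x) \<partial>lborel)"
  proof -
    have "(\<integral>\<^sup>+x. \<phi> x * (ennreal (1 - \<theta>) + ennreal \<theta> * Knn (weight_sup \<theta>) x) \<partial>lborel)
      = (\<integral>\<^sup>+x. ennreal (1 - \<theta>) * \<phi> x + ennreal \<theta> * (\<phi> x * Knn (weight_sup \<theta>) x) \<partial>lborel)"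
      by (intro nn_integral_cong) (simp add: distrib_left mult_ac)
    also have "\<dots> = ennreal (1 - \<theta>) * ennreal (2 / \<epsilon>) + ennreal \<theta> * (\<integral>\<^sup>+x. \<phi> x * Knn (weight_sup \<theta>) x \<partial>lborel)"
      by (simp add: nn_integral_add nn_integral_cmult int\<phi>)
    finally show ?thesis by (simp add: nn_integral_k_swap Q_def)
  qed
  also have "\<dots> \<le> (\<integral>\<^sup>+x. \<phi> x * weight_sup \<theta> x \<partial>lborel)"
    by (intro nn_integral_mono mult_left_mono weight_sup_supersolution) auto
  finally have 1: "ennreal (1 - \<theta>) * ennreal (2 / \<epsilon>) + Q \<le> (\<integral>\<^sup>+x. \<phi> x * weight_sup \<theta> x \<partial>lborel)" .
  also have "\<dots> \<le> (\<integral>\<^sup>+y. (ennreal \<theta> * Kadj \<phi> y + ennreal (\<theta> * s) * B y) * weight_sup \<theta> y \<partial>lborel)"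
    by (intro nn_integral_mono mult_right_mono test) auto
  also have "\<dots> = Q + ennreal (\<theta> * s) * X"
    unfolding Q_def X_def by (simp add: distrib_right nn_integral_add nn_integral_cmult mult.assoc)
  finally have "Q + ennreal ((1 - \<theta>) * (2 / \<epsilon>)) \<le> Q + ennreal (\<theta> * s) * X"
    using th(2) e by (subst ennreal_mult) (auto simp: add.commute)
  moreover have "Q < \<infinity>"
  proof -
    have "Q \<le> ennreal (1 - \<theta>) * ennreal (2 / \<epsilon>) + Q" by simp
    also note 1
    also have "(\<integral>\<^sup>+x. \<phi> x * weight_sup \<theta> x \<partial>lborel) \<le> (\<integral>\<^sup>+x. \<phi> x * ennreal (weight_upper k0 k1 M \<rho>) \<partial>lborel)"
      by (intro nn_integral_mono mult_left_mono weight_sup_upper[OF assms]) auto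
    also have "\<dots> < \<infinity>" by (simp add: nn_integral_multc int\<phi> ennreal_mult_less_top)
    finally show ?thesis .
  qed
  ultimately have "ennreal ((1 - \<theta>) * (2 / \<epsilon>)) \<le> ennreal (\<theta> * s) * X"
    by (auto simp: ennreal_add_left_cancel_le)
  then have "ennreal ((1 - \<theta>) * (2 / \<epsilon>) / (\<theta> * s)) \<le> X"
    using th s e by (intro ennreal_divide_le_of_le_mult) auto
  moreover have "k0 * \<rho>^3 / (8 * M * cosh (\<epsilon>\<^sub>1 * M)) \<le> (1 - \<theta>) * (2 / \<epsilon>) / (\<theta> * s)"
  proof -
    have "s \<le> (\<epsilon> * M) * cosh (\<epsilon> * M)" unfolding s_def using e M_pos by (intro sinh_le_mult_cosh) auto
    also have "\<dots> \<le> (\<epsilon> * M) * cosh (\<epsilon>\<^sub>1 * M)"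
      using e M_pos by (intro mult_left_mono cosh_real_nonneg_le_iff[THEN iffD2]) auto
    finally have "2 * \<nu> / (\<epsilon> * ((\<epsilon> * M) * cosh (\<epsilon>\<^sub>1 * M))) \<le> 2 * \<nu> / (\<epsilon> * s)"
      using l e s M_pos by (intro divide_left_mono mult_left_mono) (auto intro!: mult_pos_pos)
    also have "\<dots> = (1 - \<theta>) * (2 / \<epsilon>) / (\<theta> * s)" unfolding th(3) using th by simp
    finally have 2: "2 * \<nu> / (\<epsilon> * ((\<epsilon> * M) * cosh (\<epsilon>\<^sub>1 * M))) \<le> (1 - \<theta>) * (2 / \<epsilon>) / (\<theta> * s)" .
    have "2 * \<nu> / (\<epsilon> * ((\<epsilon> * M) * cosh (\<epsilon>\<^sub>1 * M))) = k0 * \<rho>^3 / (8 * M * cosh (\<epsilon>\<^sub>1 * M))"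
    proof -
      have nu: "\<nu> = \<epsilon> * \<epsilon> * k0 * \<rho>^3 / 16" using el by (simp add: power2_eq_square)
      show ?thesis unfolding nu using e M_pos by (simp add: field_simps)
    qed
    then show ?thesis using 2 by simp
  qed
  ultimately show ?thesis unfolding X_def B_def \<epsilon>\<^sub>1_def by (meson ennreal_leI order_trans)
qed

text \<open>
  Lower bounds spread: \<open>w x\<close> dominates the mass of \<open>w\<close> near \<open>x\<close>, and each application of this to all
  points near \<open>x\<close> enlarges the radius by \<open>\<rho> / 4\<close>.
\<close>
lemma weight_sup_spread:
  assumes \<theta>: "1 / 2 \<le> \<theta>"
  shows "ennreal (k0 / 2 * (k0 * \<rho> / 16) ^ n) * (\<integral>\<^sup>+y. indicator {x - (\<rho>/2 + real n * (\<rho>/4))..x + (\<rho>/2 + real n * (\<rho>/4))} y * weight_sup \<theta> y \<partial>lborel)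
       \<le> weight_sup \<theta> x"
proof -
  have base: "ennreal (k0 / 2) * (\<integral>\<^sup>+y. indicator {x - \<rho>/2..x + \<rho>/2} y * weight_sup \<theta> y \<partial>lborel) \<le> weight_sup \<theta> x" for x
  proof -
    have "ennreal (k0 / 2) * (\<integral>\<^sup>+y. indicator {x - \<rho>/2..x + \<rho>/2} y * weight_sup \<theta> y \<partial>lborel)
        = ennreal (1 / 2) * (\<integral>\<^sup>+y. ennreal k0 * (indicator {x - \<rho>/2..x + \<rho>/2} y * weight_sup \<theta> y) \<partial>lborel)"
    proof -
      have "ennreal (k0 / 2) = ennreal (1/2) * ennreal k0"
        using kappa0_pos by (subst ennreal_mult[symmetric]) auto
      then show ?thesis by (simp only: mult.assoc) (subst nn_integral_cmult, auto)
    qed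
    also have "\<dots> \<le> ennreal \<theta> * Knn (weight_sup \<theta>) x"
    proof (rule mult_mono)
      show "ennreal (1 / 2) \<le> ennreal \<theta>" using \<theta> by (intro ennreal_leI) simp
      show "(\<integral>\<^sup>+y. ennreal k0 * (indicator {x - \<rho>/2..x + \<rho>/2} y * weight_sup \<theta> y) \<partial>lborel) \<le> Knn (weight_sup \<theta>) x"
      proof (rule nn_integral_mono)
        fix y
        show "ennreal k0 * (indicator {x - \<rho>/2..x + \<rho>/2} y * weight_sup \<theta> y) \<le> k x y * weight_sup \<theta> y"
        proof (cases "y \<in> {x - \<rho>/2..x + \<rho>/2}")
          case True
          then have "\<bar>x - y\<bar> < \<rho>" unfolding atLeastAtMost_iff using rho_pos by linarith
          then show ?thesis using True k_ge[of x y] by (auto intro!: mult_right_mono ennreal_leI)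
        qed auto
      qed
    qed auto
    also have "\<dots> \<le> ennreal (1 - \<theta>) + ennreal \<theta> * Knn (weight_sup \<theta>) x" by simp
    also have "\<dots> \<le> weight_sup \<theta> x" by (rule weight_sup_supersolution)
    finally show ?thesis .
  qed
  show ?thesis
  proof (induction n arbitrary: x)
    case 0
    show ?case using base[of x] by simp
  next
    case (Suc n)
    define a where "a = k0 / 2 * (k0 * \<rho> / 16) ^ n"
    have a: "0 \<le> a" using kappa0_pos rho_pos by (simp add: a_def)
    define r where "r = \<rho>/2 + real n * (\<rho>/4)"
    have r: "\<rho>/2 \<le> r" using rho_pos by (simp add: r_def)
    have rS: "\<rho>/2 + real (Suc n) * (\<rho>/4) = r + \<rho>/4" by (simp add: r_def field_simps)
    \<comment> \<open>one side at a time: every \<open>z\<close> in the interval \<open>Z\<close> on that side sees all of \<open>S\<close>\<close>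
    have half: "ennreal (k0 * \<rho> / 8 * a) * (\<integral>\<^sup>+y. indicator S y * weight_sup \<theta> y \<partial>lborel) \<le> weight_sup \<theta> x"
      if Z: "Z = {b..b+\<rho>/4}" "Z \<subseteq> {x - \<rho>/2..x + \<rho>/2}" and S: "S \<in> sets borel" "\<And>z. z \<in> Z \<Longrightarrow> S \<subseteq> {z - r..z + r}" for Z S b
    proof -
      note S(1)[measurable]
      define X where "X = (\<integral>\<^sup>+y. indicator S y * weight_sup \<theta> y \<partial>lborel)"
      have X: "ennreal a * X \<le> weight_sup \<theta> z" if "z \<in> Z" for z
      proof -
        have "X \<le> (\<integral>\<^sup>+y. indicator {z - r..z + r} y * weight_sup \<theta> y \<partial>lborel)"
          unfolding X_def using S(2)[OF that] by (intro nn_integral_mono mult_right_mono) (auto simp: indicator_def)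
        then have "ennreal a * X \<le> ennreal a * (\<integral>\<^sup>+y. indicator {z - r..z + r} y * weight_sup \<theta> y \<partial>lborel)"
          by (intro mult_left_mono) auto
        also have "\<dots> \<le> weight_sup \<theta> z" unfolding a_def r_def by (rule Suc)
        finally show ?thesis .
      qed
      have "ennreal (k0 * \<rho> / 8 * a) = ennreal (k0 / 2) * (ennreal a * ennreal (\<rho> / 4))"
        using kappa0_pos rho_pos a by (simp add: ennreal_mult[symmetric])
      then have "ennreal (k0 * \<rho> / 8 * a) * X = ennreal (k0 / 2) * (ennreal a * X * emeasure lborel Z)"
        using rho_pos by (simp add: Z(1) mult_ac)
      also have "\<dots> = ennreal (k0 / 2) * (\<integral>\<^sup>+z. ennreal a * X * indicator Z z \<partial>lborel)"
        by (simp add: nn_integral_cmult_indicator Z(1))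
      also have "\<dots> \<le> ennreal (k0 / 2) * (\<integral>\<^sup>+z. indicator {x - \<rho>/2..x + \<rho>/2} z * weight_sup \<theta> z \<partial>lborel)"
        using X Z(2) by (intro mult_left_mono nn_integral_mono) (auto simp: indicator_def)
      also have "\<dots> \<le> weight_sup \<theta> x" using base[of x] by simp
      finally show ?thesis unfolding X_def .
    qed
    define X where "X = (\<integral>\<^sup>+y. indicator {x - (r + \<rho>/4)..x + (r + \<rho>/4)} y * weight_sup \<theta> y \<partial>lborel)"
    have "X \<le> (\<integral>\<^sup>+y. indicator {x - (r + \<rho>/4)..x} y * weight_sup \<theta> y + indicator {x..x + (r + \<rho>/4)} y * weight_sup \<theta> y \<partial>lborel)"
      unfolding X_def by (intro nn_integral_mono) (auto simp: indicator_def)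
    also have "\<dots> = (\<integral>\<^sup>+y. indicator {x - (r + \<rho>/4)..x} y * weight_sup \<theta> y \<partial>lborel) + (\<integral>\<^sup>+y. indicator {x..x + (r + \<rho>/4)} y * weight_sup \<theta> y \<partial>lborel)"
      by (intro nn_integral_add) auto
    finally have "ennreal (k0 * \<rho> / 8 * a) * X \<le> ennreal (k0 * \<rho> / 8 * a) * \<dots>"
      by (intro mult_left_mono) auto
    also have "\<dots> \<le> weight_sup \<theta> x + weight_sup \<theta> x"
      unfolding distrib_left
    proof (intro add_mono)
      show "ennreal (k0 * \<rho> / 8 * a) * (\<integral>\<^sup>+y. indicator {x - (r + \<rho>/4)..x} y * weight_sup \<theta> y \<partial>lborel) \<le> weight_sup \<theta> x"
      proof (rule half[OF refl, of "x - \<rho>/2"])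
        show "{x - (r + \<rho>/4)..x} \<subseteq> {z - r..z + r}" if "z \<in> {x - \<rho>/2..x - \<rho>/2 + \<rho>/4}" for z
          using that r unfolding atLeastAtMost_iff atLeastatMost_subset_iff by linarith
      qed (use rho_pos in auto)
      show "ennreal (k0 * \<rho> / 8 * a) * (\<integral>\<^sup>+y. indicator {x..x + (r + \<rho>/4)} y * weight_sup \<theta> y \<partial>lborel) \<le> weight_sup \<theta> x"
      proof (rule half[OF refl, of "x + \<rho>/4"])
        show "{x..x + (r + \<rho>/4)} \<subseteq> {z - r..z + r}" if "z \<in> {x + \<rho>/4..x + \<rho>/4 + \<rho>/4}" for z
          using that r unfolding atLeastAtMost_iff atLeastatMost_subset_iff by linarith
      qed (use rho_pos in auto)
    qed
    finally have "ennreal (1/2) * (ennreal (k0 * \<rho> / 8 * a) * X) \<le> ennreal (1/2) * (weight_sup \<theta> x + weight_sup \<theta> x)"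
      by (intro mult_left_mono) auto
    also have "\<dots> = weight_sup \<theta> x"
    proof -
      have "ennreal (1/2) + ennreal (1/2) = 1"
        by (subst ennreal_plus[symmetric]) auto
      then show ?thesis by (metis distrib_left distrib_right mult_1)
    qed
    also have "ennreal (1/2) * (ennreal (k0 * \<rho> / 8 * a) * X) = ennreal (k0 / 2 * (k0 * \<rho> / 16) ^ Suc n) * X"
      using kappa0_pos rho_pos a unfolding mult.assoc[symmetric]
      by (subst ennreal_mult[symmetric]) (auto simp: a_def mult_ac)
    finally show ?case unfolding X_def rS .
  qed
qed

text \<open>
  An almost stationary weight: up to the factor \<open>1 + \<nu>\<close> it is a supersolution of \<open>K w = w\<close>, and its
  bounds depend neither on \<open>\<nu>\<close> nor on the particular kernel.
\<close>
lemma exists_weight: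
  assumes l: "0 < \<nu>" "\<nu> \<le> 1"
  shows "\<exists>w. w \<in> borel_measurable borel \<and> (\<forall>x. weight_lower k0 M \<rho> \<le> w x) \<and> (\<forall>x. w x \<le> weight_upper k0 k1 M \<rho>)
           \<and> (\<forall>x. (\<integral>\<^sup>+y. k x y * w y \<partial>lborel) \<le> ennreal ((1 + \<nu>) * w x))"
proof -
  define \<theta> where "\<theta> = 1 / (1 + \<nu>)"
  have th: "1 / 2 \<le> \<theta>" "\<theta> \<le> 1" "\<theta> * (1 + \<nu>) = 1" using l by (auto simp: \<theta>_def field_simps)
  define w where "w = (\<lambda>x. enn2real (weight_sup \<theta> x))"
  have up: "weight_sup \<theta> x \<le> ennreal (weight_upper k0 k1 M \<rho>)" for x by (rule weight_sup_upper[OF l \<theta>_def])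
  have U: "0 \<le> weight_upper k0 k1 M \<rho>"
    using kappa0_pos kappa1_pos by (auto simp: weight_upper_def intro!: add_nonneg_nonneg)
  have w: "ennreal (w x) = weight_sup \<theta> x" for x
    unfolding w_def using up[of x] by (intro ennreal_enn2real) (auto simp: top_unique less_top[symmetric])
  have [measurable]: "w \<in> borel_measurable borel" unfolding w_def by measurable
  have "weight_lower k0 M \<rho> \<le> w x" for x
  proof -
    define n where "n = nat \<lceil>4 * M / \<rho>\<rceil>"
    define m1 where "m1 = k0 * \<rho>^3 / (8 * M * cosh (sqrt (16 / (k0 * \<rho>^3)) * M))"
    have "4 * M / \<rho> \<le> real n" unfolding n_def by (rule real_nat_ceiling_ge)
    then have n: "M \<le> \<rho>/2 + real n * (\<rho>/4)" using rho_pos by (simp add: field_simps)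
    have "ennreal (weight_lower k0 M \<rho>) = ennreal (k0 / 2 * (k0 * \<rho> / 16) ^ n) * ennreal m1"
      unfolding weight_lower_def n_def m1_def using kappa0_pos rho_pos M_pos by (intro ennreal_mult) auto
    also have "\<dots> \<le> ennreal (k0 / 2 * (k0 * \<rho> / 16) ^ n) * (\<integral>\<^sup>+y. indicator {x - M..x + M} y * weight_sup \<theta> y \<partial>lborel)"
      unfolding m1_def by (intro mult_left_mono weight_sup_local_mass[OF l \<theta>_def]) auto
    also have "\<dots> \<le> ennreal (k0 / 2 * (k0 * \<rho> / 16) ^ n) * (\<integral>\<^sup>+y. indicator {x - (\<rho>/2 + real n * (\<rho>/4))..x + (\<rho>/2 + real n * (\<rho>/4))} y * weight_sup \<theta> y \<partial>lborel)"
      using n by (intro mult_left_mono nn_integral_mono mult_right_mono) (auto simp: indicator_def)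
    also have "\<dots> \<le> weight_sup \<theta> x" by (rule weight_sup_spread[OF th(1)])
    finally show ?thesis unfolding w[symmetric] by (simp add: w_def ennreal_le_iff)
  qed
  moreover have "w x \<le> weight_upper k0 k1 M \<rho>" for x
    using up[of x] U unfolding w[symmetric] by (simp add: ennreal_le_iff)
  moreover have "(\<integral>\<^sup>+y. k x y * w y \<partial>lborel) \<le> ennreal ((1 + \<nu>) * w x)" for x
  proof -
    have "(\<integral>\<^sup>+y. k x y * w y \<partial>lborel) = Knn (weight_sup \<theta>) x"
      using k_nonneg by (simp add: ennreal_mult' w)
    also have "\<dots> = ennreal (1 + \<nu>) * (ennreal \<theta> * \<dots>)"
    proof -
      have "ennreal (1 + \<nu>) * ennreal \<theta> = 1"
        using th l by (subst ennreal_mult[symmetric]) (auto simp: mult.commute)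
      then show ?thesis by (simp only: mult.assoc[symmetric] mult_1)
    qed
    also have "\<dots> \<le> ennreal (1 + \<nu>) * weight_sup \<theta> x"
      using weight_sup_supersolution[of \<theta> x] by (intro mult_left_mono) (auto elim: order_trans[rotated])
    also have "\<dots> = ennreal ((1 + \<nu>) * w x)" using l by (simp add: ennreal_mult' w)
    finally show ?thesis .
  qed
  ultimately show ?thesis by (intro exI[of _ w]) auto
qed


end

section \<open>Dissipation of the weighted energy\<close>

text \<open>
  The energy \<open>\<Phi> f = \<integral> w\<^sup>1\<^sup>-\<^sup>p \<bar>f\<bar>\<^sup>p\<close> as an extended nonnegative real.
\<close>
abbreviation weighted_energy :: "real \<Rightarrow> (real \<Rightarrow> real) \<Rightarrow> (real \<Rightarrow> real) \<Rightarrow> ennreal" where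
  "weighted_energy p w f \<equiv> (\<integral>\<^sup>+x. w x powr (1 - p) * \<bar>f x\<bar> powr p \<partial>lborel)"

context jump_kernel
begin

text \<open>
  The integral operator with kernel \<open>k\<close>; by the convention for the Bochner integral, it is \<open>0\<close> at points
  where the integrand is not integrable.
\<close>
definition Kop :: "(real \<Rightarrow> real) \<Rightarrow> real \<Rightarrow> real" where
  "Kop u x = (LINT y|lborel. k x y * u y)"

lemma Kop_measurable [measurable]:
  assumes [measurable]: "u \<in> borel_measurable borel"
  shows "Kop u \<in> borel_measurable borel"
  unfolding Kop_def[abs_def] by measurable

lemma integrable_k_mult:
  assumes "integrable lborel u"
  shows "integrable lborel (\<lambda>y. k x y * u y)"
proof (rule Bochner_Integration.integrable_bound)
  show "integrable lborel (\<lambda>y. k1 * u y)" using assms by simp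
  have [measurable]: "u \<in> borel_measurable borel" using assms by auto
  show "(\<lambda>y. k x y * u y) \<in> borel_measurable lborel" by measurable
  show "AE y in lborel. norm (k x y * u y) \<le> norm (k1 * u y)"
    using k_nonneg k_le kappa1_pos by (intro AE_I2) (simp add: abs_mult mult_right_mono)
qed

lemma nn_integral_nn_integral_k:
  fixes f :: "real \<Rightarrow> ennreal"
  assumes [measurable]: "f \<in> borel_measurable borel"
  shows "(\<integral>\<^sup>+x. Knn f x \<partial>lborel) = (\<integral>\<^sup>+y. f y \<partial>lborel)"
  using nn_integral_k_swap[OF assms, of "\<lambda>_. 1"] by (simp add: k_mass)

lemma Kop_L1:
  assumes u: "integrable lborel u"
  shows "integrable lborel (\<lambda>x. \<bar>Kop u x\<bar>)" "(LINT x|lborel. \<bar>Kop u x\<bar>) \<le> (LINT x|lborel. \<bar>u x\<bar>)"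
proof -
  have [measurable]: "u \<in> borel_measurable borel" using u by auto
  have "(\<integral>\<^sup>+x. \<bar>Kop u x\<bar> \<partial>lborel) \<le> (\<integral>\<^sup>+x. (\<integral>\<^sup>+y. k x y * ennreal \<bar>u y\<bar> \<partial>lborel) \<partial>lborel)"
  proof (intro nn_integral_mono)
    fix x
    have "\<bar>Kop u x\<bar> \<le> (LINT y|lborel. \<bar>k x y * u y\<bar>)" unfolding Kop_def by (rule integral_abs_bound)
    then have "ennreal \<bar>Kop u x\<bar> \<le> ennreal (LINT y|lborel. \<bar>k x y * u y\<bar>)" by (rule ennreal_leI)
    also have "\<dots> = (\<integral>\<^sup>+y. \<bar>k x y * u y\<bar> \<partial>lborel)"
      using integrable_k_mult[OF u, of x] by (intro nn_integral_eq_integral[symmetric]) auto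
    also have "\<dots> = (\<integral>\<^sup>+y. k x y * ennreal \<bar>u y\<bar> \<partial>lborel)"
      using k_nonneg by (simp add: abs_mult ennreal_mult)
    finally show "ennreal \<bar>Kop u x\<bar> \<le> \<dots>" .
  qed
  also have "\<dots> = (\<integral>\<^sup>+y. ennreal \<bar>u y\<bar> \<partial>lborel)" by (rule nn_integral_nn_integral_k) measurable
  also have "\<dots> = ennreal (LINT x|lborel. \<bar>u x\<bar>)" using u by (intro nn_integral_eq_integral) auto
  finally have le: "(\<integral>\<^sup>+x. \<bar>Kop u x\<bar> \<partial>lborel) \<le> ennreal (LINT x|lborel. \<bar>u x\<bar>)" .
  then show i: "integrable lborel (\<lambda>x. \<bar>Kop u x\<bar>)"
    by (intro integrableI_nonneg) (auto simp: le_less_trans)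
  have "ennreal (LINT x|lborel. \<bar>Kop u x\<bar>) = (\<integral>\<^sup>+x. \<bar>Kop u x\<bar> \<partial>lborel)"
    using i by (intro nn_integral_eq_integral[symmetric]) auto
  with le have "ennreal (LINT x|lborel. \<bar>Kop u x\<bar>) \<le> ennreal (LINT x|lborel. \<bar>u x\<bar>)" by simp
  then show "(LINT x|lborel. \<bar>Kop u x\<bar>) \<le> (LINT x|lborel. \<bar>u x\<bar>)"
    by (subst (asm) ennreal_le_iff) auto
qed

text \<open>
  Two points at distance less than \<open>\<rho>\<close> can jump to a common set of length at least \<open>\<rho>\<close>.
\<close>
lemma nn_integral_k_k_ge:
  assumes "0 \<le> h" "h < \<rho>"
  shows "ennreal (k0\<^sup>2 * \<rho>) \<le> (\<integral>\<^sup>+x. k x y * k x (y + h) \<partial>lborel)"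
proof -
  have "ennreal (k0\<^sup>2 * \<rho>) = ennreal (k0\<^sup>2) * ennreal \<rho>" using rho_pos by (intro ennreal_mult) auto
  also have "\<dots> \<le> ennreal (k0\<^sup>2) * emeasure lborel {y + h - \<rho><..<y + \<rho>}"
    using assms by (intro mult_left_mono) (auto intro!: ennreal_leI)
  also have "\<dots> = (\<integral>\<^sup>+x. ennreal (k0\<^sup>2) * indicator {y + h - \<rho><..<y + \<rho>} x \<partial>lborel)"
    by (simp add: nn_integral_cmult_indicator)
  also have "\<dots> \<le> (\<integral>\<^sup>+x. k x y * k x (y + h) \<partial>lborel)"
  proof (intro nn_integral_mono)
    fix x
    show "ennreal (k0\<^sup>2) * indicator {y + h - \<rho><..<y + \<rho>} x \<le> k x y * k x (y + h)"
    proof (cases "x \<in> {y + h - \<rho><..<y + \<rho>}")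
      case True
      then have "\<bar>x - y\<bar> < \<rho>" "\<bar>x - (y + h)\<bar> < \<rho>" using assms unfolding greaterThanLessThan_iff by linarith+
      then have "k0 * k0 \<le> k x y * k x (y + h)"
        using k_ge kappa0_pos k_nonneg by (intro mult_mono) auto
      then show ?thesis using True by (simp add: power2_eq_square ennreal_leI)
    qed auto
  qed
  finally show ?thesis .
qed

lemma nn_integral_pair_defect_ge:
  assumes [measurable]: "v \<in> borel_measurable borel"
  shows "ennreal (k0\<^sup>2 * \<rho>) * total_defect \<rho> v
     \<le> (\<integral>\<^sup>+x. pair_defect (k x) v \<partial>lborel)"
proof -
  have "total_defect \<rho> v
      = (\<integral>\<^sup>+h. (\<integral>\<^sup>+y. indicator {0..<\<rho>} h * ennreal ((v (y + h) - v y)\<^sup>2) \<partial>lborel) \<partial>lborel)"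
    unfolding shift_defect_def by (simp add: nn_integral_cmult)
  also have "\<dots> = (\<integral>\<^sup>+y. (\<integral>\<^sup>+h. indicator {0..<\<rho>} h * ennreal ((v (y + h) - v y)\<^sup>2) \<partial>lborel) \<partial>lborel)"
    by (rule lborel_pair.Fubini') measurable
  finally have "ennreal (k0\<^sup>2 * \<rho>) * total_defect \<rho> v
    = (\<integral>\<^sup>+y. (\<integral>\<^sup>+h. ennreal (k0\<^sup>2 * \<rho>) * (indicator {0..<\<rho>} h * ennreal ((v (y + h) - v y)\<^sup>2)) \<partial>lborel) \<partial>lborel)"
    by (simp add: nn_integral_cmult)
  also have "\<dots> \<le> (\<integral>\<^sup>+y. (\<integral>\<^sup>+h. (\<integral>\<^sup>+x. k x y * k x (y + h) \<partial>lborel) * ennreal ((v (y + h) - v y)\<^sup>2) \<partial>lborel) \<partial>lborel)"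
    using nn_integral_k_k_ge by (intro nn_integral_mono) (auto simp: indicator_def intro!: mult_right_mono)
  also have "\<dots> = (\<integral>\<^sup>+y. (\<integral>\<^sup>+h. (\<integral>\<^sup>+x. k x y * k x (y + h) * (v (y + h) - v y)\<^sup>2 \<partial>lborel) \<partial>lborel) \<partial>lborel)"
    using k_nonneg by (intro nn_integral_cong) (simp add: ennreal_mult nn_integral_multc)
  also have "\<dots> = (\<integral>\<^sup>+y. (\<integral>\<^sup>+z. (\<integral>\<^sup>+x. k x y * k x z * (v z - v y)\<^sup>2 \<partial>lborel) \<partial>lborel) \<partial>lborel)"
  proof (rule nn_integral_cong)
    fix y
    show "(\<integral>\<^sup>+h. (\<integral>\<^sup>+x. k x y * k x (y + h) * (v (y + h) - v y)\<^sup>2 \<partial>lborel) \<partial>lborel) = (\<integral>\<^sup>+z. (\<integral>\<^sup>+x. k x y * k x z * (v z - v y)\<^sup>2 \<partial>lborel) \<partial>lborel)"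
      by (rule nn_integral_shift[symmetric, where f = "\<lambda>z. (\<integral>\<^sup>+x. k x y * k x z * (v z - v y)\<^sup>2 \<partial>lborel)"]) measurable
  qed
  also have "\<dots> = (\<integral>\<^sup>+y. (\<integral>\<^sup>+x. (\<integral>\<^sup>+z. k x y * k x z * (v z - v y)\<^sup>2 \<partial>lborel) \<partial>lborel) \<partial>lborel)"
    by (intro nn_integral_cong lborel_pair.Fubini') measurable
  also have "\<dots> = (\<integral>\<^sup>+x. pair_defect (k x) v \<partial>lborel)"
    by (rule lborel_pair.Fubini') measurable
  finally show ?thesis .
qed

text \<open>
  Energy dissipation in one step of the jump process: Jensen's inequality with remainder for the
  measures \<open>k x y w y dy\<close>, whose mass is at most \<open>(1 + \<nu>) w x\<close>, integrated over \<open>x\<close>.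
\<close>
lemma weighted_energy_defect:
  assumes p: "2 \<le> p" and \<nu>: "0 < \<nu>" "\<nu> \<le> 1"
    and [measurable]: "w \<in> borel_measurable borel"
    and c1: "0 < c1" "\<And>x. c1 \<le> w x" and c2: "\<And>x. w x \<le> c2"
    and sup: "\<And>x. (\<integral>\<^sup>+y. k x y * w y \<partial>lborel) \<le> ennreal ((1 + \<nu>) * w x)"
    and u: "integrable lborel u" "integrable lborel (\<lambda>x. \<bar>u x\<bar> powr p)"
  defines "v \<equiv> \<lambda>y. \<bar>u y / w y\<bar> powr (p/2)"
  shows "ennreal ((1 + \<nu>) powr (1 - p)) * weighted_energy p w (Kop u)
      + ennreal (c1\<^sup>2 * (k0\<^sup>2 * \<rho>) / (8 * c2)) * total_defect \<rho> v
      \<le> weighted_energy p w u"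
proof -
  have [measurable]: "u \<in> borel_measurable borel" using u by auto
  have [measurable]: "v \<in> borel_measurable borel" unfolding v_def by measurable
  have w: "0 < w x" for x using c1(2)[of x] c1(1) by linarith
  have c2': "0 < c2" using w[of 0] c2[of 0] by linarith
  define f where "f = (\<lambda>y. w y powr (1 - p) * \<bar>u y\<bar> powr p)"
  have [measurable]: "f \<in> borel_measurable borel" unfolding f_def by measurable
  have f0: "0 \<le> f y" for y by (simp add: f_def)
  have f: "w y * \<bar>u y / w y\<bar> powr p = f y" for y
    using w[of y] by (simp add: f_def abs_divide powr_divide powr_diff)
  have fi: "integrable lborel f"
  proof (rule Bochner_Integration.integrable_bound)
    show "integrable lborel (\<lambda>y. c1 powr (1 - p) * \<bar>u y\<bar> powr p)" using u by simp
    have "f y \<le> c1 powr (1 - p) * \<bar>u y\<bar> powr p" for y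
      unfolding f_def using c1 p by (intro mult_right_mono powr_mono2') auto
    then show "AE y in lborel. norm (f y) \<le> norm (c1 powr (1 - p) * \<bar>u y\<bar> powr p)"
      using f0 by (intro AE_I2) simp
  qed measurable
  define P where "P = (\<lambda>x. pair_defect (k x) v)"
  have [measurable]: "P \<in> borel_measurable borel" unfolding P_def by measurable
  have ptw: "ennreal ((1 + \<nu>) powr (1 - p)) * ennreal (w x powr (1 - p) * \<bar>Kop u x\<bar> powr p) + ennreal (c1\<^sup>2 / (8 * c2)) * P x
     \<le> (\<integral>\<^sup>+y. k x y * ennreal (f y) \<partial>lborel)" for x
  proof -
    define \<theta> where "\<theta> = (\<lambda>y. k x y * w y)"
    have [measurable]: "\<theta> \<in> borel_measurable borel" unfolding \<theta>_def by measurable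
    have th: "0 \<le> \<theta> y" for y using k_nonneg w by (simp add: \<theta>_def less_imp_le)
    define m where "m = (LINT y|lborel. \<theta> y)"
    have nn: "(\<integral>\<^sup>+y. \<theta> y \<partial>lborel) \<le> ennreal ((1 + \<nu>) * w x)"
      using sup[of x] k_nonneg w by (simp add: \<theta>_def ennreal_mult less_imp_le)
    have ith: "integrable lborel \<theta>"
      using th by (intro integrableI_nonneg) (auto intro: le_less_trans[OF nn])
    have m_nn: "ennreal m = (\<integral>\<^sup>+y. \<theta> y \<partial>lborel)"
      unfolding m_def using ith th by (intro nn_integral_eq_integral[symmetric]) auto
    have m_le: "m \<le> (1 + \<nu>) * w x"
      using nn w[of x] \<nu> unfolding m_nn[symmetric] by (simp add: ennreal_le_iff)
    have "ennreal (k0 * c1 * \<rho>) = ennreal (k0 * c1) * emeasure lborel {x<..<x + \<rho>}"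
      using rho_pos kappa0_pos c1 by (simp add: ennreal_mult)
    also have "\<dots> = (\<integral>\<^sup>+y. ennreal (k0 * c1) * indicator {x<..<x + \<rho>} y \<partial>lborel)"
      by (simp add: nn_integral_cmult_indicator)
    also have "\<dots> \<le> (\<integral>\<^sup>+y. \<theta> y \<partial>lborel)"
    proof (intro nn_integral_mono)
      fix y
      show "ennreal (k0 * c1) * indicator {x<..<x + \<rho>} y \<le> \<theta> y"
      proof (cases "y \<in> {x<..<x + \<rho>}")
        case True
        then have "k0 * c1 \<le> \<theta> y"
          unfolding \<theta>_def using c1 kappa0_pos k_nonneg k_ge[of x y] by (intro mult_mono) auto
        then show ?thesis using True by (simp add: ennreal_leI)
      qed auto
    qed
    finally have "k0 * c1 * \<rho> \<le> m \<or> k0 * c1 * \<rho> \<le> 0"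
      unfolding m_nn[symmetric] by (auto simp: ennreal_le_iff2)
    then have m: "0 < m" using kappa0_pos c1 rho_pos
      by (metis mult_pos_pos less_le_trans not_less)
    have eqs: "\<theta> y * (u y / w y) = k x y * u y" "\<theta> y * \<bar>u y / w y\<bar> powr p = k x y * f y" for y
    proof -
      show "\<theta> y * (u y / w y) = k x y * u y" using w[of y] by (simp add: \<theta>_def)
      show "\<theta> y * \<bar>u y / w y\<bar> powr p = k x y * f y" by (simp only: \<theta>_def mult.assoc f)
    qed
    have J: "ennreal (m powr (1 - p) * \<bar>LINT y|lborel. \<theta> y * (u y / w y)\<bar> powr p)
      + ennreal (1 / (4 * m)) * pair_defect \<theta> v
      \<le> (\<integral>\<^sup>+y. \<theta> y * \<bar>u y / w y\<bar> powr p \<partial>lborel)"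
      unfolding v_def
    proof (rule jensen_defect[OF p th _ _ ith _ _ m_def m])
      show "integrable lborel (\<lambda>y. \<theta> y * (u y / w y))" unfolding eqs by (rule integrable_k_mult[OF u(1)])
      show "integrable lborel (\<lambda>y. \<theta> y * \<bar>u y / w y\<bar> powr p)" unfolding eqs by (rule integrable_k_mult[OF fi])
    qed measurable
    have "(1 + \<nu>) powr (1 - p) * (w x powr (1 - p) * \<bar>Kop u x\<bar> powr p) = ((1 + \<nu>) * w x) powr (1 - p) * \<bar>Kop u x\<bar> powr p"
      using \<nu> w[of x] by (simp add: powr_mult)
    also have "\<dots> \<le> m powr (1 - p) * \<bar>Kop u x\<bar> powr p"
      using m m_le p by (intro mult_right_mono powr_mono2') auto
    finally have 1: "(1 + \<nu>) powr (1 - p) * (w x powr (1 - p) * \<bar>Kop u x\<bar> powr p) \<le> m powr (1 - p) * \<bar>Kop u x\<bar> powr p" .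
    have 2: "ennreal (c1\<^sup>2 / (8 * c2)) * P x \<le> ennreal (1 / (4 * m)) * pair_defect \<theta> v"
    proof -
      have "m \<le> 2 * c2"
      proof -
        have "(1 + \<nu>) * w x \<le> 2 * c2" using \<nu> w[of x] c2[of x] by (intro mult_mono) auto
        then show ?thesis using m_le by linarith
      qed
      then have "1 / (8 * c2) \<le> 1 / (4 * m)" using m by (intro divide_left_mono) auto
      moreover have "ennreal (c1\<^sup>2) * P x \<le> pair_defect \<theta> v"
      proof -
        have "ennreal (c1\<^sup>2) * P x = (\<integral>\<^sup>+y. (\<integral>\<^sup>+z. ennreal (c1\<^sup>2) * (k x y * k x z * (v z - v y)\<^sup>2) \<partial>lborel) \<partial>lborel)"
          unfolding P_def by (simp add: nn_integral_cmult)
        also have "\<dots> \<le> pair_defect \<theta> v"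
        proof (intro nn_integral_mono)
          fix y z
          have "c1 * c1 \<le> w y * w z" using c1 w by (intro mult_mono) (auto simp: less_imp_le)
          then have "c1\<^sup>2 * (k x y * k x z * (v z - v y)\<^sup>2) \<le> w y * w z * (k x y * k x z * (v z - v y)\<^sup>2)"
            using k_nonneg by (intro mult_right_mono) (auto simp: power2_eq_square)
          also have "\<dots> = \<theta> y * \<theta> z * (v z - v y)\<^sup>2" by (simp add: \<theta>_def mult_ac)
          finally show "ennreal (c1\<^sup>2) * ennreal (k x y * k x z * (v z - v y)\<^sup>2) \<le> ennreal (\<theta> y * \<theta> z * (v z - v y)\<^sup>2)"
            using k_nonneg by (subst ennreal_mult[symmetric]) (auto intro!: ennreal_leI)
        qed
        finally show ?thesis .
      qed
      ultimately have "ennreal (1 / (8 * c2)) * (ennreal (c1\<^sup>2) * P x) \<le> ennreal (1 / (4 * m)) * pair_defect \<theta> v"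
        by (intro mult_mono ennreal_leI) auto
      moreover have "ennreal (c1\<^sup>2 / (8 * c2)) = ennreal (1 / (8 * c2)) * ennreal (c1\<^sup>2)"
        using c2' by (subst ennreal_mult[symmetric]) auto
      ultimately show ?thesis by (simp add: mult.assoc)
    qed
    have "ennreal ((1 + \<nu>) powr (1 - p)) * ennreal (w x powr (1 - p) * \<bar>Kop u x\<bar> powr p) + ennreal (c1\<^sup>2 / (8 * c2)) * P x
       \<le> ennreal (m powr (1 - p) * \<bar>Kop u x\<bar> powr p) + ennreal (1 / (4 * m)) * pair_defect \<theta> v"
      using 1 by (intro add_mono 2) (auto simp: ennreal_mult[symmetric] intro!: ennreal_leI)
    also have "\<dots> \<le> (\<integral>\<^sup>+y. k x y * f y \<partial>lborel)" using J unfolding eqs Kop_def .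
    finally show ?thesis using k_nonneg by (simp add: ennreal_mult f0)
  qed
  define D where "D = total_defect \<rho> v"
  have "ennreal (c1\<^sup>2 * (k0\<^sup>2 * \<rho>) / (8 * c2)) * D = ennreal (c1\<^sup>2 / (8 * c2)) * (ennreal (k0\<^sup>2 * \<rho>) * D)"
    using c2' rho_pos unfolding mult.assoc[symmetric, of _ _ D] by (subst ennreal_mult[symmetric]) auto
  also have "\<dots> \<le> ennreal (c1\<^sup>2 / (8 * c2)) * (\<integral>\<^sup>+x. P x \<partial>lborel)"
    unfolding D_def P_def by (intro mult_left_mono nn_integral_pair_defect_ge) auto
  finally have "ennreal ((1 + \<nu>) powr (1 - p)) * weighted_energy p w (Kop u)
      + ennreal (c1\<^sup>2 * (k0\<^sup>2 * \<rho>) / (8 * c2)) * D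
    \<le> ennreal ((1 + \<nu>) powr (1 - p)) * weighted_energy p w (Kop u) + ennreal (c1\<^sup>2 / (8 * c2)) * (\<integral>\<^sup>+x. P x \<partial>lborel)"
    by (intro add_left_mono)
  also have "\<dots> = (\<integral>\<^sup>+x. ennreal ((1 + \<nu>) powr (1 - p)) * ennreal (w x powr (1 - p) * \<bar>Kop u x\<bar> powr p) + ennreal (c1\<^sup>2 / (8 * c2)) * P x \<partial>lborel)"
    by (simp add: nn_integral_add nn_integral_cmult)
  also have "\<dots> \<le> (\<integral>\<^sup>+x. (\<integral>\<^sup>+y. k x y * ennreal (f y) \<partial>lborel) \<partial>lborel)"
    by (intro nn_integral_mono ptw)
  also have "\<dots> = (\<integral>\<^sup>+y. f y \<partial>lborel)" by (rule nn_integral_nn_integral_k) measurable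
  finally show ?thesis unfolding D_def f_def .
qed

lemma Kop_Lp:
  assumes p: "2 \<le> p" and \<nu>: "0 < \<nu>" "\<nu> \<le> 1"
    and [measurable]: "w \<in> borel_measurable borel"
    and c1: "0 < c1" "\<And>x. c1 \<le> w x" and c2: "\<And>x. w x \<le> c2"
    and sup: "\<And>x. (\<integral>\<^sup>+y. k x y * w y \<partial>lborel) \<le> ennreal ((1 + \<nu>) * w x)"
    and u: "integrable lborel u" "integrable lborel (\<lambda>x. \<bar>u x\<bar> powr p)"
  shows "integrable lborel (\<lambda>x. \<bar>Kop u x\<bar> powr p)"
proof (rule integrableI_nonneg)
  have [measurable]: "u \<in> borel_measurable borel" using u by auto
  show "(\<lambda>x. \<bar>Kop u x\<bar> powr p) \<in> borel_measurable lborel" by measurable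
  have w: "0 < w x" for x using c1(2)[of x] c1(1) by linarith
  have c2': "0 < c2" using w[of 0] c2[of 0] by linarith
  define G where "G = weighted_energy p w (Kop u)"
  have fi: "weighted_energy p w u < \<infinity>"
  proof -
    have "weighted_energy p w u \<le> (\<integral>\<^sup>+x. c1 powr (1 - p) * \<bar>u x\<bar> powr p \<partial>lborel)"
      using c1 p by (intro nn_integral_mono ennreal_leI mult_right_mono powr_mono2') auto
    also have "\<dots> = ennreal (LINT x|lborel. c1 powr (1 - p) * \<bar>u x\<bar> powr p)"
      using u by (intro nn_integral_eq_integral) auto
    finally show ?thesis by (simp add: le_less_trans)
  qed
  have "ennreal ((1 + \<nu>) powr (1 - p)) * G < \<infinity>"
    using weighted_energy_defect[OF p \<nu> assms(4) c1 c2 sup u] fi unfolding G_def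
    by (meson add_increasing2 le_less_trans order_trans zero_le order_refl le_add_same_cancel1)
  then have G: "G < \<infinity>" using \<nu> by (auto simp: ennreal_mult_less_top)
  have "(\<integral>\<^sup>+x. \<bar>Kop u x\<bar> powr p \<partial>lborel) \<le> (\<integral>\<^sup>+x. ennreal (c2 powr (p - 1)) * (w x powr (1 - p) * \<bar>Kop u x\<bar> powr p) \<partial>lborel)"
  proof (intro nn_integral_mono)
    fix x
    have "1 = w x powr (p - 1) * w x powr (1 - p)" using w[of x] by (simp flip: powr_add)
    also have "\<dots> \<le> c2 powr (p - 1) * w x powr (1 - p)"
      using w[of x] c2[of x] p by (intro mult_right_mono powr_mono2) auto
    finally have "1 * \<bar>Kop u x\<bar> powr p \<le> c2 powr (p - 1) * w x powr (1 - p) * \<bar>Kop u x\<bar> powr p"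
      by (intro mult_right_mono) auto
    then show "ennreal (\<bar>Kop u x\<bar> powr p) \<le> ennreal (c2 powr (p - 1)) * ennreal (w x powr (1 - p) * \<bar>Kop u x\<bar> powr p)"
      by (subst ennreal_mult[symmetric]) (auto intro!: ennreal_leI simp: mult.assoc)
  qed
  also have "\<dots> = ennreal (c2 powr (p - 1)) * G" unfolding G_def by (rule nn_integral_cmult) measurable
  also have "\<dots> < \<infinity>" using G by (simp add: ennreal_mult_less_top)
  finally show "(\<integral>\<^sup>+x. \<bar>Kop u x\<bar> powr p \<partial>lborel) < \<infinity>" .
qed simp

text \<open>
  The dissipation as a function of the energy \<open>F\<close> alone, given the bound \<open>c1 A\<close> on the \<open>L\<^sup>1\<close> norm of \<open>u\<close>.
\<close>
lemma energy_dissipation: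
  assumes p: "2 \<le> p" and \<nu>: "0 < \<nu>" "\<nu> \<le> 1"
    and [measurable]: "w \<in> borel_measurable borel"
    and c1: "0 < c1" "\<And>x. c1 \<le> w x" and c2: "\<And>x. w x \<le> c2"
    and sup: "\<And>x. (\<integral>\<^sup>+y. k x y * w y \<partial>lborel) \<le> ennreal ((1 + \<nu>) * w x)"
    and u: "integrable lborel u" "integrable lborel (\<lambda>x. \<bar>u x\<bar> powr p)"
    and A: "0 < A" "(LINT x|lborel. \<bar>u x\<bar>) \<le> c1 * A"
  defines "F \<equiv> LINT x|lborel. w x powr (1 - p) * \<bar>u x\<bar> powr p"
    and "B \<equiv> 8 * A * (A * c2) powr (1 / (p - 1)) / \<rho>"
  assumes F: "0 < F"
  shows "(LINT x|lborel. w x powr (1 - p) * \<bar>Kop u x\<bar> powr p)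
     \<le> (1 + \<nu>) powr (p - 1) * (F - (c1 * k0 * \<rho> / c2)\<^sup>2 / 8 * F / (1 + B * F powr (- 1 / (p - 1)))\<^sup>2)"
proof -
  have [measurable]: "u \<in> borel_measurable borel" using u by auto
  have w: "0 < w x" for x using c1(2)[of x] c1(1) by linarith
  have c2': "0 < c2" using w[of 0] c2[of 0] by linarith
  define q where "q = (\<lambda>x. u x / w x)"
  have [measurable]: "q \<in> borel_measurable borel" unfolding q_def by measurable
  have wq: "w x * \<bar>q x\<bar> powr p = w x powr (1 - p) * \<bar>u x\<bar> powr p" for x
    using w[of x] by (simp add: q_def abs_divide powr_divide powr_diff)
  have qle: "\<bar>q x\<bar> \<le> \<bar>u x\<bar> / c1" for x
    using w[of x] c1 by (auto simp: q_def abs_divide intro!: divide_left_mono)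
  have iq: "integrable lborel (\<lambda>x. \<bar>q x\<bar>)"
    by (rule Bochner_Integration.integrable_bound[of _ "\<lambda>x. \<bar>u x\<bar> / c1"]) (use u qle c1 in auto)
  have iqp: "integrable lborel (\<lambda>x. \<bar>q x\<bar> powr p)"
  proof (rule Bochner_Integration.integrable_bound)
    show "integrable lborel (\<lambda>x. \<bar>u x\<bar> powr p / c1 powr p)" using u by simp
    have "\<bar>q x\<bar> powr p \<le> \<bar>u x\<bar> powr p / c1 powr p" for x
    proof -
      have "\<bar>q x\<bar> powr p \<le> (\<bar>u x\<bar> / c1) powr p" using qle p by (intro powr_mono2) auto
      then show ?thesis using c1 by (simp add: powr_divide)
    qed
    then show "AE x in lborel. norm (\<bar>q x\<bar> powr p) \<le> norm (\<bar>u x\<bar> powr p / c1 powr p)" by simp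
  qed measurable
  have iwq: "integrable lborel (\<lambda>x. w x * \<bar>q x\<bar> powr p)"
  proof (rule Bochner_Integration.integrable_bound)
    show "integrable lborel (\<lambda>x. c2 * \<bar>q x\<bar> powr p)" using iqp by simp
    show "AE x in lborel. norm (w x * \<bar>q x\<bar> powr p) \<le> norm (c2 * \<bar>q x\<bar> powr p)"
      using w c2 c2' by (auto simp: abs_mult less_imp_le intro!: mult_right_mono)
  qed measurable
  define E where "E = (LINT x|lborel. \<bar>q x\<bar> powr p)"
  have Aq: "(LINT x|lborel. \<bar>q x\<bar>) \<le> A"
  proof -
    have "(LINT x|lborel. \<bar>q x\<bar>) \<le> (LINT x|lborel. \<bar>u x\<bar> / c1)"
      using iq u qle by (intro integral_mono) auto
    also have "\<dots> \<le> A" using A c1 by (simp add: field_simps)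
    finally show ?thesis .
  qed
  have FE: "F \<le> c2 * E"
  proof -
    have "F = (LINT x|lborel. w x * \<bar>q x\<bar> powr p)" unfolding F_def wq ..
    also have "\<dots> \<le> (LINT x|lborel. c2 * \<bar>q x\<bar> powr p)"
      using iwq iqp c2 by (intro integral_mono mult_right_mono) auto
    finally show ?thesis by (simp add: E_def)
  qed
  have E: "0 < E" using F FE c2' by (smt (verit) zero_less_mult_pos)
  define v where "v = (\<lambda>y. \<bar>q y\<bar> powr (p/2))"
  have [measurable]: "v \<in> borel_measurable borel" unfolding v_def by measurable
  have v2: "(v y)\<^sup>2 = \<bar>q y\<bar> powr p" for y
    by (simp add: v_def power2_eq_square flip: powr_add)
  define D where "D = total_defect \<rho> v"
  \<comment> \<open>this level balances the two terms of the interpolation inequality\<close>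
  define \<tau> where "\<tau> = (E / A) powr (1 / (p - 1))"
  have t: "0 < \<tau>" using E A by (simp add: \<tau>_def)
  have Et: "E = A * \<tau> powr (p - 1)" using E A p by (simp add: \<tau>_def powr_powr)
  have S: "(\<integral>\<^sup>+x. v x \<partial>lborel) \<le> ennreal (2 * A * \<tau> powr (p/2 - 1))"
  proof -
    have "(\<integral>\<^sup>+x. v x \<partial>lborel) \<le> ennreal (\<tau> powr (p/2 - 1) * (LINT x|lborel. \<bar>q x\<bar>) + \<tau> powr (- (p/2)) * E)"
      unfolding v_def E_def by (rule nn_integral_powr_half_le[OF p t _ iq iqp]) measurable
    also have "\<dots> \<le> ennreal (\<tau> powr (p/2 - 1) * A + \<tau> powr (- (p/2)) * E)"
      using Aq by (intro ennreal_leI add_right_mono mult_left_mono) auto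
    also have "\<tau> powr (- (p/2)) * E = A * \<tau> powr (p/2 - 1)"
    proof -
      have "\<tau> powr (- (p/2)) * \<tau> powr (p - 1) = \<tau> powr (p/2 - 1)" by (simp flip: powr_add)
      then show ?thesis unfolding Et by (simp add: mult.left_commute)
    qed
    finally show ?thesis by (simp add: algebra_simps)
  qed
  have S2: "2 * (\<integral>\<^sup>+x. v x \<partial>lborel)\<^sup>2 \<le> ennreal (8 * A / \<tau> * E)"
  proof -
    have "(\<integral>\<^sup>+x. v x \<partial>lborel)\<^sup>2 \<le> (ennreal (2 * A * \<tau> powr (p/2 - 1)))\<^sup>2"
      using S by (intro power_mono) auto
    also have "\<dots> = ennreal ((2 * A * \<tau> powr (p/2 - 1))\<^sup>2)" using A by (intro ennreal_power) auto
    finally have "2 * (\<integral>\<^sup>+x. v x \<partial>lborel)\<^sup>2 \<le> ennreal 2 * ennreal ((2 * A * \<tau> powr (p/2 - 1))\<^sup>2)"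
      by (simp add: mult_left_mono)
    also have "\<dots> = ennreal (2 * (2 * A * \<tau> powr (p/2 - 1))\<^sup>2)" by (rule ennreal_mult[symmetric]) auto
    also have "2 * (2 * A * \<tau> powr (p/2 - 1))\<^sup>2 = 8 * A / \<tau> * E"
    proof -
      have "(\<tau> powr (p/2 - 1))\<^sup>2 = \<tau> powr (p - 2)" by (simp add: power2_eq_square flip: powr_add)
      moreover have "\<tau> powr (p - 1) = \<tau> powr (p - 2) * \<tau>" using t powr_add[of \<tau> "p - 2" 1] by simp
      ultimately show ?thesis unfolding Et using t by (simp add: power_mult_distrib power2_eq_square)
    qed
    finally show ?thesis .
  qed
  \<comment> \<open>the least \<open>n\<close> for which the bound on the \<open>L\<^sup>1\<close> term of the Nash inequality is at most half its left side\<close>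
  define n where "n = nat \<lceil>8 * A / (\<tau> * \<rho>)\<rceil>"
  have np: "0 < 8 * A / (\<tau> * \<rho>)" using A t rho_pos by simp
  then have n1: "1 \<le> n" unfolding n_def by linarith
  have n2: "real n \<le> 1 + 8 * A / (\<tau> * \<rho>)" using np unfolding n_def by linarith
  have "8 * A / (\<tau> * \<rho>) \<le> real n" unfolding n_def by (rule real_nat_ceiling_ge)
  then have n3: "8 * A / \<tau> \<le> real n * \<rho>" using rho_pos t by (simp add: field_simps)
  have E_nn: "(\<integral>\<^sup>+x. ennreal ((v x)\<^sup>2) \<partial>lborel) = ennreal E"
    unfolding v2 E_def using iqp by (intro nn_integral_eq_integral) auto
  have "ennreal (real n * \<rho> * E) + ennreal (real n * \<rho> * E) = ennreal (2 * (real n * \<rho>)) * ennreal E"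
    using E rho_pos by (simp add: ennreal_mult[symmetric] ennreal_plus[symmetric] del: ennreal_plus)
  also have "\<dots> \<le> 2 * (\<integral>\<^sup>+x. v x \<partial>lborel)\<^sup>2 + ennreal ((real n)^3) * D"
    unfolding E_nn[symmetric] D_def by (rule nash_inequality) (use n1 rho_pos in \<open>auto simp: v_def\<close>)
  also have "\<dots> \<le> ennreal (real n * \<rho> * E) + ennreal ((real n)^3) * D"
    using n3 E by (intro add_right_mono order_trans[OF S2] ennreal_leI mult_right_mono) auto
  finally have "ennreal (real n * \<rho> * E) \<le> ennreal ((real n)^3) * D"
    by (simp add: ennreal_add_left_cancel_le)
  then have "ennreal (real n * \<rho> * E / (real n)^3) \<le> D"
    using n1 rho_pos E by (intro ennreal_divide_le_of_le_mult) auto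
  also have "real n * \<rho> * E / (real n)^3 = \<rho> * E / (real n)\<^sup>2"
    using n1 by (simp add: power2_eq_square power3_eq_cube)
  finally have D1: "ennreal (\<rho> * E / (real n)\<^sup>2) \<le> D" .
  define N where "N = 1 + B * F powr (- 1 / (p - 1))"
  have nN: "real n \<le> N"
  proof -
    have "1 / \<tau> = (A / E) powr (1 / (p - 1))"
      unfolding \<tau>_def using E A by (simp add: powr_divide)
    also have "\<dots> \<le> (A * c2 / F) powr (1 / (p - 1))"
    proof (intro powr_mono2)
      have "A * F \<le> A * (c2 * E)" using FE A by (intro mult_left_mono) auto
      then show "A / E \<le> A * c2 / F" using E F by (simp add: field_simps)
    qed (use p A E in auto)
    also have "\<dots> = (A * c2) powr (1 / (p - 1)) * F powr (- 1 / (p - 1))"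
      using A c2' F by (simp add: powr_divide powr_minus_divide)
    finally have "8 * A / \<rho> * (1 / \<tau>) \<le> 8 * A / \<rho> * ((A * c2) powr (1 / (p - 1)) * F powr (- 1 / (p - 1)))"
      using A rho_pos by (intro mult_left_mono) auto
    then show ?thesis using n2 t by (simp add: N_def B_def mult_ac)
  qed
  have "\<rho> / c2 * F / N\<^sup>2 \<le> \<rho> * E / (real n)\<^sup>2"
  proof -
    have "\<rho> / c2 * F \<le> \<rho> * E" using FE c2' rho_pos by (simp add: field_simps)
    moreover have "(real n)\<^sup>2 \<le> N\<^sup>2" using nN by (intro power_mono) auto
    ultimately show ?thesis using n1 E rho_pos by (intro frac_le) auto
  qed
  then have D2: "ennreal (\<rho> / c2 * F / N\<^sup>2) \<le> D" using D1 ennreal_leI order_trans by blast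
  define d where "d = (c1 * k0 * \<rho> / c2)\<^sup>2 / 8 * F / N\<^sup>2"
  have d0: "0 \<le> d" unfolding d_def using F by auto
  define G where "G = (LINT x|lborel. w x powr (1 - p) * \<bar>Kop u x\<bar> powr p)"
  have G0: "0 \<le> G" unfolding G_def by (intro integral_nonneg_AE) auto
  have iG: "integrable lborel (\<lambda>x. w x powr (1 - p) * \<bar>Kop u x\<bar> powr p)"
  proof (rule Bochner_Integration.integrable_bound)
    show "integrable lborel (\<lambda>x. c1 powr (1 - p) * \<bar>Kop u x\<bar> powr p)"
      using Kop_Lp[OF p \<nu> assms(4) c1 c2 sup u] by simp
    show "AE x in lborel. norm (w x powr (1 - p) * \<bar>Kop u x\<bar> powr p) \<le> norm (c1 powr (1 - p) * \<bar>Kop u x\<bar> powr p)"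
      using c1 p by (auto simp: abs_mult intro!: mult_right_mono powr_mono2')
  qed measurable
  have "ennreal ((1 + \<nu>) powr (1 - p) * G + d) = ennreal ((1 + \<nu>) powr (1 - p)) * ennreal G + ennreal d"
    using G0 d0 by (simp add: ennreal_mult)
  also have "ennreal d = ennreal (c1\<^sup>2 * (k0\<^sup>2 * \<rho>) / (8 * c2)) * ennreal (\<rho> / c2 * F / N\<^sup>2)"
  proof -
    have "d = (c1\<^sup>2 * (k0\<^sup>2 * \<rho>) / (8 * c2)) * (\<rho> / c2 * F / N\<^sup>2)"
      unfolding d_def by (simp add: power_mult_distrib power_divide power2_eq_square mult_ac)
    moreover have "0 \<le> c1\<^sup>2 * (k0\<^sup>2 * \<rho>) / (8 * c2)" "0 \<le> \<rho> / c2 * F / N\<^sup>2"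
      using c2' rho_pos F by auto
    ultimately show ?thesis by (simp only: ennreal_mult)
  qed
  also have "ennreal ((1 + \<nu>) powr (1 - p)) * ennreal G + ennreal (c1\<^sup>2 * (k0\<^sup>2 * \<rho>) / (8 * c2)) * ennreal (\<rho> / c2 * F / N\<^sup>2)
      \<le> ennreal ((1 + \<nu>) powr (1 - p)) * ennreal G + ennreal (c1\<^sup>2 * (k0\<^sup>2 * \<rho>) / (8 * c2)) * D"
    by (intro add_left_mono mult_left_mono D2) auto
  also have "ennreal G = weighted_energy p w (Kop u)"
    unfolding G_def using iG by (intro nn_integral_eq_integral[symmetric]) auto
  also have "ennreal ((1 + \<nu>) powr (1 - p)) * \<dots> + ennreal (c1\<^sup>2 * (k0\<^sup>2 * \<rho>) / (8 * c2)) * D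
      \<le> weighted_energy p w u"
    using weighted_energy_defect[OF p \<nu> assms(4) c1 c2 sup u] unfolding D_def v_def q_def .
  also have "\<dots> = ennreal F"
    unfolding F_def using iwq unfolding wq by (intro nn_integral_eq_integral) auto
  finally have "(1 + \<nu>) powr (1 - p) * G + d \<le> F" using F by (simp add: ennreal_le_iff)
  then have "(1 + \<nu>) powr (p - 1) * ((1 + \<nu>) powr (1 - p) * G) \<le> (1 + \<nu>) powr (p - 1) * (F - d)"
    by (intro mult_left_mono) auto
  also have "(1 + \<nu>) powr (p - 1) * ((1 + \<nu>) powr (1 - p) * G) = G"
    using \<nu> by (simp add: mult.assoc[symmetric] flip: powr_add)
  finally show ?thesis unfolding G_def d_def N_def .
qed

end

section \<open>Energies along differentiable curves\<close>

lemma integrable_abs_powr_add: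
  fixes f g :: "real \<Rightarrow> real"
  assumes q: "1 \<le> q" and [measurable]: "f \<in> borel_measurable lborel" "g \<in> borel_measurable lborel"
    and i: "integrable lborel (\<lambda>x. \<bar>f x\<bar> powr q)" "integrable lborel (\<lambda>x. \<bar>g x\<bar> powr q)"
  shows "integrable lborel (\<lambda>x. \<bar>f x + g x\<bar> powr q)"
proof -
  obtain C where C: "0 \<le> C" "\<And>a b. \<bar>a + b\<bar> powr q \<le> (1 + 1) * \<bar>a\<bar> powr q + C * \<bar>b\<bar> powr q"
    using abs_powr_add_le[OF q, of 1] by auto
  show ?thesis
  proof (rule Bochner_Integration.integrable_bound)
    show "integrable lborel (\<lambda>x. (1 + 1) * \<bar>f x\<bar> powr q + C * \<bar>g x\<bar> powr q)" using i by auto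
    show "AE x in lborel. norm (\<bar>f x + g x\<bar> powr q) \<le> norm ((1 + 1) * \<bar>f x\<bar> powr q + C * \<bar>g x\<bar> powr q)"
      using C by (intro AE_I2) (smt (verit) norm_powr_real_powr powr_ge_zero real_norm_def)
  qed measurable
qed

lemma integrable_abs_powr_cmult:
  fixes f :: "real \<Rightarrow> real"
  assumes "integrable lborel (\<lambda>x. \<bar>f x\<bar> powr q)"
  shows "integrable lborel (\<lambda>x. \<bar>c * f x\<bar> powr q)"
  using assms by (simp add: abs_mult powr_mult)

lemma integrable_abs_powr_diff:
  fixes f g :: "real \<Rightarrow> real"
  assumes q: "1 \<le> q" and "f \<in> borel_measurable lborel" "g \<in> borel_measurable lborel"
    and i: "integrable lborel (\<lambda>x. \<bar>f x\<bar> powr q)" "integrable lborel (\<lambda>x. \<bar>g x\<bar> powr q)"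
  shows "integrable lborel (\<lambda>x. \<bar>f x - g x\<bar> powr q)"
  using integrable_abs_powr_add[OF q, of f "\<lambda>x. - g x"] assms by simp

lemma integrable_weight_mult:
  fixes W f :: "real \<Rightarrow> real"
  assumes [measurable]: "W \<in> borel_measurable lborel" and W: "\<And>x. 0 \<le> W x" "\<And>x. W x \<le> W2"
    and i: "integrable lborel f"
  shows "integrable lborel (\<lambda>x. W x * f x)"
proof (rule Bochner_Integration.integrable_bound)
  show "integrable lborel (\<lambda>x. W2 * f x)" using i by simp
  have "\<bar>W x\<bar> \<le> \<bar>W2\<bar>" for x using W[of x] by simp
  then show "AE x in lborel. norm (W x * f x) \<le> norm (W2 * f x)"
    by (intro AE_I2) (simp add: abs_mult mult_right_mono)
  show "(\<lambda>x. W x * f x) \<in> borel_measurable lborel" using i by measurable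
qed

text \<open>
  \<open>U\<close> is a curve in \<open>L\<^sup>q\<close> with derivative \<open>Z - U\<close> on \<open>[0, \<infinity>)\<close>, and \<open>W\<close> is a bounded weight. The derivative is
  expressed through \<open>q\<close>-th powers of norms.
\<close>
locale energy_curve =
  fixes q W2 :: real and W :: "real \<Rightarrow> real" and U Z :: "real \<Rightarrow> real \<Rightarrow> real"
  assumes q: "1 \<le> q"
    and W_borel [measurable]: "W \<in> borel_measurable lborel" and W: "\<And>x. 0 \<le> W x" "\<And>x. W x \<le> W2"
    and U_borel [measurable]: "\<And>t. U t \<in> borel_measurable lborel"
    and U: "\<And>t. 0 \<le> t \<Longrightarrow> integrable lborel (\<lambda>x. \<bar>U t x\<bar> powr q)"
    and Z_borel [measurable]: "\<And>t. Z t \<in> borel_measurable lborel"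
    and Z: "\<And>t. 0 \<le> t \<Longrightarrow> integrable lborel (\<lambda>x. \<bar>Z t x\<bar> powr q)"
    and lim: "\<And>t. 0 \<le> t \<Longrightarrow> ((\<lambda>s. LINT x|lborel. \<bar>(U s x - U t x) / (s - t) - (Z t x - U t x)\<bar> powr q) \<longlongrightarrow> 0) (at t within {0..})"
begin

text \<open>
  The weighted energy, the \<open>q\<close>-th power of a weighted \<open>L\<^sup>q\<close> norm.
\<close>
definition energy :: "(real \<Rightarrow> real) \<Rightarrow> real" where
  "energy f = (LINT x|lborel. W x * \<bar>f x\<bar> powr q)"

lemma W2_nonneg: "0 \<le> W2" using W[of 0] by linarith

lemma energy_nonneg: "0 \<le> energy f"
  unfolding energy_def using W by (intro integral_nonneg_AE) auto

lemma remainder_integrable: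
  assumes "0 \<le> s" "0 \<le> t"
  shows "integrable lborel (\<lambda>x. \<bar>(U s x - U t x) / (s - t) - (Z t x - U t x)\<bar> powr q)"
proof -
  have "integrable lborel (\<lambda>x. \<bar>1 / (s - t) * (U s x - U t x)\<bar> powr q)"
    using assms U q by (intro integrable_abs_powr_cmult integrable_abs_powr_diff) auto
  then have "integrable lborel (\<lambda>x. \<bar>(U s x - U t x) / (s - t)\<bar> powr q)" by simp
  then show ?thesis
    using assms U Z q by (intro integrable_abs_powr_diff) (auto intro: integrable_abs_powr_diff)
qed

lemma remainder_small:
  assumes "0 \<le> t" "0 < e"
  shows "\<exists>d>0. \<forall>s. 0 \<le> s \<and> s \<noteq> t \<and> \<bar>s - t\<bar> < d \<longrightarrow>
           (LINT x|lborel. \<bar>(U s x - U t x) / (s - t) - (Z t x - U t x)\<bar> powr q) < e"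
proof -
  have "\<forall>\<^sub>F s in at t within {0..}. (LINT x|lborel. \<bar>(U s x - U t x) / (s - t) - (Z t x - U t x)\<bar> powr q) < e"
    using lim[OF assms(1)] assms(2) by (intro order_tendstoD) auto
  then show ?thesis unfolding eventually_at by (auto simp: dist_real_def)
qed

text \<open>
  The upper right derivative of \<open>t \<mapsto> energy (U t)\<close> is at most \<open>energy (Z t) - energy (U t)\<close>. This uses
  only that \<open>U (t + h)\<close> is the convex combination \<open>(1 - h) U t + h (Z t + r)\<close> with a small remainder \<open>r\<close>.
\<close>
lemma energy_right_step:
  assumes t: "0 \<le> t" and e: "0 < e"
  shows "\<exists>d>0. \<forall>h. 0 < h \<and> h < d \<longrightarrow> energy (U (t + h)) \<le> (1 - h) * energy (U t) + h * (energy (Z t) + e)"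
proof -
  define e' where "e' = e / (2 * (energy (Z t) + 1))"
  have e': "0 < e'" using e energy_nonneg[of "Z t"] by (simp add: e'_def)
  have e'2: "e' * energy (Z t) \<le> e / 2"
    using e energy_nonneg[of "Z t"] by (simp add: e'_def field_simps)
  obtain C where C: "0 \<le> C" "\<And>a b. \<bar>a + b\<bar> powr q \<le> (1 + e') * \<bar>a\<bar> powr q + C * \<bar>b\<bar> powr q"
    using abs_powr_add_le[OF q e'] by auto
  have CW: "0 \<le> C * W2" using C W2_nonneg by simp
  obtain d where d: "0 < d" "\<And>s. 0 \<le> s \<Longrightarrow> s \<noteq> t \<Longrightarrow> \<bar>s - t\<bar> < d \<Longrightarrow>
           (LINT x|lborel. \<bar>(U s x - U t x) / (s - t) - (Z t x - U t x)\<bar> powr q) < e / (2 * (C * W2 + 1))"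
    using remainder_small[OF t, of "e / (2 * (C * W2 + 1))"] e CW by auto
  have "energy (U (t + h)) \<le> (1 - h) * energy (U t) + h * (energy (Z t) + e)" if h: "0 < h" "h < min d 1" for h
  proof -
    define r where "r = (\<lambda>x. (U (t + h) x - U t x) / h - (Z t x - U t x))"
    have ir: "integrable lborel (\<lambda>x. \<bar>r x\<bar> powr q)"
      using remainder_integrable[of "t + h" t] t h by (simp add: r_def)
    have r: "(LINT x|lborel. \<bar>r x\<bar> powr q) < e / (2 * (C * W2 + 1))"
      using d(2)[of "t + h"] t h by (simp add: r_def)
    have eq: "U (t + h) x = (1 - h) * U t x + h * (Z t x + r x)" for x
      using h by (simp add: r_def field_simps)
    have i: "integrable lborel (\<lambda>x. W x * \<bar>U t x\<bar> powr q)" "integrable lborel (\<lambda>x. W x * \<bar>Z t x\<bar> powr q)"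
      "integrable lborel (\<lambda>x. W x * \<bar>U (t + h) x\<bar> powr q)" "integrable lborel (\<lambda>x. W2 * \<bar>r x\<bar> powr q)"
      using U Z t h ir W by (auto intro!: integrable_weight_mult)
    have "energy (U (t + h)) \<le> (LINT x|lborel. (1 - h) * (W x * \<bar>U t x\<bar> powr q)
        + h * ((1 + e') * (W x * \<bar>Z t x\<bar> powr q) + C * (W2 * \<bar>r x\<bar> powr q)))"
      unfolding energy_def
    proof (intro integral_mono)
      fix x
      have "\<bar>U (t + h) x\<bar> powr q \<le> (1 - h) * \<bar>U t x\<bar> powr q + h * \<bar>Z t x + r x\<bar> powr q"
        unfolding eq using q h by (intro abs_powr_convex) auto
      also have "\<dots> \<le> (1 - h) * \<bar>U t x\<bar> powr q + h * ((1 + e') * \<bar>Z t x\<bar> powr q + C * \<bar>r x\<bar> powr q)"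
        using C h by (intro add_left_mono mult_left_mono) auto
      finally have "W x * \<bar>U (t + h) x\<bar> powr q \<le> W x * ((1 - h) * \<bar>U t x\<bar> powr q + h * ((1 + e') * \<bar>Z t x\<bar> powr q + C * \<bar>r x\<bar> powr q))"
        using W by (intro mult_left_mono) auto
      also have "\<dots> = (1 - h) * (W x * \<bar>U t x\<bar> powr q) + h * ((1 + e') * (W x * \<bar>Z t x\<bar> powr q) + C * (W x * \<bar>r x\<bar> powr q))"
        by (simp add: algebra_simps)
      also have "\<dots> \<le> (1 - h) * (W x * \<bar>U t x\<bar> powr q) + h * ((1 + e') * (W x * \<bar>Z t x\<bar> powr q) + C * (W2 * \<bar>r x\<bar> powr q))"
        using h C W by (intro add_left_mono mult_left_mono mult_right_mono) auto
      finally show "W x * \<bar>U (t + h) x\<bar> powr q \<le> (1 - h) * (W x * \<bar>U t x\<bar> powr q)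
        + h * ((1 + e') * (W x * \<bar>Z t x\<bar> powr q) + C * (W2 * \<bar>r x\<bar> powr q))" .
    qed (use i in auto)
    also have "\<dots> = (1 - h) * energy (U t) + h * ((1 + e') * energy (Z t) + C * (W2 * (LINT x|lborel. \<bar>r x\<bar> powr q)))"
      using i ir by (simp add: energy_def)
    also have "\<dots> \<le> (1 - h) * energy (U t) + h * (energy (Z t) + e)"
    proof -
      have "C * (W2 * (LINT x|lborel. \<bar>r x\<bar> powr q)) \<le> (C * W2) * (e / (2 * (C * W2 + 1)))"
        unfolding mult.assoc[symmetric] using r CW by (intro mult_left_mono) auto
      also have "\<dots> \<le> e / 2" using CW e by (simp add: field_simps)
      finally have "(1 + e') * energy (Z t) + C * (W2 * (LINT x|lborel. \<bar>r x\<bar> powr q)) \<le> energy (Z t) + e"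
        using e'2 by (simp add: algebra_simps)
      then show ?thesis using h by (intro add_left_mono mult_left_mono) auto
    qed
    finally show ?thesis .
  qed
  then show ?thesis using d(1) by (intro exI[of _ "min d 1"]) auto
qed

text \<open>
  Lower semicontinuity from the left, in the multiplicative form in which it follows from
  \<open>abs_powr_add_le\<close>.
\<close>
lemma energy_left_lsc:
  assumes t: "0 < t" and e: "0 < e"
  shows "\<exists>d>0. \<forall>s. 0 \<le> s \<and> t - d < s \<and> s < t \<longrightarrow> energy (U t) \<le> (1 + e) * energy (U s) + e"
proof -
  obtain C where C: "0 \<le> C" "\<And>a b. \<bar>a + b\<bar> powr q \<le> (1 + e) * \<bar>a\<bar> powr q + C * \<bar>b\<bar> powr q"
    using abs_powr_add_le[OF q e] by auto
  obtain C' where C': "0 \<le> C'" "\<And>a b. \<bar>a + b\<bar> powr q \<le> (1 + 1) * \<bar>a\<bar> powr q + C' * \<bar>b\<bar> powr q"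
    using abs_powr_add_le[OF q, of 1] by auto
  obtain d where d: "0 < d" "\<And>s. 0 \<le> s \<Longrightarrow> s \<noteq> t \<Longrightarrow> \<bar>s - t\<bar> < d \<Longrightarrow>
           (LINT x|lborel. \<bar>(U s x - U t x) / (s - t) - (Z t x - U t x)\<bar> powr q) < 1"
    using remainder_small[of t 1] t by auto
  define I where "I = (LINT x|lborel. \<bar>Z t x - U t x\<bar> powr q)"
  have I: "0 \<le> I" unfolding I_def by (intro integral_nonneg_AE) auto
  have iV: "integrable lborel (\<lambda>x. \<bar>Z t x - U t x\<bar> powr q)"
    using t U Z q by (intro integrable_abs_powr_diff) auto
  define Q where "Q = C * W2 * (2 * I + C')"
  have Q: "0 \<le> Q" using C C' W2_nonneg I by (simp add: Q_def)
  define d' where "d' = min (min d 1) (e / (Q + 1))"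
  have d': "0 < d'" using d e Q by (simp add: d'_def)
  have "energy (U t) \<le> (1 + e) * energy (U s) + e" if s: "0 \<le> s" "t - d' < s" "s < t" for s
  proof -
    have s': "t - s < d" "t - s \<le> 1" "t - s \<le> e / (Q + 1)" using s by (auto simp: d'_def)
    define r where "r = (\<lambda>x. (U s x - U t x) / (s - t) - (Z t x - U t x))"
    have ir: "integrable lborel (\<lambda>x. \<bar>r x\<bar> powr q)"
      using remainder_integrable[of s t] t s by (simp add: r_def)
    have r: "(LINT x|lborel. \<bar>r x\<bar> powr q) < 1"
      using d(2)[of s] t s s' by (simp add: r_def)
    have eq: "U t x = U s x + (t - s) * ((Z t x - U t x) + r x)" for x
      using s by (simp add: r_def field_simps)
    have i: "integrable lborel (\<lambda>x. W x * \<bar>U t x\<bar> powr q)" "integrable lborel (\<lambda>x. W x * \<bar>U s x\<bar> powr q)"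
      using U t s W by (auto intro!: integrable_weight_mult)
    have "energy (U t) \<le> (LINT x|lborel. (1 + e) * (W x * \<bar>U s x\<bar> powr q)
        + C * W2 * (t - s) * (2 * \<bar>Z t x - U t x\<bar> powr q + C' * \<bar>r x\<bar> powr q))"
      unfolding energy_def
    proof (intro integral_mono)
      fix x
      have "(t - s) powr q \<le> t - s"
      proof -
        have "(t - s) powr q \<le> (t - s) powr 1" using s s' q by (intro powr_mono') auto
        then show ?thesis using s by simp
      qed
      then have "(t - s) powr q * \<bar>(Z t x - U t x) + r x\<bar> powr q \<le> (t - s) * (2 * \<bar>Z t x - U t x\<bar> powr q + C' * \<bar>r x\<bar> powr q)"
        using C'(2)[of "Z t x - U t x" "r x"] s by (intro mult_mono) auto
      then have 1: "\<bar>(t - s) * ((Z t x - U t x) + r x)\<bar> powr q \<le> (t - s) * (2 * \<bar>Z t x - U t x\<bar> powr q + C' * \<bar>r x\<bar> powr q)"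
        using s by (simp add: abs_mult powr_mult)
      have "\<bar>U t x\<bar> powr q \<le> (1 + e) * \<bar>U s x\<bar> powr q + C * \<bar>(t - s) * ((Z t x - U t x) + r x)\<bar> powr q"
        using C(2)[of "U s x" "(t - s) * ((Z t x - U t x) + r x)"] eq[of x] by simp
      also have "\<dots> \<le> (1 + e) * \<bar>U s x\<bar> powr q + C * ((t - s) * (2 * \<bar>Z t x - U t x\<bar> powr q + C' * \<bar>r x\<bar> powr q))"
        using C 1 by (intro add_left_mono mult_left_mono) auto
      finally have "W x * \<bar>U t x\<bar> powr q \<le> W x * ((1 + e) * \<bar>U s x\<bar> powr q + C * ((t - s) * (2 * \<bar>Z t x - U t x\<bar> powr q + C' * \<bar>r x\<bar> powr q)))"
        using W by (intro mult_left_mono) auto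
      also have "\<dots> = (1 + e) * (W x * \<bar>U s x\<bar> powr q) + W x * (C * ((t - s) * (2 * \<bar>Z t x - U t x\<bar> powr q + C' * \<bar>r x\<bar> powr q)))"
        by (simp add: algebra_simps)
      also have "\<dots> \<le> (1 + e) * (W x * \<bar>U s x\<bar> powr q) + W2 * (C * ((t - s) * (2 * \<bar>Z t x - U t x\<bar> powr q + C' * \<bar>r x\<bar> powr q)))"
        using s C C' W by (intro add_left_mono mult_right_mono) auto
      finally show "W x * \<bar>U t x\<bar> powr q \<le> (1 + e) * (W x * \<bar>U s x\<bar> powr q)
        + C * W2 * (t - s) * (2 * \<bar>Z t x - U t x\<bar> powr q + C' * \<bar>r x\<bar> powr q)"
        by (simp add: mult_ac)
    qed (use i ir iV in auto)
    also have "\<dots> = (1 + e) * energy (U s) + C * W2 * (t - s) * (2 * I + C' * (LINT x|lborel. \<bar>r x\<bar> powr q))"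
      using i ir iV by (simp add: energy_def I_def)
    also have "\<dots> \<le> (1 + e) * energy (U s) + C * W2 * (t - s) * (2 * I + C' * 1)"
      using r C C' W2_nonneg s by (intro add_left_mono mult_left_mono) auto
    also have "\<dots> = (1 + e) * energy (U s) + Q * (t - s)" by (simp add: Q_def mult_ac)
    also have "\<dots> \<le> (1 + e) * energy (U s) + Q * (e / (Q + 1))"
      using s' Q by (intro add_left_mono mult_left_mono) auto
    also have "\<dots> \<le> (1 + e) * energy (U s) + e"
      using Q e by (simp add: field_simps)
    finally show ?thesis .
  qed
  then show ?thesis using d' by blast
qed

end

text \<open>
  If \<open>\<Phi>\<close> starts below \<open>\<beta>\<close> and, whenever it touches \<open>\<beta>\<close>, its upper right derivative is less than \<open>\<beta>'\<close>, then
  it stays below \<open>\<beta>\<close>.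
\<close>
lemma comparison_principle:
  fixes \<Phi> P \<beta> \<beta>' :: "real \<Rightarrow> real"
  assumes right: "\<And>t e. 0 \<le> t \<Longrightarrow> 0 < e \<Longrightarrow> \<exists>d>0. \<forall>h. 0 < h \<and> h < d \<longrightarrow> \<Phi> (t + h) \<le> (1 - h) * \<Phi> t + h * (P t + e)"
    and left: "\<And>t e. 0 < t \<Longrightarrow> 0 < e \<Longrightarrow> \<exists>d>0. \<forall>s. 0 \<le> s \<and> t - d < s \<and> s < t \<longrightarrow> \<Phi> t \<le> (1 + e) * \<Phi> s + e"
    and init: "\<Phi> 0 \<le> \<beta> 0"
    and deriv: "\<And>t. 0 \<le> t \<Longrightarrow> (\<beta> has_real_derivative \<beta>' t) (at t)"
    and contact: "\<And>t. 0 \<le> t \<Longrightarrow> \<Phi> t = \<beta> t \<Longrightarrow> P t - \<Phi> t < \<beta>' t"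
    and T: "0 \<le> T"
  shows "\<Phi> T \<le> \<beta> T"
proof (rule ccontr)
  assume "\<not> \<Phi> T \<le> \<beta> T"
  define S where "S = {s. 0 \<le> s \<and> \<beta> s < \<Phi> s}"
  have TS: "T \<in> S" using T \<open>\<not> \<Phi> T \<le> \<beta> T\<close> by (simp add: S_def)
  have bdd: "bdd_below S" by (rule bdd_belowI[of _ 0]) (simp add: S_def)
  \<comment> \<open>the first time at which \<open>\<beta>\<close> is crossed\<close>
  define t where "t = Inf S"
  have t0: "0 \<le> t" unfolding t_def using TS by (intro cInf_greatest) (auto simp: S_def)
  have below: "\<Phi> s \<le> \<beta> s" if "0 \<le> s" "s < t" for s
    using cInf_lower[OF _ bdd, of s] that by (force simp: S_def t_def)
  have cont: "isCont \<beta> t" using deriv[OF t0] by (rule DERIV_isCont)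
  have le: "\<Phi> t \<le> \<beta> t"
  proof (cases "t = 0")
    case True
    then show ?thesis using init by simp
  next
    case False
    then have t: "0 < t" using t0 by simp
    show ?thesis
    proof (rule ccontr)
      assume "\<not> \<Phi> t \<le> \<beta> t"
      define e where "e = (\<Phi> t - \<beta> t) / (2 * (\<bar>\<beta> t\<bar> + 1))"
      have e: "0 < e" using \<open>\<not> \<Phi> t \<le> \<beta> t\<close> by (simp add: e_def)
      obtain d where d: "0 < d" "\<And>s. 0 \<le> s \<Longrightarrow> t - d < s \<Longrightarrow> s < t \<Longrightarrow> \<Phi> t \<le> (1 + e) * \<Phi> s + e"
        using left[OF t e] by blast
      have "\<Phi> t \<le> (1 + e) * \<beta> t + e"
      proof (rule tendsto_lowerbound)
        show "((\<lambda>s. (1 + e) * \<beta> s + e) \<longlongrightarrow> (1 + e) * \<beta> t + e) (at_left t)"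
          using cont by (intro tendsto_intros) (auto simp: isCont_def intro: tendsto_within_subset)
        have "\<forall>\<^sub>F s in at_left t. max 0 (t - d) < s" using t d by (intro order_tendstoD(1)[OF tendsto_ident_at]) auto
        moreover have "\<forall>\<^sub>F s in at_left t. s < t" by (simp add: eventually_at_filter)
        ultimately show "\<forall>\<^sub>F s in at_left t. \<Phi> t \<le> (1 + e) * \<beta> s + e"
        proof eventually_elim
          case (elim s)
          then have "\<Phi> t \<le> (1 + e) * \<Phi> s + e" by (intro d) auto
          also have "\<dots> \<le> (1 + e) * \<beta> s + e" using below[of s] elim e by (intro add_right_mono mult_left_mono) auto
          finally show ?case .
        qed
      qed auto
      then have "\<Phi> t - \<beta> t \<le> e * (\<beta> t + 1)" by (simp add: algebra_simps)
      also have "\<dots> \<le> e * (\<bar>\<beta> t\<bar> + 1)" using e by (intro mult_left_mono) auto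
      also have "\<dots> = (\<Phi> t - \<beta> t) / 2" by (simp add: e_def field_simps)
      finally show False using \<open>\<not> \<Phi> t \<le> \<beta> t\<close> by simp
    qed
  qed
  have "\<exists>d>0. \<forall>h. 0 < h \<and> h < d \<longrightarrow> \<Phi> (t + h) \<le> \<beta> (t + h)"
  proof (cases "\<Phi> t = \<beta> t")
    case True
    define e where "e = (\<beta>' t - (P t - \<Phi> t)) / 2"
    have e: "0 < e" using contact[OF t0 True] by (simp add: e_def)
    obtain d where d: "0 < d" "\<And>h. 0 < h \<Longrightarrow> h < d \<Longrightarrow> \<Phi> (t + h) \<le> (1 - h) * \<Phi> t + h * (P t + e)"
      using right[OF t0 e] by blast
    have "((\<lambda>h. (\<beta> (t + h) - \<beta> t) / h) \<longlongrightarrow> \<beta>' t) (at 0)" using deriv[OF t0] by (simp add: DERIV_def)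
    then have "\<forall>\<^sub>F h in at 0. \<beta>' t - e < (\<beta> (t + h) - \<beta> t) / h" using e by (intro order_tendstoD) auto
    then obtain d2 where d2: "0 < d2" "\<And>h. h \<noteq> 0 \<Longrightarrow> \<bar>h\<bar> < d2 \<Longrightarrow> \<beta>' t - e < (\<beta> (t + h) - \<beta> t) / h"
      unfolding eventually_at by (auto simp: dist_real_def)
    have "\<Phi> (t + h) \<le> \<beta> (t + h)" if h: "0 < h" "h < min d d2" for h
    proof -
      have "\<Phi> (t + h) \<le> \<Phi> t + h * (P t - \<Phi> t + e)" using d(2)[of h] h by (simp add: algebra_simps)
      also have "P t - \<Phi> t + e = \<beta>' t - e" by (simp add: e_def field_simps)
      also have "\<Phi> t + h * (\<beta>' t - e) \<le> \<beta> (t + h)"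
        using d2(2)[of h] h True by (simp add: field_simps)
      finally show ?thesis .
    qed
    then show ?thesis using d(1) d2(1) by (intro exI[of _ "min d d2"]) auto
  next
    case False
    then have lt: "\<Phi> t < \<beta> t" using le by simp
    obtain d where d: "0 < d" "\<And>h. 0 < h \<Longrightarrow> h < d \<Longrightarrow> \<Phi> (t + h) \<le> (1 - h) * \<Phi> t + h * (P t + 1)"
      using right[OF t0, of 1] by auto
    have "((\<lambda>h. \<beta> (t + h) - ((1 - h) * \<Phi> t + h * (P t + 1))) \<longlongrightarrow> \<beta> t - ((1 - 0) * \<Phi> t + 0 * (P t + 1))) (at 0)"
      using cont by (intro tendsto_intros) (simp add: isCont_iff)
    then have "\<forall>\<^sub>F h in at 0. 0 < \<beta> (t + h) - ((1 - h) * \<Phi> t + h * (P t + 1))"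
      using lt by (intro order_tendstoD) auto
    then obtain d2 where d2: "0 < d2" "\<And>h. h \<noteq> 0 \<Longrightarrow> \<bar>h\<bar> < d2 \<Longrightarrow> 0 < \<beta> (t + h) - ((1 - h) * \<Phi> t + h * (P t + 1))"
      unfolding eventually_at by (auto simp: dist_real_def)
    have "\<Phi> (t + h) \<le> \<beta> (t + h)" if h: "0 < h" "h < min d d2" for h
      using d(2)[of h] d2(2)[of h] h by simp
    then show ?thesis using d(1) d2(1) by (intro exI[of _ "min d d2"]) auto
  qed
  then obtain d where d: "0 < d" "\<And>h. 0 < h \<Longrightarrow> h < d \<Longrightarrow> \<Phi> (t + h) \<le> \<beta> (t + h)" by blast
  have "t + d \<le> s" if "s \<in> S" for s
  proof (rule ccontr)
    assume "\<not> t + d \<le> s"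
    moreover have "t \<le> s" unfolding t_def by (rule cInf_lower[OF that bdd])
    ultimately have "\<Phi> s \<le> \<beta> s" using d(2)[of "s - t"] le by (cases "s = t") auto
    then show False using that by (simp add: S_def)
  qed
  then have "t + d \<le> t" using TS unfolding t_def[symmetric] by (subst (2) t_def, intro cInf_greatest) auto
  then show False using d by simp
qed

section \<open>Decay for even jump kernels\<close>

text \<open>
  The functions \<open>F = C (K + t) powr (- (p - 1) / 2)\<close> with \<open>C\<close> and \<open>K\<close> large are strict supersolutions of
  \<open>F' = - d F / (1 + B F\<^sup>-\<^sup>1\<^sup>/\<^sup>(\<^sup>p\<^sup>-\<^sup>1\<^sup>))\<^sup>2\<close>. The inequality is stated for all values above \<open>F\<close>, because the
  barrier is later multiplied by a growing exponential.
\<close>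
lemma barrier_constants:
  fixes p d B F0 :: real
  assumes p: "2 \<le> p" and d: "0 < d" and B: "0 < B" and F0: "0 \<le> F0"
  shows "\<exists>C>0. \<exists>K\<ge>1. F0 \<le> C * K powr (- ((p - 1) / 2)) \<and>
           (\<forall>t\<ge>0. \<forall>F. C * (K + t) powr (- ((p - 1) / 2)) \<le> F \<longrightarrow>
              (p - 1) / 2 * F / (K + t) < d * F / (1 + B * F powr (- 1 / (p - 1)))\<^sup>2)"
proof -
  \<comment> \<open>\<open>C\<close> is chosen so that \<open>B C\<^sup>-\<^sup>1\<^sup>/\<^sup>(\<^sup>p\<^sup>-\<^sup>1\<^sup>) \<le> \<eta>\<close>, and \<open>\<eta>\<close> so that the growth of the squared denominator uses up half of \<open>d\<close>\<close>
  define \<eta> where "\<eta> = sqrt (d / (2 * (p - 1)))"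
  have "m * (d / (2 * m)) = d / 2" if "0 < m" for m :: real using that by simp
  from this[of "p - 1"] have eta: "0 < \<eta>" "(p - 1) * \<eta>\<^sup>2 = d / 2" using d p by (simp_all add: \<eta>_def)
  define K where "K = 2 * (p - 1) / d + 1"
  have K: "1 \<le> K" "d / 2 * K > p - 1" using d p by (auto simp: K_def field_simps)
  define C where "C = max ((B / \<eta>) powr (p - 1)) (K powr ((p - 1) / 2) * F0)"
  have C0: "0 < C" using B eta by (simp add: C_def less_max_iff_disj)
  have init: "F0 \<le> C * K powr (- ((p - 1) / 2))"
  proof -
    have "F0 = K powr ((p - 1) / 2) * F0 * K powr (- ((p - 1) / 2))"
      using K by (simp add: powr_minus field_simps)
    also have "\<dots> \<le> C * K powr (- ((p - 1) / 2))" by (intro mult_right_mono) (auto simp: C_def)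
    finally show ?thesis .
  qed
  have BC: "B * C powr (- 1 / (p - 1)) \<le> \<eta>"
  proof -
    have "C powr (- 1 / (p - 1)) \<le> ((B / \<eta>) powr (p - 1)) powr (- 1 / (p - 1))"
      using B eta p C0 by (intro powr_mono2') (auto simp: C_def divide_nonpos_pos)
    also have "\<dots> = (B / \<eta>) powr (- 1)" using p by (simp add: powr_powr)
    also have "\<dots> = \<eta> / B" using B eta by (simp add: powr_minus_divide)
    finally show ?thesis using B by (simp add: field_simps)
  qed
  have "(p - 1) / 2 * F / (K + t) < d * F / (1 + B * F powr (- 1 / (p - 1)))\<^sup>2"
    if t: "0 \<le> t" and F: "C * (K + t) powr (- ((p - 1) / 2)) \<le> F" for t F
  proof -
    have Kt: "0 < K + t" using K t by simp
    have Fp: "0 < F" using F C0 Kt by (smt (verit) mult_pos_pos powr_gt_zero)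
    have "F powr (- 1 / (p - 1)) \<le> (C * (K + t) powr (- ((p - 1) / 2))) powr (- 1 / (p - 1))"
      using F C0 Kt p by (intro powr_mono2') (auto simp: divide_nonpos_pos)
    also have "\<dots> = C powr (- 1 / (p - 1)) * (K + t) powr (1 / 2)"
    proof -
      have "- ((p - 1) / 2) * (- 1 / (p - 1)) = 1 / 2" using p by simp
      then show ?thesis using C0 Kt by (simp only: powr_mult powr_powr)
    qed
    also have "\<dots> = C powr (- 1 / (p - 1)) * sqrt (K + t)" using Kt by (simp add: powr_half_sqrt)
    finally have "B * F powr (- 1 / (p - 1)) \<le> (B * C powr (- 1 / (p - 1))) * sqrt (K + t)"
      using B by (simp add: mult.assoc)
    also have "\<dots> \<le> \<eta> * sqrt (K + t)" using BC Kt by (intro mult_right_mono) auto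
    finally have le: "B * F powr (- 1 / (p - 1)) \<le> \<eta> * sqrt (K + t)" .
    define N where "N = 1 + B * F powr (- 1 / (p - 1))"
    have N1: "1 \<le> N" using B by (simp add: N_def)
    have "N\<^sup>2 \<le> (1 + \<eta> * sqrt (K + t))\<^sup>2" using le N1 unfolding N_def by (intro power_mono) auto
    also have "\<dots> \<le> 2 + 2 * (\<eta> * sqrt (K + t))\<^sup>2"
      using sum_squares_ge_zero[of "1 - \<eta> * sqrt (K + t)" 0] by (simp add: power2_eq_square algebra_simps)
    also have "\<dots> = 2 + 2 * (\<eta>\<^sup>2 * (K + t))" using Kt by (simp add: power_mult_distrib)
    finally have "(p - 1) / 2 * N\<^sup>2 \<le> (p - 1) / 2 * (2 + 2 * (\<eta>\<^sup>2 * (K + t)))"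
      using p by (intro mult_left_mono) auto
    also have "\<dots> = (p - 1) + ((p - 1) * \<eta>\<^sup>2) * (K + t)" by (simp add: field_simps)
    also have "\<dots> < d * (K + t)"
    proof -
      have "0 \<le> d / 2 * t" using d t by simp
      then have "p - 1 < d / 2 * (K + t)" using K(2) unfolding distrib_left by linarith
      then show ?thesis unfolding eta(2) by simp
    qed
    finally have "(p - 1) / 2 * N\<^sup>2 * F < d * (K + t) * F" using Fp by (intro mult_strict_right_mono) auto
    then show ?thesis unfolding N_def[symmetric] using Kt N1 by (simp add: field_simps)
  qed
  then show ?thesis using C0 K(1) init by blast
qed

context jump_kernel
begin

text \<open>
  The decay estimate for \<open>u' = K u - u\<close>. The constants \<open>C\<close> and \<open>K\<close> enter as hypotheses, so that they can be
  fixed before the kernel.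
\<close>
lemma energy_decay:
  fixes p T a :: real and U :: "real \<Rightarrow> real \<Rightarrow> real"
  defines "c1 \<equiv> weight_lower k0 M \<rho>" and "c2 \<equiv> weight_upper k0 k1 M \<rho>"
  assumes p: "2 \<le> p" and T: "0 \<le> T"
    and U_borel: "\<And>t. U t \<in> borel_measurable borel"
    and U1: "\<And>t. 0 \<le> t \<Longrightarrow> integrable lborel (\<lambda>x. \<bar>U t x\<bar> powr 1)"
    and Up: "\<And>t. 0 \<le> t \<Longrightarrow> integrable lborel (\<lambda>x. \<bar>U t x\<bar> powr p)"
    and lim1: "\<And>t. 0 \<le> t \<Longrightarrow> ((\<lambda>s. LINT x|lborel. \<bar>(U s x - U t x) / (s - t) - (Kop (U t) x - U t x)\<bar> powr 1) \<longlongrightarrow> 0) (at t within {0..})"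
    and limp: "\<And>t. 0 \<le> t \<Longrightarrow> ((\<lambda>s. LINT x|lborel. \<bar>(U s x - U t x) / (s - t) - (Kop (U t) x - U t x)\<bar> powr p) \<longlongrightarrow> 0) (at t within {0..})"
    and a: "(LINT x|lborel. \<bar>U 0 x\<bar> powr 1) \<le> a" and A: "A = (a + 1) / c1"
    and B: "B = 8 * A * (A * c2) powr (1 / (p - 1)) / \<rho>"
    and C: "0 < C" and K: "1 \<le> K"
    and init: "c1 powr (1 - p) * (LINT x|lborel. \<bar>U 0 x\<bar> powr p) \<le> C * K powr (- ((p - 1) / 2))"
    and barrier: "\<And>t F. 0 \<le> t \<Longrightarrow> C * (K + t) powr (- ((p - 1) / 2)) \<le> F \<Longrightarrow>
        (p - 1) / 2 * F / (K + t) < (c1 * k0 * \<rho> / c2)\<^sup>2 / 8 * F / (1 + B * F powr (- 1 / (p - 1)))\<^sup>2"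
  shows "(LINT x|lborel. \<bar>U T x\<bar> powr p) \<le> c2 powr (p - 1) * (exp (2 powr (p - 1)) * C) * (1 + T) powr (- ((p - 1) / 2))"
proof -
  note [measurable] = U_borel
  have c1: "0 < c1" unfolding c1_def by (rule weight_lower_pos[OF kappa0_pos M_pos rho_pos])
  have c2: "0 < c2" unfolding c2_def using kappa0_pos kappa1_pos by (intro weight_upper_pos) auto
  have iU: "integrable lborel (U t)" if "0 \<le> t" for t
    using U1[OF that] by (simp add: integrable_abs_iff)
  interpret L1: energy_curve 1 1 "\<lambda>_. 1" U "\<lambda>t. Kop (U t)"
  proof
    show "integrable lborel (\<lambda>x. \<bar>Kop (U t) x\<bar> powr 1)" if "0 \<le> t" for t
      using Kop_L1(1)[OF iU[OF that]] by simp
  qed (use U1 lim1 in \<open>auto\<close>)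
  have "0 \<le> (LINT x|lborel. \<bar>U 0 x\<bar> powr 1)" by (intro integral_nonneg_AE) auto
  then have a0: "0 \<le> a" using a by linarith
  \<comment> \<open>the \<open>L\<^sup>1\<close> norm does not increase; a bound with slack is enough and meets the strict contact condition\<close>
  have L1b: "(LINT x|lborel. \<bar>U t x\<bar>) \<le> a + 1" if t: "0 \<le> t" for t
  proof -
    \<comment> \<open>the barrier \<open>s \<mapsto> a + s / (t + 1)\<close> is at most \<open>a + 1\<close> at time \<open>t\<close>\<close>
    have "L1.energy (U t) \<le> a + t * (1 / (t + 1))"
    proof (rule comparison_principle[where \<Phi> = "\<lambda>s. L1.energy (U s)" and P = "\<lambda>s. L1.energy (Kop (U s))" and \<beta> = "\<lambda>s. a + s * (1 / (t + 1))" and \<beta>' = "\<lambda>_. 1 / (t + 1)"])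
      show "L1.energy (Kop (U s)) - L1.energy (U s) < 1 / (t + 1)" if "0 \<le> s" for s
      proof -
        have "L1.energy (Kop (U s)) \<le> L1.energy (U s)"
          using Kop_L1(2)[OF iU[OF that]] by (simp add: L1.energy_def)
        moreover have "0 < 1 / (t + 1)" using t by simp
        ultimately show ?thesis by linarith
      qed
      show "((\<lambda>s. a + s * (1 / (t + 1))) has_real_derivative 1 / (t + 1)) (at s)" for s
        using t by (auto intro!: derivative_eq_intros)
      show "L1.energy (U 0) \<le> a + 0 * (1 / (t + 1))" using a by (simp add: L1.energy_def)
    qed (use L1.energy_right_step L1.energy_left_lsc t in auto)
    also have "\<dots> \<le> a + 1" using t by (simp add: field_simps)
    finally show ?thesis by (simp add: L1.energy_def)
  qed
  \<comment> \<open>the weight is adapted to the final time, so that the exponent \<open>\<mu> T\<close> of the barrier is bounded\<close>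
  define \<nu> where "\<nu> = 1 / (1 + T)"
  have nu: "0 < \<nu>" "\<nu> \<le> 1" using T by (auto simp: \<nu>_def)
  obtain w where w_borel [measurable]: "w \<in> borel_measurable borel" and w1: "\<And>x. c1 \<le> w x" and w2: "\<And>x. w x \<le> c2"
    and wK: "\<And>x. (\<integral>\<^sup>+y. k x y * w y \<partial>lborel) \<le> ennreal ((1 + \<nu>) * w x)"
    using exists_weight[OF nu] unfolding c1_def c2_def by blast
  have w0: "0 < w x" for x using w1[of x] c1 by linarith
  define W where "W = (\<lambda>x. w x powr (1 - p))"
  interpret Lp: energy_curve p "c1 powr (1 - p)" W U "\<lambda>t. Kop (U t)"
  proof
    show "W x \<le> c1 powr (1 - p)" for x unfolding W_def using w1 c1 p by (intro powr_mono2') auto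
    show "integrable lborel (\<lambda>x. \<bar>Kop (U t) x\<bar> powr p)" if "0 \<le> t" for t
      by (rule Kop_Lp[OF p nu w_borel c1 w1 w2 wK iU[OF that] Up[OF that]])
    show "W \<in> borel_measurable lborel" unfolding W_def by measurable
  qed (use Up limp p in \<open>auto simp: W_def\<close>)
  have energy_w: "Lp.energy f = (LINT x|lborel. w x powr (1 - p) * \<bar>f x\<bar> powr p)" for f
    unfolding Lp.energy_def by (simp only: W_def)
  define \<mu> where "\<mu> = (1 + \<nu>) powr (p - 1) - 1"
  have mu0: "0 \<le> \<mu>" unfolding \<mu>_def using nu p by (simp add: ge_one_powr_ge_zero)
  have muT: "\<mu> * T \<le> 2 powr (p - 1)"
  proof -
    have "\<bar>(1 - \<nu>) * 1 + \<nu> * 2\<bar> powr (p - 1) \<le> (1 - \<nu>) * \<bar>1\<bar> powr (p - 1) + \<nu> * \<bar>2\<bar> powr (p - 1)"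
      using nu p by (intro abs_powr_convex) auto
    moreover have "\<bar>(1 - \<nu>) * 1 + \<nu> * 2\<bar> = 1 + \<nu>" using nu by simp
    ultimately have "\<mu> \<le> \<nu> * 2 powr (p - 1)" using nu by (simp add: \<mu>_def add.commute)
    then have "\<mu> * T \<le> \<nu> * 2 powr (p - 1) * T" using T by (intro mult_right_mono)
    also have "\<dots> = (\<nu> * T) * 2 powr (p - 1)" by simp
    also have "\<dots> \<le> 1 * 2 powr (p - 1)" using T by (intro mult_right_mono) (auto simp: \<nu>_def)
    finally show ?thesis by simp
  qed
  define \<gamma> where "\<gamma> = (p - 1) / 2"
  define \<beta> where "\<beta> = (\<lambda>t. exp (\<mu> * t) * (C * (K + t) powr (- \<gamma>)))"
  have "Lp.energy (U T) \<le> \<beta> T"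
  proof (rule comparison_principle[where \<Phi> = "\<lambda>s. Lp.energy (U s)" and \<beta> = \<beta> and P = "\<lambda>s. Lp.energy (Kop (U s))" and \<beta>' = "\<lambda>t. \<mu> * \<beta> t - \<gamma> * \<beta> t / (K + t)"])
    have "Lp.energy (U 0) \<le> (LINT x|lborel. c1 powr (1 - p) * \<bar>U 0 x\<bar> powr p)"
      unfolding Lp.energy_def
    proof (intro integral_mono)
      show "integrable lborel (\<lambda>x. W x * \<bar>U 0 x\<bar> powr p)"
        using Lp.W Up[of 0] by (intro integrable_weight_mult[OF Lp.W_borel]) auto
      show "W x * \<bar>U 0 x\<bar> powr p \<le> c1 powr (1 - p) * \<bar>U 0 x\<bar> powr p" for x
        using Lp.W by (intro mult_right_mono) auto
    qed (use Up[of 0] in auto)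
    then show "Lp.energy (U 0) \<le> \<beta> 0" using init by (simp add: \<beta>_def \<gamma>_def)
    show "(\<beta> has_real_derivative \<mu> * \<beta> t - \<gamma> * \<beta> t / (K + t)) (at t)" if "0 \<le> t" for t
    proof -
      have Kt: "0 < K + t" using K that by simp
      have "(K + t) powr (- \<gamma> - 1) = (K + t) powr (- \<gamma>) / (K + t)" using Kt by (simp add: powr_diff)
      then show ?thesis unfolding \<beta>_def using Kt
        by (auto intro!: derivative_eq_intros simp: algebra_simps)
    qed
    show "Lp.energy (Kop (U t)) - Lp.energy (U t) < \<mu> * \<beta> t - \<gamma> * \<beta> t / (K + t)"
      if t: "0 \<le> t" and eq: "Lp.energy (U t) = \<beta> t" for t
    proof -
      have Kt: "0 < K + t" using K t by simp
      define F where "F = Lp.energy (U t)"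
      have Fge: "C * (K + t) powr (- \<gamma>) \<le> F"
      proof -
        have "1 \<le> exp (\<mu> * t)" using mu0 t by simp
        then have "1 * (C * (K + t) powr (- \<gamma>)) \<le> \<beta> t" unfolding \<beta>_def using C by (intro mult_right_mono) auto
        then show ?thesis using eq by (simp add: F_def)
      qed
      have F0: "0 < F" using Fge C Kt by (smt (verit) mult_pos_pos powr_gt_zero)
      define D where "D = (c1 * k0 * \<rho> / c2)\<^sup>2 / 8 * F / (1 + B * F powr (- 1 / (p - 1)))\<^sup>2"
      have D0: "0 \<le> D" unfolding D_def using F0 by auto
      have bar: "\<gamma> * F / (K + t) < D" unfolding D_def \<gamma>_def using barrier[OF t] Fge by (simp add: \<gamma>_def)
      have "Lp.energy (Kop (U t)) \<le> (1 + \<nu>) powr (p - 1) * (F - D)"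
        unfolding D_def F_def energy_w B
      proof (rule energy_dissipation[OF p nu w_borel c1 w1 w2 wK iU[OF t] Up[OF t]])
        show "0 < A" using a0 c1 by (simp add: A)
        show "(LINT x|lborel. \<bar>U t x\<bar>) \<le> c1 * A" using L1b[OF t] c1 by (simp add: A)
        show "0 < (LINT x|lborel. w x powr (1 - p) * \<bar>U t x\<bar> powr p)"
          using F0 by (simp add: F_def energy_w)
      qed
      also have "\<dots> = F + \<mu> * F - (1 + \<mu>) * D" by (simp add: \<mu>_def algebra_simps)
      also have "\<dots> \<le> F + \<mu> * F - D" using mu0 D0 by (simp add: algebra_simps)
      finally have "Lp.energy (Kop (U t)) - F < \<mu> * F - \<gamma> * F / (K + t)" using bar by linarith
      then show ?thesis unfolding F_def eq .
    qed
  qed (use Lp.energy_right_step Lp.energy_left_lsc T in auto)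
  also have "\<beta> T \<le> exp (2 powr (p - 1)) * (C * (1 + T) powr (- \<gamma>))"
  proof -
    have "(K + T) powr (- \<gamma>) \<le> (1 + T) powr (- \<gamma>)" using K T p by (intro powr_mono2') (auto simp: \<gamma>_def)
    then show ?thesis unfolding \<beta>_def using muT C by (intro mult_mono) auto
  qed
  finally have E: "Lp.energy (U T) \<le> exp (2 powr (p - 1)) * (C * (1 + T) powr (- \<gamma>))" .
  have "(LINT x|lborel. \<bar>U T x\<bar> powr p) \<le> (LINT x|lborel. c2 powr (p - 1) * (W x * \<bar>U T x\<bar> powr p))"
  proof (intro integral_mono)
    show "integrable lborel (\<lambda>x. c2 powr (p - 1) * (W x * \<bar>U T x\<bar> powr p))"
      using Lp.W Up[OF T] by (intro integrable_mult_right integrable_weight_mult[OF Lp.W_borel]) auto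
    fix x
    have "1 = w x powr (p - 1) * w x powr (1 - p)" using w0[of x] by (simp flip: powr_add)
    also have "\<dots> \<le> c2 powr (p - 1) * w x powr (1 - p)"
      using w0[of x] w2[of x] p by (intro mult_right_mono powr_mono2) auto
    finally have "1 * \<bar>U T x\<bar> powr p \<le> c2 powr (p - 1) * w x powr (1 - p) * \<bar>U T x\<bar> powr p"
      by (intro mult_right_mono) auto
    then show "\<bar>U T x\<bar> powr p \<le> c2 powr (p - 1) * (W x * \<bar>U T x\<bar> powr p)" by (simp add: W_def mult.assoc)
  qed (use Up[OF T] in auto)
  also have "\<dots> = c2 powr (p - 1) * Lp.energy (U T)" by (simp add: Lp.energy_def)
  also have "\<dots> \<le> c2 powr (p - 1) * (exp (2 powr (p - 1)) * (C * (1 + T) powr (- \<gamma>)))"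
    by (intro mult_left_mono E) auto
  finally show ?thesis by (simp add: \<gamma>_def mult.assoc)
qed

end

section \<open>The rescaled kernel\<close>

text \<open>
  Lebesgue measurable functions may be replaced by Borel representatives, for which product measures
  and Tonelli's theorem are available.
\<close>
lemma lborel_representative:
  assumes "f \<in> borel_measurable lebesgue" "g \<in> borel_measurable lborel" "AE x in lebesgue. f x = (g x :: real)"
    and [measurable]: "h \<in> borel_measurable borel"
  shows "integrable lebesgue (\<lambda>x. h (f x) :: real) \<longleftrightarrow> integrable lborel (\<lambda>x. h (g x))"
    and "(LINT x|lebesgue. h (f x)) = (LINT x|lborel. h (g x))"
proof -
  note [measurable] = assms(1,2)
  have g: "g \<in> borel_measurable lebesgue" by (rule measurable_completion) (use assms in simp)
  have hf: "(\<lambda>x. h (f x)) \<in> borel_measurable lebesgue" by (rule measurable_compose[OF assms(1,4)])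
  have hg: "(\<lambda>x. h (g x)) \<in> borel_measurable lebesgue" by (rule measurable_compose[OF g assms(4)])
  have hg': "(\<lambda>x. h (g x)) \<in> borel_measurable lborel" by measurable
  have ae: "AE x in lebesgue. h (f x) = h (g x)" using assms(3) by eventually_elim simp
  show "integrable lebesgue (\<lambda>x. h (f x) :: real) \<longleftrightarrow> integrable lborel (\<lambda>x. h (g x))"
    using integrable_cong_AE[OF hf hg ae] integrable_completion[OF hg'] by simp
  show "(LINT x|lebesgue. h (f x)) = (LINT x|lborel. h (g x))"
    using integral_cong_AE[OF hf hg ae] integral_completion[OF hg'] by simp
qed

lemma Lq_norm_powr:
  assumes "0 < q"
  shows "Lq_norm q f powr q = (LINT x|lebesgue. \<bar>f x\<bar> powr q)"
  unfolding Lq_norm_def using assms by (simp add: powr_powr integral_nonneg_AE)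

text \<open>
  The kernel of the equation is an even jump kernel, with constants that depend on \<open>g\<close> only through \<open>M\<close>.
\<close>
lemma jump_kernel_rescaled:
  fixes J g :: "real \<Rightarrow> real"
  assumes cont: "continuous_on UNIV J" "continuous_on UNIV g"
    and J: "\<And>x. J (- x) = J x" "\<And>x. 0 \<le> J x" "\<And>x. J x \<le> b" "\<And>x. 1 < \<bar>x\<bar> \<Longrightarrow> J x = 0"
    and int: "(\<integral>\<^sup>+x. J x \<partial>lborel) = 1"
    and r: "0 < r" "0 < R" "\<And>z. \<bar>z\<bar> < R \<Longrightarrow> r \<le> J z"
    and M: "0 < M" and g: "\<And>x. 1 / M \<le> g x" "\<And>x. g x \<le> M"
  shows "jump_kernel (\<lambda>x y. J ((x - y) / g y) / g y) (r / M) (b * M) M (R / M)"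
proof
  have [measurable]: "J \<in> borel_measurable borel" "g \<in> borel_measurable borel"
    using cont by (auto intro: borel_measurable_continuous_onI)
  have g0: "0 < g x" for x using g(1)[of x] M by (smt (verit) divide_pos_pos)
  have ginv: "1 / g x \<le> M" for x using g(1)[of x] g0[of x] M by (simp add: field_simps)
  have ginv': "1 / M \<le> 1 / g x" for x using g(2)[of x] g0[of x] M by (simp add: field_simps)
  show "(\<lambda>(x, y). J ((x - y) / g y) / g y) \<in> borel_measurable (borel \<Otimes>\<^sub>M borel)" by measurable
  show "0 \<le> J ((x - y) / g y) / g y" for x y using J g0[of y] by simp
  show "J ((x - y) / g y) / g y \<le> b * M" for x y
  proof -
    have "J ((x - y) / g y) * (1 / g y) \<le> b * M"
      using J(2,3) ginv[of y] g0[of y] by (intro mult_mono) (auto intro: order_trans)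
    then show ?thesis by simp
  qed
  show "r / M \<le> J ((x - y) / g y) / g y" if "\<bar>x - y\<bar> < R / M" for x y
  proof -
    have "\<bar>(x - y) / g y\<bar> = \<bar>x - y\<bar> * (1 / g y)" using g0[of y] by (simp add: abs_divide)
    also have "\<dots> \<le> \<bar>x - y\<bar> * M" using ginv by (intro mult_left_mono) auto
    also have "\<dots> < R" using that M by (simp add: field_simps)
    finally have "r * (1 / M) \<le> J ((x - y) / g y) * (1 / g y)"
      using r ginv'[of y] M J by (intro mult_mono) auto
    then show ?thesis by simp
  qed
  show "J ((x - y) / g y) / g y = 0" if "M < \<bar>x - y\<bar>" for x y
  proof -
    have "1 < \<bar>x - y\<bar> / g y" using that g(2)[of y] g0[of y] by simp
    then have "1 < \<bar>(x - y) / g y\<bar>" using g0[of y] by (simp add: abs_divide)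
    then show ?thesis using J(4) by simp
  qed
  show "J ((y + h - y) / g y) / g y = J ((y - h - y) / g y) / g y" for y h
    using J(1)[of "h / g y"] by simp
  show "(\<integral>\<^sup>+x. J ((x - y) / g y) / g y \<partial>lborel) = 1" for y
  proof -
    have "(\<integral>\<^sup>+x. J ((x - y) / g y) / g y \<partial>lborel) = ennreal \<bar>g y\<bar> * (\<integral>\<^sup>+x. J ((y + g y * x - y) / g y) / g y \<partial>lborel)"
      using nn_integral_real_affine[of "\<lambda>x. ennreal (J ((x - y) / g y) / g y)" "g y" y] g0[of y] by simp
    also have "\<dots> = (\<integral>\<^sup>+x. ennreal \<bar>g y\<bar> * (J x / g y) \<partial>lborel)"
      using g0[of y] by (simp add: nn_integral_cmult)
    also have "\<dots> = (\<integral>\<^sup>+x. J x \<partial>lborel)"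
      using g0[of y] J by (intro nn_integral_cong) (simp add: ennreal_mult[symmetric])
    finally show ?thesis using int by simp
  qed
qed (use r M in auto)

theorem theorem4p3:
  fixes p M a b :: real and J :: "real \<Rightarrow> real"
  assumes "p \<ge> 2"
    and "\<forall>x. J (- x) = J x"
    and "smooth_fun J"
    and "bounded (range J)"
    and "\<forall>x. J x \<ge> 0"
    and "integrable lebesgue J"
    and "(LINT x|lebesgue. J x) = 1"
    and "closure {x. J x \<noteq> 0} = {-1..1}"
    and "\<exists>r>0. \<exists>R>0. \<forall>z. \<bar>z\<bar> < R \<longrightarrow> J z \<ge> r"
    and "M > 0"
  shows "\<exists>C>0. \<forall>g u0 u.
           continuous_on UNIV g \<longrightarrow>
           (\<forall>x. 1 / M \<le> g x \<and> g x \<le> M) \<longrightarrow>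
           in_L1_Lp p u0 \<longrightarrow> Lq_norm 1 u0 = a \<longrightarrow> Lq_norm p u0 = b \<longrightarrow>
           is_solution p J g u0 u \<longrightarrow>
           (\<forall>t\<ge>0. Lq_norm p (u t) powr p \<le> C * (1 + t) powr (- ((p - 1) / 2)))"
proof -
  note p = \<open>p \<ge> 2\<close> and M = \<open>M > 0\<close>
  have contJ: "continuous_on UNIV J"
  proof -
    have "J field_differentiable at x" for x
      using \<open>smooth_fun J\<close> unfolding smooth_fun_def by (metis funpow_0)
    then show ?thesis by (simp add: continuous_at_imp_continuous_on field_differentiable_imp_continuous_at)
  qed
  have [measurable]: "J \<in> borel_measurable borel" using contJ by (rule borel_measurable_continuous_onI)
  obtain Jb where Jb: "\<And>x. J x \<le> Jb"
    using \<open>bounded (range J)\<close> unfolding bounded_iff by (metis abs_le_D1 rangeI real_norm_def)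
  have supp: "J x = 0" if "1 < \<bar>x\<bar>" for x
  proof (rule ccontr)
    assume "J x \<noteq> 0"
    then have "x \<in> closure {x. J x \<noteq> 0}" using subsetD[OF closure_subset, of x "{x. J x \<noteq> 0}"] by simp
    then show False using that assms(8) by auto
  qed
  have intJ: "(\<integral>\<^sup>+x. J x \<partial>lborel) = 1"
  proof -
    have J': "J \<in> borel_measurable lborel" by simp
    have "(\<integral>\<^sup>+x. J x \<partial>lborel) = ennreal (LINT x|lborel. J x)"
      using assms(5,6) integrable_completion[OF J'] by (intro nn_integral_eq_integral) auto
    then show ?thesis using assms(7) integral_completion[OF J'] by simp
  qed
  obtain r R where r: "0 < r" "0 < R" "\<And>z. \<bar>z\<bar> < R \<Longrightarrow> r \<le> J z" using assms(9) by blast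
  define k0 k1 \<rho> where "k0 = r / M" and "k1 = Jb * M" and "\<rho> = R / M"
  have kernel: "jump_kernel (\<lambda>x y. J ((x - y) / g y) / g y) k0 k1 M \<rho>"
    if "continuous_on UNIV g" "\<forall>x. 1 / M \<le> g x \<and> g x \<le> M" for g
    unfolding k0_def k1_def \<rho>_def
    using jump_kernel_rescaled[OF contJ that(1) _ _ Jb supp intJ r M] assms(2,5) that(2) by blast
  define c1 c2 where "c1 = weight_lower k0 M \<rho>" and "c2 = weight_upper k0 k1 M \<rho>"
  have pos: "0 < k0" "0 < \<rho>" using r M by (auto simp: k0_def \<rho>_def)
  have "0 \<le> Jb" using assms(5) Jb order_trans by blast
  then have "0 \<le> k1" using M by (simp add: k1_def)
  have c12: "0 < c1" "0 < c2"
    unfolding c1_def c2_def using pos M \<open>0 \<le> k1\<close> by (auto intro: weight_lower_pos weight_upper_pos)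
  define A B where "A = (\<bar>a\<bar> + 1) / c1" and "B = 8 * A * (A * c2) powr (1 / (p - 1)) / \<rho>"
  have "0 < A" using c12 by (simp add: A_def)
  then have "0 < B" using c12 pos by (simp add: B_def)
  have "0 < (c1 * k0 * \<rho> / c2)\<^sup>2 / 8" using c12 pos by simp
  then obtain C K where C: "0 < C" and K: "1 \<le> K"
    and init: "c1 powr (1 - p) * b powr p \<le> C * K powr (- ((p - 1) / 2))"
    and barrier: "\<And>t F. 0 \<le> t \<Longrightarrow> C * (K + t) powr (- ((p - 1) / 2)) \<le> F \<Longrightarrow>
        (p - 1) / 2 * F / (K + t) < (c1 * k0 * \<rho> / c2)\<^sup>2 / 8 * F / (1 + B * F powr (- 1 / (p - 1)))\<^sup>2"
    using barrier_constants[OF p _ \<open>0 < B\<close>, of "(c1 * k0 * \<rho> / c2)\<^sup>2 / 8" "c1 powr (1 - p) * b powr p"] by auto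
  define C' where "C' = c2 powr (p - 1) * (exp (2 powr (p - 1)) * C)"
  have C': "0 < C'" using C c12 by (simp add: C'_def)
  have "Lq_norm p (u T) powr p \<le> C' * (1 + T) powr (- ((p - 1) / 2))"
    if g: "continuous_on UNIV g" "\<forall>x. 1 / M \<le> g x \<and> g x \<le> M"
      and u0: "in_L1_Lp p u0" "Lq_norm 1 u0 = a" "Lq_norm p u0 = b"
      and sol: "is_solution p J g u0 u" and T: "0 \<le> T" for g u0 u T
  proof -
    interpret jump_kernel "\<lambda>x y. J ((x - y) / g y) / g y" k0 k1 M \<rho> by (rule kernel[OF g])
    have [measurable]: "g \<in> borel_measurable borel" using g(1) by (rule borel_measurable_continuous_onI)
    obtain v where v: "C1_with_deriv p u v"
      and eq: "\<And>t. 0 \<le> t \<Longrightarrow> AE x in lebesgue. v t x = (LINT y|lebesgue. J ((x - y) / g y) * (u t y / g y)) - u t x"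
      and u_init: "AE x in lebesgue. u 0 x = u0 x"
      using sol unfolding is_solution_def by blast
    have uv: "u t \<in> borel_measurable lebesgue" "v t \<in> borel_measurable lebesgue" if "0 \<le> t" for t
      using v that unfolding C1_with_deriv_def in_L1_Lp_def in_Lq_def by auto
    have "\<exists>f. f \<in> borel_measurable lborel \<and> (0 \<le> t \<longrightarrow> (AE x in lebesgue. u t x = f x))" for t
    proof (cases "0 \<le> t")
      case True
      then obtain f where "f \<in> borel_measurable lborel" "AE x in lborel. u t x = f x"
        using completion_ex_borel_measurable_real[OF uv(1)] by blast
      then show ?thesis using AE_completion by blast
    qed (auto intro: exI[of _ "\<lambda>_. 0"])
    then obtain U where U: "\<And>t. U t \<in> borel_measurable lborel"
      and uU: "\<And>t. 0 \<le> t \<Longrightarrow> AE x in lebesgue. u t x = U t x" by metis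
    note [measurable] = U
    have U_int: "integrable lborel (\<lambda>x. \<bar>U t x\<bar> powr q)" if "0 \<le> t" "q = 1 \<or> q = p" for t q
    proof -
      have "integrable lebesgue (\<lambda>x. \<bar>u t x\<bar> powr q)"
        using v that unfolding C1_with_deriv_def in_L1_Lp_def in_Lq_def by auto
      then show ?thesis
        using lborel_representative(1)[OF uv(1)[OF that(1)] U uU[OF that(1)], of "\<lambda>z. \<bar>z\<bar> powr q"] by simp
    qed
    have Kop_u: "(LINT y|lebesgue. J ((x - y) / g y) * (u t y / g y)) = Kop (U t) x" if "0 \<le> t" for t x
    proof -
      have gl: "g \<in> borel_measurable lebesgue" by (rule measurable_completion) simp
      have "(LINT y|lebesgue. J ((x - y) / g y) * (u t y / g y)) = (LINT y|lebesgue. J ((x - y) / g y) / g y * U t y)"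
      proof (rule integral_cong_AE)
        show "AE y in lebesgue. J ((x - y) / g y) * (u t y / g y) = J ((x - y) / g y) / g y * U t y"
          using uU[OF that] by eventually_elim simp
        have k': "(\<lambda>y. J ((x - y) / g y)) \<in> borel_measurable lebesgue"
          by (rule measurable_completion) simp
        show "(\<lambda>y. J ((x - y) / g y) * (u t y / g y)) \<in> borel_measurable lebesgue"
          using k' gl uv(1)[OF that] by (intro borel_measurable_times borel_measurable_divide)
        show "(\<lambda>y. J ((x - y) / g y) / g y * U t y) \<in> borel_measurable lebesgue"
          by (rule measurable_completion) measurable
      qed
      also have "\<dots> = Kop (U t) x"
        unfolding Kop_def by (rule integral_completion) measurable
      finally show ?thesis .
    qed
    have lim: "((\<lambda>s. LINT x|lborel. \<bar>(U s x - U t x) / (s - t) - (Kop (U t) x - U t x)\<bar> powr q) \<longlongrightarrow> 0) (at t within {0..})"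
      if t: "0 \<le> t" and q: "q = 1 \<or> q = p" for t q
    proof -
      define N where "N = (\<lambda>s. Lq_norm q (\<lambda>x. (u s x - u t x) / (s - t) - v t x))"
      have lim0: "((\<lambda>s. L1_Lp_norm p (\<lambda>x. (u s x - u t x) / (s - t) - v t x)) \<longlongrightarrow> 0) (at t within {0..})"
        using v t unfolding C1_with_deriv_def by blast
      have "(N \<longlongrightarrow> 0) (at t within {0..})"
      proof (rule tendsto_sandwich[OF _ _ tendsto_const lim0])
        show "\<forall>\<^sub>F s in at t within {0..}. 0 \<le> N s" by (simp add: N_def Lq_norm_def)
        show "\<forall>\<^sub>F s in at t within {0..}. N s \<le> L1_Lp_norm p (\<lambda>x. (u s x - u t x) / (s - t) - v t x)"
          using q by (auto simp: N_def L1_Lp_norm_def Lq_norm_def)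
      qed
      then have "((\<lambda>s. N s powr q) \<longlongrightarrow> 0 powr q) (at t within {0..})"
        using p q by (intro tendsto_powr') (auto simp: N_def Lq_norm_def)
      then have lim1: "((\<lambda>s. N s powr q) \<longlongrightarrow> 0) (at t within {0..})" by simp
      have "N s powr q = (LINT x|lborel. \<bar>(U s x - U t x) / (s - t) - (Kop (U t) x - U t x)\<bar> powr q)" if s: "0 \<le> s" for s
      proof -
        have "N s powr q = (LINT x|lebesgue. \<bar>(u s x - u t x) / (s - t) - v t x\<bar> powr q)"
          unfolding N_def using p q by (intro Lq_norm_powr) auto
        also have "\<dots> = (LINT x|lborel. \<bar>(U s x - U t x) / (s - t) - (Kop (U t) x - U t x)\<bar> powr q)"
        proof (rule lborel_representative(2)[where h = "\<lambda>z. \<bar>z\<bar> powr q"])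
          show "(\<lambda>x. (u s x - u t x) / (s - t) - v t x) \<in> borel_measurable lebesgue"
            using uv(1)[OF s] uv(1)[OF t] uv(2)[OF t]
            by (intro borel_measurable_diff borel_measurable_divide borel_measurable_const)
          show "(\<lambda>x. (U s x - U t x) / (s - t) - (Kop (U t) x - U t x)) \<in> borel_measurable lborel"
            using Kop_measurable[of "U t"] U by simp
          show "AE x in lebesgue. (u s x - u t x) / (s - t) - v t x = (U s x - U t x) / (s - t) - (Kop (U t) x - U t x)"
            using uU[OF s] uU[OF t] eq[OF t] by eventually_elim (simp only: Kop_u[OF t])
        qed measurable
        finally show ?thesis .
      qed
      then show ?thesis
        using lim1 by (subst tendsto_cong[where g = "\<lambda>s. N s powr q"]) (auto simp: eventually_at_filter)
    qed
    have U0: "(LINT x|lborel. \<bar>U 0 x\<bar> powr q) = Lq_norm q u0 powr q" if q: "q = 1 \<or> q = p" for q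
    proof -
      have u0m: "u0 \<in> borel_measurable lebesgue" using u0(1) by (simp add: in_L1_Lp_def in_Lq_def)
      have "AE x in lebesgue. u0 x = U 0 x" using u_init uU[OF order_refl] by eventually_elim simp
      then have "(LINT x|lebesgue. \<bar>u0 x\<bar> powr q) = (LINT x|lborel. \<bar>U 0 x\<bar> powr q)"
        by (intro lborel_representative(2)[OF u0m U, where h = "\<lambda>z. \<bar>z\<bar> powr q"]) auto
      then show ?thesis using p q Lq_norm_powr[of q u0] by auto
    qed
    have a0: "0 \<le> a" using u0(2) by (auto simp: Lq_norm_def)
    have "(LINT x|lborel. \<bar>U T x\<bar> powr p) \<le> C' * (1 + T) powr (- ((p - 1) / 2))"
      unfolding C'_def c2_def
    proof (rule energy_decay[OF p T, where a = "\<bar>a\<bar>" and K = K and A = A and B = B])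
      show "(LINT x|lborel. \<bar>U 0 x\<bar> powr 1) \<le> \<bar>a\<bar>" using U0[of 1] u0(2) a0 by simp
      show "weight_lower k0 M \<rho> powr (1 - p) * (LINT x|lborel. \<bar>U 0 x\<bar> powr p) \<le> C * K powr (- ((p - 1) / 2))"
        using init U0[of p] u0(3) by (simp add: c1_def)
      show "U t \<in> borel_measurable borel" for t using U[of t] by simp
      show "integrable lborel (\<lambda>x. \<bar>U t x\<bar> powr 1)" "integrable lborel (\<lambda>x. \<bar>U t x\<bar> powr p)" if "0 \<le> t" for t
        using U_int[OF that, of 1] U_int[OF that, of p] by blast+
      show "((\<lambda>s. LINT x|lborel. \<bar>(U s x - U t x) / (s - t) - (Kop (U t) x - U t x)\<bar> powr 1) \<longlongrightarrow> 0) (at t within {0..})"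
        "((\<lambda>s. LINT x|lborel. \<bar>(U s x - U t x) / (s - t) - (Kop (U t) x - U t x)\<bar> powr p) \<longlongrightarrow> 0) (at t within {0..})"
        if "0 \<le> t" for t
        using lim[OF that, of 1] lim[OF that, of p] by blast+
      show "A = (\<bar>a\<bar> + 1) / weight_lower k0 M \<rho>" by (simp only: A_def c1_def)
      show "B = 8 * A * (A * weight_upper k0 k1 M \<rho>) powr (1 / (p - 1)) / \<rho>" by (simp only: B_def c2_def)
    qed (rule C K barrier[unfolded c1_def c2_def]; assumption)+
    also have "(LINT x|lborel. \<bar>U T x\<bar> powr p) = Lq_norm p (u T) powr p"
      using p Lq_norm_powr[of p "u T"] lborel_representative(2)[OF uv(1)[OF T] U uU[OF T], of "\<lambda>z. \<bar>z\<bar> powr p"] by simp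
    finally show ?thesis .
  qed
  then show ?thesis using C' by blast
qed

end
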